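(* Let $\mathcal{H}$ be a real Hilbert space, let $\mathcal{Z}\subseteq\mathcal{H}$ be nonempty, closed and convex, and let $0<T<\infty$. Then the play operator $\mathsf{P}:\mathcal{Z}\times BV^{r}([0,T];\mathcal{H})\to BV^{r}([0,T];\mathcal{H})$ with characteristic $\mathcal{Z}$ is continuous when $BV^{r}([0,T];\mathcal{H})$ is endowed (both in the domain and in the codomain) with the topology induced by the norm $\|f\|_{BV}:=\|f\|_\infty+V(f,[0,T])$, and $\mathcal{Z}$ carries the topology induced by the norm of $\mathcal{H}$.
   Context: $\mathcal{H}$ is a real Hilbert space with inner product $\langle\cdot,\cdot\rangle$ and norm $\|\cdot\|$; no separability is assumed. For an interval $J$, $V(f,J)$ is the pointwise variation of $f$ on $J$, i.e. the supremum of $\sum_{j=1}^m\|f(t_j)-f(t_{j-1})\|$ over all $t_0<\dots<t_m$ in $J$, and $\|f\|_\infty=\sup_{t}\|f(t)\|$. $BV^{r}([0,T];\mathcal{H})$ is the set of functions $f:[0,T]\to\mathcal{H}$ with $V(f,[0,T])<\infty$ that are right continuous (with the convention $f(T+):=f(T)$; also $f(0-):=f(0)$). Functions equal a.e. are not identified. For $f\in BV^r([0,T];\mathcal{H})$, $\mathrm{D}f$ denotes its differential (Lebesgue–Stieltjes) measure: the unique $\mathcal{H}$-valued Borel measure of bounded variation on $[0,T]$ with $\mathrm{D}f([c,d])=f(d)-f(c-)$ and $\mathrm{D}f(]c,d])=f(d)-f(c)$ for $c<d$ (so $\mathrm{D}f(\{0\})=0$). For a nonempty closed convex set $\mathcal{K}\subseteq\mathcal{H}$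 and $x\in\mathcal{K}$, $N_{\mathcal{K}}(x):=\{p\in\mathcal{H}:\langle p,k-x\rangle\le 0\ \forall k\in\mathcal{K}\}$ is the normal cone (the subdifferential of the indicator function of $\mathcal{K}$). Play operator: for $z_0\in\mathcal{Z}$ and $u\in BV^r([0,T];\mathcal{H})$, $\mathsf{P}(z_0,u)$ is the unique $y\in BV^r([0,T];\mathcal{H})$ (existence and uniqueness are a known theorem of Moreau) for which there exist a finite positive Borel measure $\mu$ on $[0,T]$ and $v\in L^1(\mu;\mathcal{H})$ such that: $y(t)\in u(t)-\mathcal{Z}$ for all $t\in[0,T]$; $\mathrm{D}y=v\mu$; $-v(t)\in N_{u(t)-\mathcal{Z}}(y(t))$ for $\mu$-a.e. $t\in[0,T]$; and $y(0)=u(0)-z_0$. That is, $\mathsf{P}(z_0,u)$ is the solution of the sweeping process driven by the moving convex set $\mathcal{C}_u(t)=u(t)-\mathcal{Z}$ with initial value $u(0)-z_0$. *)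

theory Defs
  imports "HOL-Analysis.Analysis"
begin

section \<open>Functions of bounded variation\<close>

definition variation :: "(real \<Rightarrow> 'a::real_normed_vector) \<Rightarrow> real set \<Rightarrow> ennreal" where
  "variation f J =
     (SUP (m, t) \<in> {(m :: nat, t :: nat \<Rightarrow> real). strict_mono_on {..m} t \<and> t ` {..m} \<subseteq> J}.
        \<Sum>j<m. ennreal (norm (f (t (Suc j)) - f (t j))))"

text \<open>
  A function on the interval \<open>[0,T]\<close> is represented by its extensional version (value
  \<^const>\<open>undefined\<close> off the interval), so that equality of functions is equality on the interval.
  Right continuity at \<open>T\<close> is void by the convention \<open>f(T+) = f(T)\<close>.
\<close>

definition BVr :: "real \<Rightarrow> (real \<Rightarrow> 'a::real_normed_vector) set" where
  "BVr T = {f \<in> extensional {0..T}.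
     variation f {0..T} < \<infinity> \<and> (\<forall>t\<in>{0..<T}. (f \<longlongrightarrow> f t) (at_right t))}"

text \<open>
  Suprema are taken in \<^typ>\<open>ennreal\<close>, where they always exist; on \<^const>\<open>BVr\<close> both summands are
  finite, so that \<^const>\<open>enn2real\<close> loses nothing there.
\<close>

definition bv_norm :: "real \<Rightarrow> (real \<Rightarrow> 'a::real_normed_vector) \<Rightarrow> real" where
  "bv_norm T f = enn2real ((SUP t\<in>{0..T}. ennreal (norm (f t))) + variation f {0..T})"

definition bv_dist ::
    "real \<Rightarrow> (real \<Rightarrow> 'a::real_normed_vector) \<Rightarrow> (real \<Rightarrow> 'a) \<Rightarrow> real" where
  "bv_dist T f g = bv_norm T (\<lambda>t. f t - g t)"

lemma variation_triangle:
  "variation (\<lambda>t. f t + g t) J \<le> variation f J + variation g J"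
  unfolding variation_def
proof (rule SUP_least, clarify)
  fix m :: nat and t :: "nat \<Rightarrow> real"
  assume t: "strict_mono_on {..m} t" "t ` {..m} \<subseteq> J"
  let ?P = "{(m :: nat, t :: nat \<Rightarrow> real). strict_mono_on {..m} t \<and> t ` {..m} \<subseteq> J}"
  let ?S = "\<lambda>f :: real \<Rightarrow> 'a. \<lambda>(m, t). \<Sum>j<m. ennreal (norm (f (t (Suc j)) - f (t j)))"
  have mem: "(m, t) \<in> ?P"
    using t by simp
  have "(\<Sum>j<m. ennreal (norm (f (t (Suc j)) + g (t (Suc j)) - (f (t j) + g (t j)))))
      \<le> (\<Sum>j<m. ennreal (norm (f (t (Suc j)) - f (t j))) + ennreal (norm (g (t (Suc j)) - g (t j))))"
    by (intro sum_mono) (simp add: ennreal_plus[symmetric] norm_diff_triangle_ineq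
        del: ennreal_plus)
  also have "\<dots> = ?S f (m, t) + ?S g (m, t)"
    by (simp add: sum.distrib)
  also have "\<dots> \<le> (SUP p\<in>?P. ?S f p) + (SUP p\<in>?P. ?S g p)"
    by (intro add_mono SUP_upper mem)
  finally show "(\<Sum>j<m. ennreal (norm (f (t (Suc j)) + g (t (Suc j)) - (f (t j) + g (t j)))))
      \<le> (SUP p\<in>?P. ?S f p) + (SUP p\<in>?P. ?S g p)" .
qed

lemma variation_minus: "variation (\<lambda>t. - f t) J = variation f J"
  unfolding variation_def by (simp add: norm_minus_commute)

lemma variation_zero: "variation (\<lambda>t. 0) J = 0"
proof -
  have "variation (\<lambda>t. 0) J \<le> 0"
    unfolding variation_def by (rule SUP_least) auto
  then show ?thesis by simp
qed

lemma variation_ge: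
  assumes "s \<in> J" "t \<in> J"
  shows "ennreal (norm (f t - f s)) \<le> variation f J"
proof -
  consider "s < t" | "t < s" | "s = t" by linarith
  then show ?thesis
  proof cases
    case 1
    have "ennreal (norm (f t - f s)) =
      (case (1 :: nat, \<lambda>j :: nat. if j = 0 then s else t) of
        (m, t) \<Rightarrow> \<Sum>j<m. ennreal (norm (f (t (Suc j)) - f (t j))))" by simp
    also have "\<dots> \<le> variation f J" unfolding variation_def
      by (rule SUP_upper) (use 1 assms in \<open>auto simp: strict_mono_on_def\<close>)
    finally show ?thesis .
  next
    case 2
    have "ennreal (norm (f t - f s)) =
      (case (1 :: nat, \<lambda>j :: nat. if j = 0 then t else s) of
        (m, t) \<Rightarrow> \<Sum>j<m. ennreal (norm (f (t (Suc j)) - f (t j))))"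
      by (simp add: norm_minus_commute)
    also have "\<dots> \<le> variation f J" unfolding variation_def
      by (rule SUP_upper) (use 2 assms in \<open>auto simp: strict_mono_on_def\<close>)
    finally show ?thesis .
  qed simp
qed

lemma sup_norm_finite:
  assumes "variation f {0..T} < \<infinity>"
  shows "(SUP t\<in>{0..T}. ennreal (norm (f t))) < \<infinity>"
proof -
  have "(SUP t\<in>{0..T}. ennreal (norm (f t))) \<le> ennreal (norm (f 0)) + variation f {0..T}"
  proof (rule SUP_least)
    fix t assume t: "t \<in> {0..T}"
    have "ennreal (norm (f t)) \<le> ennreal (norm (f 0)) + ennreal (norm (f t - f 0))"
      by (simp add: ennreal_plus[symmetric] norm_triangle_sub del: ennreal_plus)
    also have "\<dots> \<le> ennreal (norm (f 0)) + variation f {0..T}"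
      using t by (intro add_left_mono variation_ge) auto
    finally show "ennreal (norm (f t)) \<le> ennreal (norm (f 0)) + variation f {0..T}" .
  qed
  also have "\<dots> < \<infinity>"
    using assms by simp
  finally show ?thesis .
qed

lemma variation_diff_finite:
  assumes "variation f J < \<infinity>" "variation g J < \<infinity>"
  shows "variation (\<lambda>t. f t - g t) J < \<infinity>"
proof -
  have "variation (\<lambda>t. f t + - g t) J \<le> variation f J + variation (\<lambda>t. - g t) J"
    by (rule variation_triangle)
  also have "\<dots> < \<infinity>"
    using assms by (simp add: variation_minus)
  finally show ?thesis by simp
qed

lemma Metric_space_BVr: "Metric_space (BVr T :: (real \<Rightarrow> 'a::real_normed_vector) set) (bv_dist T)"
proof
  let ?N = "\<lambda>h :: real \<Rightarrow> 'a. (SUP t\<in>{0..T}. ennreal (norm (h t))) + variation h {0..T}"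
  have fin: "?N (\<lambda>t. f t - g t) < \<infinity>" if "f \<in> BVr T" "g \<in> BVr T" for f g
    using that variation_diff_finite[of f "{0..T}" g] sup_norm_finite[of "\<lambda>t. f t - g t" T]
    by (auto simp: BVr_def)
  fix f g h :: "real \<Rightarrow> 'a"
  show "0 \<le> bv_dist T f g"
    by (simp add: bv_dist_def bv_norm_def)
  show "bv_dist T f g = bv_dist T g f"
    using variation_minus[of "\<lambda>t. f t - g t" "{0..T}"]
    by (simp add: bv_dist_def bv_norm_def norm_minus_commute)
  assume f: "f \<in> BVr T" and g: "g \<in> BVr T"
  show "bv_dist T f g = 0 \<longleftrightarrow> f = g"
  proof
    assume "bv_dist T f g = 0"
    then have "?N (\<lambda>t. f t - g t) = 0"
      using less_imp_neq[OF fin[OF f g]]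
      unfolding bv_dist_def bv_norm_def enn2real_eq_0_iff infinity_ennreal_def by blast
    then have "(SUP t\<in>{0..T}. ennreal (norm (f t - g t))) \<le> 0"
      by simp
    then have "ennreal (norm (f t - g t)) \<le> 0" if "t \<in> {0..T}" for t
      using that by (simp only: SUP_le_iff)
    then show "f = g"
      using f g by (intro extensionalityI[of f "{0..T}" g]) (auto simp: BVr_def)
  next
    assume "f = g"
    moreover have "(SUP t\<in>{0..T}. 0 :: ennreal) \<le> 0"
      by (rule SUP_least) simp
    ultimately show "bv_dist T f g = 0"
      by (simp add: bv_dist_def bv_norm_def variation_zero)
  qed
  assume h: "h \<in> BVr T"
  have "?N (\<lambda>t. f t - h t) \<le> ?N (\<lambda>t. f t - g t) + ?N (\<lambda>t. g t - h t)"
  proof -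
    have "(SUP t\<in>{0..T}. ennreal (norm (f t - h t)))
      \<le> (SUP t\<in>{0..T}. ennreal (norm (f t - g t))) + (SUP t\<in>{0..T}. ennreal (norm (g t - h t)))"
    proof (rule SUP_least)
      fix t assume t: "t \<in> {0..T}"
      have "norm (f t - h t) \<le> norm (f t - g t) + norm (g t - h t)"
        using norm_triangle_ineq[of "f t - g t" "g t - h t"] by simp
      then have "ennreal (norm (f t - h t)) \<le> ennreal (norm (f t - g t)) + ennreal (norm (g t - h t))"
        by (simp add: ennreal_plus[symmetric] del: ennreal_plus)
      also have "\<dots> \<le> (SUP t\<in>{0..T}. ennreal (norm (f t - g t)))
          + (SUP t\<in>{0..T}. ennreal (norm (g t - h t)))"
        by (intro add_mono SUP_upper t)
      finally show "ennreal (norm (f t - h t)) \<le> (SUP t\<in>{0..T}. ennreal (norm (f t - g t)))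
          + (SUP t\<in>{0..T}. ennreal (norm (g t - h t)))" .
    qed
    moreover have "variation (\<lambda>t. f t - h t) {0..T}
      \<le> variation (\<lambda>t. f t - g t) {0..T} + variation (\<lambda>t. g t - h t) {0..T}"
      using variation_triangle[of "\<lambda>t. f t - g t" "\<lambda>t. g t - h t" "{0..T}"] by simp
    ultimately show ?thesis
      using add_mono by (fastforce simp: ac_simps)
  qed
  then show "bv_dist T f h \<le> bv_dist T f g + bv_dist T g h"
    unfolding bv_dist_def bv_norm_def
    using fin[OF f g] fin[OF g h]
    by (subst enn2real_plus[symmetric]) (auto intro!: enn2real_mono)
qed

definition BV_topology :: "real \<Rightarrow> (real \<Rightarrow> 'a::real_normed_vector) topology" where
  "BV_topology T = Metric_space.mtopology (BVr T) (bv_dist T)"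

section \<open>Bochner integral without separability\<close>

text \<open>
  The library's \<^const>\<open>has_bochner_integral\<close> requires a second countable target space. The
  definitions below follow it, with Borel measurability replaced by strong measurability.
\<close>

definition strongly_measurable :: "'b measure \<Rightarrow> ('b \<Rightarrow> 'a::real_normed_vector) \<Rightarrow> bool" where
  "strongly_measurable M f \<longleftrightarrow>
     (\<exists>s. (\<forall>i :: nat. simple_function M (s i)) \<and> (\<forall>x\<in>space M. (\<lambda>i. s i x) \<longlonglongrightarrow> f x))"

definition L1_space :: "'b measure \<Rightarrow> ('b \<Rightarrow> 'a::real_normed_vector) set" where
  "L1_space M = {f. strongly_measurable M f \<and> (\<integral>\<^sup>+x. ennreal (norm (f x)) \<partial>M) < \<infinity>}"

definition has_strong_integral ::
    "'b measure \<Rightarrow> ('b \<Rightarrow> 'a::real_normed_vector) \<Rightarrow> 'a \<Rightarrow> bool" where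
  "has_strong_integral M f I \<longleftrightarrow> f \<in> L1_space M \<and>
     (\<exists>s. (\<forall>i :: nat. Bochner_Integration.simple_bochner_integrable M (s i)) \<and>
          (\<lambda>i. \<integral>\<^sup>+x. ennreal (norm (f x - s i x)) \<partial>M) \<longlonglongrightarrow> 0 \<and>
          (\<lambda>i. Bochner_Integration.simple_bochner_integral M (s i)) \<longlonglongrightarrow> I)"

section \<open>Vector measures and the differential measure\<close>

abbreviation borel_on :: "real \<Rightarrow> real measure" where
  "borel_on T \<equiv> restrict_space borel {0..T}"

definition vector_measure :: "'b measure \<Rightarrow> ('b set \<Rightarrow> 'a::real_normed_vector) \<Rightarrow> bool" where
  "vector_measure M m \<longleftrightarrow>
     (\<forall>A :: nat \<Rightarrow> 'b set. range A \<subseteq> sets M \<longrightarrow> disjoint_family A \<longrightarrow>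
        (\<lambda>n. m (A n)) sums m (\<Union>n. A n))"

definition measure_variation :: "'b measure \<Rightarrow> ('b set \<Rightarrow> 'a::real_normed_vector) \<Rightarrow> ennreal" where
  "measure_variation M m =
     (SUP P \<in> {P. finite P \<and> partition_on (space M) P \<and> P \<subseteq> sets M}.
        \<Sum>B\<in>P. ennreal (norm (m B)))"

definition left_limit :: "(real \<Rightarrow> 'a::real_normed_vector) \<Rightarrow> real \<Rightarrow> 'a" where
  "left_limit f t = (if t = 0 then f 0 else Lim (at_left t) f)"

text \<open>
  \<open>m = Df\<close>. The conditions determine \<open>m\<close> on the Borel subsets of \<open>[0,T]\<close>; its values on other
  sets are irrelevant.
\<close>

definition is_differential_measure ::
    "real \<Rightarrow> (real \<Rightarrow> 'a::real_normed_vector) \<Rightarrow> (real set \<Rightarrow> 'a) \<Rightarrow> bool" where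
  "is_differential_measure T f m \<longleftrightarrow>
     vector_measure (borel_on T) m \<and> measure_variation (borel_on T) m < \<infinity> \<and>
     (\<forall>c d. 0 \<le> c \<longrightarrow> c < d \<longrightarrow> d \<le> T \<longrightarrow>
        m {c..d} = f d - left_limit f c \<and> m {c<..d} = f d - f c)"

definition has_density ::
    "'b measure \<Rightarrow> ('b \<Rightarrow> 'a::real_normed_vector) \<Rightarrow> ('b set \<Rightarrow> 'a) \<Rightarrow> bool" where
  "has_density \<mu> v m \<longleftrightarrow>
     (\<forall>B\<in>sets \<mu>. has_strong_integral \<mu> (\<lambda>x. indicator B x *\<^sub>R v x) (m B))"

section \<open>The play operator\<close>

definition normal_cone :: "'a::real_inner set \<Rightarrow> 'a \<Rightarrow> 'a set" where
  "normal_cone K x = {p. \<forall>k\<in>K. p \<bullet> (k - x) \<le> 0}"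

definition is_play_solution ::
    "real \<Rightarrow> 'a::{real_inner, banach} set \<Rightarrow> 'a \<Rightarrow> (real \<Rightarrow> 'a) \<Rightarrow> (real \<Rightarrow> 'a) \<Rightarrow> bool" where
  "is_play_solution T Z z0 u y \<longleftrightarrow>
     y \<in> BVr T \<and>
     (\<exists>\<mu> v m.
        sets \<mu> = sets (borel_on T) \<and> finite_measure \<mu> \<and> v \<in> L1_space \<mu> \<and>
        (\<forall>t\<in>{0..T}. y t \<in> (\<lambda>z. u t - z) ` Z) \<and>
        is_differential_measure T y m \<and> has_density \<mu> v m \<and>
        (AE t in \<mu>. - v t \<in> normal_cone ((\<lambda>z. u t - z) ` Z) (y t)) \<and>
        y 0 = u 0 - z0)"

definition play ::
    "real \<Rightarrow> 'a::{real_inner, banach} set \<Rightarrow> 'a \<Rightarrow> (real \<Rightarrow> 'a) \<Rightarrow> (real \<Rightarrow> 'a)" where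
  "play T Z z0 u = (THE y. is_play_solution T Z z0 u y)"

end

theory Submission
  imports Defs "HOL-Probability.Distribution_Functions"
begin

text \<open>
  Write \<open>x = u - y\<close>, \<open>w = y - x\<close> and let \<open>V\<close> be the cumulative variation of \<open>u\<close>. A solution satisfies
  an integrated inequality: \<open>\<langle>y(t) - y(s), z - x(t)\<rangle>\<close> is at most the product of the masses of
  \<open>]s,t]\<close> and \<open>]s,t[\<close> under some control measure. Summed over fine partitions these errors vanish,
  which gives uniqueness and stability in the sup norm. The catching-up algorithm produces a solution
  for which the increments of \<open>x\<close>, \<open>y\<close> and \<open>w\<close> are dominated by those of \<open>V\<close>; its density with respect
  to \<open>dV\<close> is the limit of the difference quotients along refining partitions, an \<open>L\<^sup>2\<close>-bounded martingale.

  For the variation norm, the point is that \<open>dx\<close> and \<open>dy\<close> are orthogonal off the jumps, so that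
  \<open>|dw| = |du| = dV\<close> there, while \<open>|dw'| \<le> |du'| \<le> dV + d(Var(u' - u))\<close> for any solution to a nearby datum
  \<open>u'\<close>. Since \<open>w'\<close> is uniformly close to \<open>w\<close>, strict convexity of the Hilbert norm forces \<open>dw'\<close> to be
  close to \<open>dw\<close> in variation on finitely many intervals; the finitely many large jumps are controlled by
  the sup norm. Finally \<open>y = (w + u)/2\<close>.
\<close>

section \<open>Sums over the cells of a finite set\<close>

text \<open>The variable \<open>w\<close> is chosen because \<open>du = dx + dy\<close> and
  \<open>dw = dy - dx\<close> give \<open>|du|^2 = |dw|^2 + 4 <dx,dy>\<close>: the normal cone
  condition makes the last term nonnegative, and it measures exactly how far \<open>|dw|\<close>
  falls below \<open>|du|\<close>. At a jump it may be strictly positive, so nothing aligns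
  \<open>dw'\<close> with \<open>dw\<close> there; jumps are compared in the sup norm instead, at a
  fixed cost for each. Hence the radius \<rho> in the continuity proof depends on \<open>u\<close>
  through the number of points of a partition, and no modulus of continuity uniform in
  \<open>u\<close> results. The reference measure for both solutions is \<open>dV\<close> of the
  unperturbed \<open>u\<close>, since only there is the equality \<open>|dw| = dV\<close> at hand.
  The comparison works without densities: if the energy of a partition, the sum of
  \<open>|\<Delta>f|^2 / \<Delta>V\<close>, is nearly maximal among all partitions, then every
  refinement reproduces its slopes up to a small mean error. Orthogonality off the jumps thereby
  becomes an estimate on one finite partition.\<close>

definition prv :: "real set \<Rightarrow> real \<Rightarrow> real" where
  "prv Q q = Max (Q \<inter> {..<q})"

text \<open>A cell is indexed by its right end point, so a cut at \<open>b\<close> assigns each cell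
  to the side on which it ends, even when \<open>b\<close> is not in \<open>Q\<close>. Refinements
  can then be compared without renumbering points.\<close>

definition csum :: "real set \<Rightarrow> real \<Rightarrow> real \<Rightarrow> (real \<Rightarrow> real \<Rightarrow> 'b::comm_monoid_add) \<Rightarrow> 'b" where
  "csum Q a b F = (\<Sum>q\<in>Q \<inter> {a<..b}. F (prv Q q) q)"

lemma prv:
  assumes "finite Q" "a \<in> Q" "a < q"
  shows "prv Q q \<in> Q" and prv_ge: "a \<le> prv Q q" and "prv Q q < q"
    and prv_gap: "Q \<inter> {prv Q q<..<q} = {}"
proof -
  have fin: "finite (Q \<inter> {..<q})" and mem: "a \<in> Q \<inter> {..<q}"
    using assms by auto
  have "prv Q q \<in> Q \<inter> {..<q}"
    unfolding prv_def using fin mem by (intro Max_in) auto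
  then show "prv Q q \<in> Q" "prv Q q < q" by auto
  show "a \<le> prv Q q"
    unfolding prv_def using fin mem by (intro Max_ge)
  show "Q \<inter> {prv Q q<..<q} = {}"
  proof safe
    fix r assume "r \<in> Q" "r \<in> {prv Q q<..<q}"
    moreover from this have "r \<le> prv Q q"
      unfolding prv_def using fin by (intro Max_ge) auto
    ultimately show "r \<in> {}" by auto
  qed
qed

lemma prv_eqI:
  assumes "finite Q" "p \<in> Q" "p < q" "Q \<inter> {p<..<q} = {}"
  shows "prv Q q = p"
  using prv[OF assms(1-3)] assms(4) by force

lemma cell_induct [consumes 4, case_names base step]:
  assumes Q: "finite Q" and a: "a \<in> Q" and b: "b \<in> Q" "a \<le> b"
    and base: "P a" and step: "\<And>q. q \<in> Q \<Longrightarrow> a < q \<Longrightarrow> q \<le> b \<Longrightarrow> P (prv Q q) \<Longrightarrow> P q"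
  shows "P b"
proof -
  have "P q" if "q \<in> Q" "a \<le> q" "q \<le> b" for q
    using that
  proof (induction "card (Q \<inter> {a<..q})" arbitrary: q rule: less_induct)
    case less
    show ?case
    proof (cases "q = a")
      case False
      then have "a < q" using less by auto
      note p = prv[OF Q a this]
      have "Q \<inter> {a<..prv Q q} \<subseteq> Q \<inter> {a<..q}"
        using p(3) by (intro Int_mono) auto
      moreover have "q \<in> Q \<inter> {a<..q}" "q \<notin> Q \<inter> {a<..prv Q q}"
        using p(3) less(2) \<open>a < q\<close> by auto
      ultimately have "Q \<inter> {a<..prv Q q} \<subset> Q \<inter> {a<..q}" by blast
      then have "card (Q \<inter> {a<..prv Q q}) < card (Q \<inter> {a<..q})"
        using Q by (intro psubset_card_mono) auto
      then have "P (prv Q q)" using less(4) p by (intro less(1)) auto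
      then show ?thesis using step less \<open>a < q\<close> by blast
    next
      case True
      then show ?thesis using base by blast
    qed
  qed
  then show ?thesis using b by simp
qed

lemma csum_refl [simp]: "csum Q a a F = 0"
  by (simp add: csum_def)

lemma csum_split:
  assumes "finite Q" "a \<le> b" "b \<le> c"
  shows "csum Q a c F = csum Q a b F + csum Q b c F"
proof -
  have "Q \<inter> {a<..c} = (Q \<inter> {a<..b}) \<union> (Q \<inter> {b<..c})" using assms by auto
  moreover have "(Q \<inter> {a<..b}) \<inter> (Q \<inter> {b<..c}) = {}" by auto
  ultimately show ?thesis unfolding csum_def using assms by (simp add: sum.union_disjoint)
qed

lemma csum_cell:
  assumes "finite Q" "p \<in> Q" "q \<in> Q" "p < q" "Q \<inter> {p<..<q} = {}"
  shows "csum Q p q F = F p q"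
proof -
  have "Q \<inter> {p<..q} = {q}" using assms by force
  then show ?thesis unfolding csum_def using prv_eqI[OF assms(1,2,4,5)] by simp
qed

lemma csum_last:
  assumes "finite Q" "a \<in> Q" "b \<in> Q" "a < b"
  shows "csum Q a b F = csum Q a (prv Q b) F + F (prv Q b) b"
  using csum_split[of Q a "prv Q b" b F] csum_cell[of Q "prv Q b" b F] prv[OF assms(1,2,4)] assms
  by simp

lemma csum_telescope:
  fixes g :: "real \<Rightarrow> 'b::ab_group_add"
  assumes "finite Q" "a \<in> Q" "b \<in> Q" "a \<le> b"
  shows "csum Q a b (\<lambda>p q. g q - g p) = g b - g a"
  using assms
proof (induction rule: cell_induct)
  case (step q)
  then show ?case using csum_last[of Q a q "\<lambda>p q. g q - g p"] assms by simp
qed simp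

text \<open>The inner sums are increments of \<open>t \<mapsto> csum Q a t F\<close>, so the outer
  sum telescopes. Every comparison of a partition with a refinement goes through this
  identity.\<close>

lemma csum_nested:
  fixes F :: "real \<Rightarrow> real \<Rightarrow> 'b::ab_group_add"
  assumes Q: "finite Q" "P \<subseteq> Q" and "a \<in> P" "b \<in> P" "a \<le> b"
  shows "csum P a b (\<lambda>s t. csum Q s t F) = csum Q a b F"
proof -
  have P: "finite P" using Q finite_subset by blast
  have "csum P a b (\<lambda>s t. csum Q s t F) = csum P a b (\<lambda>s t. csum Q a t F - csum Q a s F)"
    unfolding csum_def[of P]
  proof (intro sum.cong refl)
    fix q assume "q \<in> P \<inter> {a<..b}"
    then show "csum Q (prv P q) q F = csum Q a q F - csum Q a (prv P q) F"
      using csum_split[of Q a "prv P q" q F] prv[OF P assms(3), of q] Q by simp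
  qed
  also have "\<dots> = csum Q a b F"
    using csum_telescope[OF P assms(3-5), of "\<lambda>t. csum Q a t F"] by simp
  finally show ?thesis .
qed

lemma csum_mono:
  fixes F H :: "real \<Rightarrow> real \<Rightarrow> 'b::ordered_comm_monoid_add"
  assumes "finite Q" "a \<in> Q"
    and "\<And>p q. p \<in> Q \<Longrightarrow> q \<in> Q \<Longrightarrow> a \<le> p \<Longrightarrow> p < q \<Longrightarrow> q \<le> b \<Longrightarrow> Q \<inter> {p<..<q} = {} \<Longrightarrow> F p q \<le> H p q"
  shows "csum Q a b F \<le> csum Q a b H"
  unfolding csum_def using prv[OF assms(1,2)] by (intro sum_mono assms(3)) auto

lemma csum_cong:
  assumes "finite Q" "a \<in> Q"
    and "\<And>p q. p \<in> Q \<Longrightarrow> q \<in> Q \<Longrightarrow> a \<le> p \<Longrightarrow> p < q \<Longrightarrow> q \<le> b \<Longrightarrow> Q \<inter> {p<..<q} = {} \<Longrightarrow> F p q = H p q"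
  shows "csum Q a b F = csum Q a b H"
  unfolding csum_def using prv[OF assms(1,2)] by (intro sum.cong assms(3)) auto

lemma csum_nonneg:
  fixes F :: "real \<Rightarrow> real \<Rightarrow> 'b::ordered_comm_monoid_add"
  assumes "finite Q" "a \<in> Q"
    and "\<And>p q. p \<in> Q \<Longrightarrow> q \<in> Q \<Longrightarrow> a \<le> p \<Longrightarrow> p < q \<Longrightarrow> q \<le> b \<Longrightarrow> Q \<inter> {p<..<q} = {} \<Longrightarrow> 0 \<le> F p q"
  shows "0 \<le> csum Q a b F"
  unfolding csum_def using prv[OF assms(1,2)] by (intro sum_nonneg assms(3)) auto

lemma csum_add: "csum Q a b (\<lambda>p q. F p q + H p q) = csum Q a b F + csum Q a b H"
  unfolding csum_def by (rule sum.distrib)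

lemma csum_diff:
  fixes F :: "real \<Rightarrow> real \<Rightarrow> 'b::ab_group_add"
  shows "csum Q a b (\<lambda>p q. F p q - H p q) = csum Q a b F - csum Q a b H"
  unfolding csum_def by (rule sum_subtractf)

lemma csum_cmult:
  fixes c :: "'b::semiring_0"
  shows "csum Q a b (\<lambda>p q. c * F p q) = c * csum Q a b F"
  unfolding csum_def by (rule sum_distrib_left[symmetric])

lemma csum_inner_left:
  fixes c :: "'b::real_inner"
  shows "csum Q a b (\<lambda>p q. F p q \<bullet> c) = csum Q a b F \<bullet> c"
  unfolding csum_def by (simp add: inner_sum_left)

lemma norm_csum: "norm (csum Q a b F) \<le> csum Q a b (\<lambda>p q. norm (F p q))"
  unfolding csum_def by (rule norm_sum)

lemma norm_diff_le_csum:
  fixes f :: "real \<Rightarrow> 'b::real_normed_vector"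
  assumes "finite Q" "a \<in> Q" "b \<in> Q" "a \<le> b"
  shows "norm (f b - f a) \<le> csum Q a b (\<lambda>p q. norm (f q - f p))"
  using norm_csum[of Q a b "\<lambda>p q. f q - f p"] csum_telescope[OF assms, of f] by simp

lemma csum_cauchy_schwarz:
  fixes F H :: "real \<Rightarrow> real \<Rightarrow> real"
  shows "(csum Q a b (\<lambda>p q. F p q * H p q))\<^sup>2 \<le> csum Q a b (\<lambda>p q. (F p q)\<^sup>2) * csum Q a b (\<lambda>p q. (H p q)\<^sup>2)"
  unfolding csum_def by (rule Cauchy_Schwarz_ineq_sum)

section \<open>Variation\<close>

text \<open>\<open>variation\<close> is defined by sequences, whereas all estimates below use finite
  sets of points. Points of \<open>Q\<close> between two terms of the sequence can only increase the
  sum, by the triangle inequality. The next lemma translates in the other direction.\<close>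

lemma sequence_sum_le_csum:
  fixes f :: "real \<Rightarrow> 'b::real_normed_vector"
  assumes "strict_mono_on {..m} \<tau>" "\<tau> ` {..m} \<subseteq> Q" "finite Q" "a \<in> Q" "a \<le> \<tau> 0"
  shows "(\<Sum>j<m. norm (f (\<tau> (Suc j)) - f (\<tau> j))) \<le> csum Q a (\<tau> m) (\<lambda>p q. norm (f q - f p))"
  using assms
proof (induction m)
  case 0
  then show ?case by (auto intro!: csum_nonneg)
next
  case (Suc m)
  have less: "\<tau> m < \<tau> (Suc m)"
    using Suc.prems(1) by (auto simp: strict_mono_on_def)
  have "a \<le> \<tau> m"
    using Suc.prems(5) strict_mono_onD[OF Suc.prems(1), of 0 m] by (cases "m = 0") auto
  moreover have "(\<Sum>j<m. norm (f (\<tau> (Suc j)) - f (\<tau> j))) \<le> csum Q a (\<tau> m) (\<lambda>p q. norm (f q - f p))"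
    using Suc.prems by (intro Suc.IH) (auto simp: strict_mono_on_def)
  moreover have "norm (f (\<tau> (Suc m)) - f (\<tau> m)) \<le> csum Q (\<tau> m) (\<tau> (Suc m)) (\<lambda>p q. norm (f q - f p))"
    using Suc.prems less by (intro norm_diff_le_csum) auto
  ultimately show ?case
    using csum_split[of Q a "\<tau> m" "\<tau> (Suc m)" "\<lambda>p q. norm (f q - f p)"] Suc.prems less by simp
qed

lemma csum_eq_sequence_sum:
  fixes f :: "real \<Rightarrow> 'b::real_normed_vector"
  assumes "finite Q" "a \<in> Q" "b \<in> Q" "a \<le> b"
  shows "\<exists>m \<tau>. strict_mono_on {..m::nat} \<tau> \<and> \<tau> ` {..m} \<subseteq> Q \<and> \<tau> m = b \<and>
    (\<Sum>j<m. ennreal (norm (f (\<tau> (Suc j)) - f (\<tau> j)))) = ennreal (csum Q a b (\<lambda>p q. norm (f q - f p)))"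
  using assms
proof (induction rule: cell_induct)
  case base
  show ?case using assms(2)
    by (intro exI[of _ 0] exI[of _ "\<lambda>_. a"]) (auto simp: strict_mono_on_def)
next
  case (step q)
  note p = prv[OF assms(1,2) step(2)]
  from step obtain m \<tau> where m: "strict_mono_on {..m::nat} \<tau>" "\<tau> ` {..m} \<subseteq> Q" "\<tau> m = prv Q q"
    "(\<Sum>j<m. ennreal (norm (f (\<tau> (Suc j)) - f (\<tau> j)))) = ennreal (csum Q a (prv Q q) (\<lambda>p q. norm (f q - f p)))"
    by blast
  define \<sigma> where "\<sigma> = \<tau>(Suc m := q)"
  have le: "\<tau> j \<le> \<tau> m" if "j \<le> m" for j
    using m(1) that by (cases "j = m") (auto simp: strict_mono_on_def intro: less_imp_le)
  have "strict_mono_on {..Suc m} \<sigma>"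
  proof (rule strict_mono_onI)
    fix r s assume "r \<in> {..Suc m}" "s \<in> {..Suc m}" "r < s"
    then show "\<sigma> r < \<sigma> s"
      using m(1) le[of r] m(3) p(3) by (cases "s = Suc m") (auto simp: \<sigma>_def strict_mono_on_def)
  qed
  moreover have "\<sigma> ` {..Suc m} \<subseteq> Q"
    using m(2) step by (auto simp: \<sigma>_def)
  moreover have "(\<Sum>j<Suc m. ennreal (norm (f (\<sigma> (Suc j)) - f (\<sigma> j)))) = ennreal (csum Q a q (\<lambda>p q. norm (f q - f p)))"
  proof -
    have "(\<Sum>j<m. ennreal (norm (f (\<sigma> (Suc j)) - f (\<sigma> j)))) = (\<Sum>j<m. ennreal (norm (f (\<tau> (Suc j)) - f (\<tau> j))))"
      by (intro sum.cong) (auto simp: \<sigma>_def)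
    moreover have "0 \<le> csum Q a (prv Q q) (\<lambda>p q. norm (f q - f p))"
      using assms by (intro csum_nonneg) auto
    ultimately show ?thesis
      using m(3,4) csum_last[OF assms(1,2) step(1,2), of "\<lambda>p q. norm (f q - f p)"]
      by (simp add: \<sigma>_def ennreal_plus)
  qed
  ultimately show ?case
    by (intro exI[of _ "Suc m"] exI[of _ \<sigma>] conjI) (auto simp only: \<sigma>_def fun_upd_same)
qed

lemma csum_le_variation:
  fixes f :: "real \<Rightarrow> 'b::real_normed_vector"
  assumes "finite Q" "a \<in> Q" "b \<in> Q" "a \<le> b" "Q \<subseteq> J"
  shows "ennreal (csum Q a b (\<lambda>p q. norm (f q - f p))) \<le> variation f J"
proof -
  from csum_eq_sequence_sum[OF assms(1-4), of f] obtain m \<tau> where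
    m: "strict_mono_on {..m::nat} \<tau>" "\<tau> ` {..m} \<subseteq> Q"
    and eq: "(\<Sum>j<m. ennreal (norm (f (\<tau> (Suc j)) - f (\<tau> j)))) = ennreal (csum Q a b (\<lambda>p q. norm (f q - f p)))"
    by blast
  have "(case (m, \<tau>) of (m, \<tau>) \<Rightarrow> \<Sum>j<m. ennreal (norm (f (\<tau> (Suc j)) - f (\<tau> j)))) \<le> variation f J"
    unfolding variation_def using m assms(5) by (intro SUP_upper) auto
  then show ?thesis using eq by simp
qed

text \<open>Inserting points never decreases the sum, so the supremum may be restricted to
  partitions that contain the end points and a prescribed finite set \<open>R\<close>.\<close>

lemma variation_le:
  fixes f :: "real \<Rightarrow> 'b::real_normed_vector"
  assumes R: "finite R" "R \<subseteq> {a..b}" and "a \<le> b"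
    and le: "\<And>Q. finite Q \<Longrightarrow> Q \<subseteq> {a..b} \<Longrightarrow> R \<subseteq> Q \<Longrightarrow> a \<in> Q \<Longrightarrow> b \<in> Q \<Longrightarrow>
      csum Q a b (\<lambda>p q. norm (f q - f p)) \<le> c"
  shows "variation f {a..b} \<le> ennreal c"
  unfolding variation_def
proof (rule SUP_least, clarify)
  fix m :: nat and \<tau> :: "nat \<Rightarrow> real"
  assume \<tau>: "strict_mono_on {..m} \<tau>" "\<tau> ` {..m} \<subseteq> {a..b}"
  define Q where "Q = \<tau> ` {..m} \<union> R \<union> {a, b}"
  have Q: "finite Q" "Q \<subseteq> {a..b}" "R \<subseteq> Q" "a \<in> Q" "b \<in> Q" "\<tau> ` {..m} \<subseteq> Q"
    using \<tau> assms by (auto simp: Q_def)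
  let ?F = "\<lambda>p q. norm (f q - f p)"
  have m: "a \<le> \<tau> 0" "\<tau> m \<in> Q" "a \<le> \<tau> m" "\<tau> m \<le> b" using \<tau> Q by (auto simp: image_subset_iff)
  have "(\<Sum>j<m. norm (f (\<tau> (Suc j)) - f (\<tau> j))) \<le> csum Q a (\<tau> m) ?F"
    using \<tau> Q m by (intro sequence_sum_le_csum) auto
  also have "\<dots> \<le> csum Q a (\<tau> m) ?F + csum Q (\<tau> m) b ?F"
    using Q m by (auto intro!: csum_nonneg)
  also have "\<dots> = csum Q a b ?F"
    using Q m by (intro csum_split[symmetric]) auto
  also have "\<dots> \<le> c" using Q by (intro le)
  finally show "(\<Sum>j<m. ennreal (norm (f (\<tau> (Suc j)) - f (\<tau> j)))) \<le> ennreal c"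
    by (simp add: sum_ennreal ennreal_leI)
qed

lemma variation_mono: "J \<subseteq> K \<Longrightarrow> variation f J \<le> variation f K"
  unfolding variation_def by (rule SUP_subset_mono) auto

text \<open>Clipping at \<open>T\<close>, together with the value \<open>0\<close> for
  \<open>t \<le> 0\<close>, makes the variation function a monotone function on the whole line, to
  which a Stieltjes measure can be attached.\<close>

definition cumvar :: "real \<Rightarrow> (real \<Rightarrow> 'b::real_normed_vector) \<Rightarrow> real \<Rightarrow> real" where
  "cumvar T f t = enn2real (variation f {0..min t T})"

locale bounded_variation =
  fixes T :: real and f :: "real \<Rightarrow> 'b::real_normed_vector"
  assumes T: "0 < T" and finite_variation: "variation f {0..T} < \<infinity>"
begin

abbreviation "V \<equiv> cumvar T f"

lemma ennreal_cumvar: "ennreal (V t) = variation f {0..min t T}"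
proof -
  have "variation f {0..min t T} \<le> variation f {0..T}" by (intro variation_mono) auto
  then show ?thesis unfolding cumvar_def using finite_variation by (simp add: less_top)
qed

lemma cumvar_nonneg: "0 \<le> V t" by (simp add: cumvar_def)

lemma mono_cumvar: "mono V"
proof (rule monoI)
  fix s t :: real assume "s \<le> t"
  then have "ennreal (V s) \<le> ennreal (V t)"
    unfolding ennreal_cumvar by (intro variation_mono) auto
  then show "V s \<le> V t" by (simp add: cumvar_nonneg)
qed

lemma cumvar_eq_0: assumes "t \<le> 0" shows "V t = 0"
proof -
  have "variation f {0..min t T} \<le> 0"
    unfolding variation_def
  proof (rule SUP_least, clarify)
    fix m :: nat and \<tau> :: "nat \<Rightarrow> real"
    assume \<tau>: "strict_mono_on {..m} \<tau>" "\<tau> ` {..m} \<subseteq> {0..min t T}"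
    show "(\<Sum>j<m. ennreal (norm (f (\<tau> (Suc j)) - f (\<tau> j)))) \<le> 0"
    proof (cases m)
      case (Suc k)
      have "\<tau> 0 \<in> {0..min t T}" "\<tau> m \<in> {0..min t T}" using \<tau>(2) by auto
      moreover have "\<tau> 0 < \<tau> m" using \<tau>(1) Suc by (auto simp: strict_mono_on_def)
      ultimately show ?thesis using assms by auto
    qed simp
  qed
  then show ?thesis by (simp add: cumvar_def)
qed

lemma cumvar_ge_T: "T \<le> t \<Longrightarrow> V t = V T"
  by (simp add: cumvar_def min_def)

text \<open>Once \<open>s\<close> belongs to a partition of \<open>[0,t]\<close>, its sum splits at
  \<open>s\<close>, and the left part is at most \<open>V s\<close>. This is the upper half of the
  additivity of variation; the next lemma is the lower half, for a single increment.\<close>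

lemma cumvar_increment_le:
  assumes st: "0 \<le> s" "s \<le> t" "t \<le> T"
    and R: "finite R" "R \<subseteq> {s..t}"
    and le: "\<And>Q. finite Q \<Longrightarrow> Q \<subseteq> {s..t} \<Longrightarrow> R \<subseteq> Q \<Longrightarrow> s \<in> Q \<Longrightarrow> t \<in> Q \<Longrightarrow>
      csum Q s t (\<lambda>p q. norm (f q - f p)) \<le> c"
  shows "V t - V s \<le> c"
proof -
  let ?F = "\<lambda>p q. norm (f q - f p)"
  have c: "0 \<le> c"
  proof -
    have "0 \<le> csum (R \<union> {s, t}) s t ?F" using R by (intro csum_nonneg) auto
    also have "\<dots> \<le> c" using R st by (intro le) auto
    finally show ?thesis .
  qed
  have "variation f {0..t} \<le> ennreal (V s + c)"
  proof (rule variation_le[of "R \<union> {s}"])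
    fix Q :: "real set" assume Q: "finite Q" "Q \<subseteq> {0..t}" "R \<union> {s} \<subseteq> Q" "0 \<in> Q" "t \<in> Q"
    have "csum Q 0 t ?F = csum Q 0 s ?F + csum Q s t ?F"
      using Q st by (intro csum_split) auto
    also have "csum Q 0 s ?F = csum (Q \<inter> {..s}) 0 s ?F"
      unfolding csum_def
    proof (intro sum.cong)
      fix q assume "q \<in> Q \<inter> {..s} \<inter> {0<..s}"
      then have "Q \<inter> {..s} \<inter> {..<q} = Q \<inter> {..<q}" by auto
      then show "norm (f q - f (prv Q q)) = norm (f q - f (prv (Q \<inter> {..s}) q))"
        unfolding prv_def by simp
    qed auto
    also have "csum Q s t ?F = csum (Q \<inter> {s..t}) s t ?F"
      unfolding csum_def
    proof (intro sum.cong)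
      fix q assume q: "q \<in> Q \<inter> {s..t} \<inter> {s<..t}"
      have "prv (Q \<inter> {s..t}) q = prv Q q"
        using q Q prv[of Q s q] by (intro prv_eqI) auto
      then show "norm (f q - f (prv Q q)) = norm (f q - f (prv (Q \<inter> {s..t}) q))"
        by simp
    qed auto
    also have "csum (Q \<inter> {s..t}) s t ?F \<le> c"
      using Q R st by (intro le) auto
    also have "csum (Q \<inter> {..s}) 0 s ?F \<le> V s"
    proof -
      have "ennreal (csum (Q \<inter> {..s}) 0 s ?F) \<le> variation f {0..s}"
        using Q st by (intro csum_le_variation) auto
      also have "\<dots> = ennreal (V s)" using st ennreal_cumvar[of s] by (simp add: min_def)
      finally show ?thesis by (simp add: cumvar_nonneg)
    qed
    finally show "csum Q 0 t ?F \<le> V s + c" by simp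
  qed (use st R in auto)
  also have "variation f {0..t} = ennreal (V t)"
    using st ennreal_cumvar[of t] by (simp add: min_def)
  finally show ?thesis using c cumvar_nonneg[of s] by (simp del: ennreal_plus)
qed

text \<open>Appending \<open>t\<close> to a partition of \<open>[0,s]\<close> gives one of
  \<open>[0,t]\<close> whose sum is larger by at least \<open>norm (f t - f s)\<close>.\<close>

lemma norm_diff_le_cumvar:
  assumes st: "0 \<le> s" "s \<le> t" "t \<le> T"
  shows "norm (f t - f s) \<le> V t - V s"
proof -
  let ?F = "\<lambda>p q. norm (f q - f p)"
  have nn: "0 \<le> V t - norm (f t - f s)"
  proof -
    have "ennreal (norm (f t - f s)) \<le> variation f {0..t}"
      using st by (intro variation_ge) auto
    also have "\<dots> = ennreal (V t)" using st ennreal_cumvar[of t] by (simp add: min_def)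
    finally show ?thesis by (simp add: cumvar_nonneg)
  qed
  have "variation f {0..s} \<le> ennreal (V t - norm (f t - f s))"
  proof (rule variation_le[of "{}"])
    fix Q :: "real set" assume Q: "finite Q" "Q \<subseteq> {0..s}" "{} \<subseteq> Q" "0 \<in> Q" "s \<in> Q"
    show "csum Q 0 s ?F \<le> V t - norm (f t - f s)"
    proof -
      have "csum (insert t Q) 0 s ?F = csum Q 0 s ?F"
        unfolding csum_def
      proof (intro sum.cong)
        fix q assume "q \<in> Q \<inter> {0<..s}"
        then have "insert t Q \<inter> {..<q} = Q \<inter> {..<q}" using st by auto
        then show "norm (f q - f (prv (insert t Q) q)) = norm (f q - f (prv Q q))"
          unfolding prv_def by simp
      qed (use st Q in auto)
      moreover have "norm (f t - f s) \<le> csum (insert t Q) s t ?F"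
        using Q st by (intro norm_diff_le_csum) auto
      moreover have "csum (insert t Q) 0 t ?F = csum (insert t Q) 0 s ?F + csum (insert t Q) s t ?F"
        using Q st by (intro csum_split) auto
      moreover have "csum (insert t Q) 0 t ?F \<le> V t"
      proof -
        have "ennreal (csum (insert t Q) 0 t ?F) \<le> variation f {0..t}"
          using Q st by (intro csum_le_variation) auto
        also have "\<dots> = ennreal (V t)" using st ennreal_cumvar[of t] by (simp add: min_def)
        finally show ?thesis by (simp add: cumvar_nonneg)
      qed
      ultimately show ?thesis by simp
    qed
  qed (use st in auto)
  also have "variation f {0..s} = ennreal (V s)"
    using st ennreal_cumvar[of s] by (simp add: min_def)
  finally show ?thesis using nn by (simp add: ennreal_le_iff)
qed

lemma csum_near_cumvar:
  assumes st: "0 \<le> s" "s \<le> t" "t \<le> T" and "0 < e"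
  obtains Q where "finite Q" "Q \<subseteq> {s..t}" "s \<in> Q" "t \<in> Q"
    "V t - V s - e < csum Q s t (\<lambda>p q. norm (f q - f p))"
proof -
  have "\<not> (\<forall>Q. finite Q \<and> Q \<subseteq> {s..t} \<and> s \<in> Q \<and> t \<in> Q \<longrightarrow>
      csum Q s t (\<lambda>p q. norm (f q - f p)) \<le> V t - V s - e)"
  proof
    assume "\<forall>Q. finite Q \<and> Q \<subseteq> {s..t} \<and> s \<in> Q \<and> t \<in> Q \<longrightarrow>
      csum Q s t (\<lambda>p q. norm (f q - f p)) \<le> V t - V s - e"
    then have "V t - V s \<le> V t - V s - e"
      using st by (intro cumvar_increment_le[of _ _ "{}"]) auto
    then show False using \<open>0 < e\<close> by simp
  qed
  then show thesis using that by (auto simp: not_le)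
qed

lemma csum_le_cumvar:
  assumes "finite Q" "Q \<subseteq> {0..T}" "a \<in> Q" "b \<in> Q" "a \<le> b"
  shows "csum Q a b (\<lambda>p q. norm (f q - f p)) \<le> V b - V a"
proof -
  have "csum Q a b (\<lambda>p q. norm (f q - f p)) \<le> csum Q a b (\<lambda>p q. V q - V p)"
    using assms by (intro csum_mono norm_diff_le_cumvar) auto
  then show ?thesis using csum_telescope[OF assms(1,3-5), of V] by simp
qed

text \<open>Take a partition of \<open>[t,T]\<close> that is optimal up to \<open>e/2\<close>. For
  \<open>r\<close> inside its first cell, \<open>V r - V t\<close> exceeds
  \<open>norm (f r - f t)\<close> by less than \<open>e/2\<close>, and right continuity of
  \<open>f\<close> does the rest.\<close>

lemma cumvar_right_cont:
  assumes rc: "\<forall>t\<in>{0..<T}. (f \<longlongrightarrow> f t) (at_right t)"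
  shows "continuous (at_right t) V"
proof -
  consider "t < 0" | "T \<le> t" | "0 \<le> t" "t < T" by linarith
  then show ?thesis
  proof cases
    case 1
    have "eventually (\<lambda>s. V s = V t) (at_right t)"
      using 1 by (intro eventually_at_rightI[of t 0]) (simp_all add: cumvar_eq_0)
    then show ?thesis unfolding continuous_within by (rule tendsto_eventually)
  next
    case 2
    have "eventually (\<lambda>s. V s = V t) (at_right t)"
    proof (rule eventually_at_rightI[of t "t + 1"])
      fix s assume "s \<in> {t<..<t + 1}"
      then show "V s = V t" using cumvar_ge_T[of s] cumvar_ge_T[of t] 2 by simp
    qed simp
    then show ?thesis unfolding continuous_within by (rule tendsto_eventually)
  next
    case 3
    show ?thesis
      unfolding continuous_within
    proof (rule tendstoI)
      fix e :: real assume "0 < e"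
      then have e2: "0 < e/2" by simp
      obtain Q where Q: "finite Q" "Q \<subseteq> {t..T}" "t \<in> Q" "T \<in> Q"
        and big: "V T - V t - e/2 < csum Q t T (\<lambda>p q. norm (f q - f p))"
        using csum_near_cumvar[OF 3(1) _ _ e2, of T] 3 by auto
      define q1 where "q1 = Min (Q \<inter> {t<..})"
      have q1: "q1 \<in> Q" "t < q1" "Q \<inter> {t<..<q1} = {}"
      proof -
        have "q1 \<in> Q \<inter> {t<..}"
          unfolding q1_def using Q 3 by (intro Min_in) auto
        then show "q1 \<in> Q" "t < q1" by auto
        show "Q \<inter> {t<..<q1} = {}"
        proof safe
          fix r assume "r \<in> Q" "r \<in> {t<..<q1}"
          moreover from this have "q1 \<le> r"
            unfolding q1_def using Q by (intro Min_le) auto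
          ultimately show "r \<in> {}" by auto
        qed
      qed
      have "eventually (\<lambda>r. dist (f r) (f t) < e/2) (at_right t)"
        using rc 3 by (intro tendstoD[OF _ e2]) auto
      moreover have "eventually (\<lambda>r. r \<in> {t<..<q1}) (at_right t)"
        using q1 by (intro eventually_at_rightI[of t q1]) auto
      ultimately show "eventually (\<lambda>r. dist (V r) (V t) < e) (at_right t)"
      proof eventually_elim
        case (elim r)
        have q1T: "q1 \<le> T" using q1 Q by auto
        have "csum Q t T (\<lambda>p q. norm (f q - f p)) =
          norm (f q1 - f t) + csum Q q1 T (\<lambda>p q. norm (f q - f p))"
          using csum_split[of Q t q1 T "\<lambda>p q. norm (f q - f p)"]
            csum_cell[of Q t q1 "\<lambda>p q. norm (f q - f p)"] Q q1 q1T by simp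
        moreover have "csum Q q1 T (\<lambda>p q. norm (f q - f p)) \<le> V T - V q1"
          using Q q1 q1T 3 by (intro csum_le_cumvar) auto
        moreover have "norm (f q1 - f t) \<le> norm (f q1 - f r) + norm (f r - f t)"
          by norm
        moreover have "norm (f q1 - f r) \<le> V q1 - V r"
          using elim 3 q1T by (intro norm_diff_le_cumvar) auto
        moreover have "V t \<le> V r" using elim by (intro monoD[OF mono_cumvar]) auto
        ultimately show ?case using big elim by (simp add: dist_norm)
      qed
    qed
  qed
qed

end

section \<open>Fine partitions\<close>

lemma le_from_eps:
  fixes A B C :: real
  assumes "\<And>e. 0 < e \<Longrightarrow> A \<le> B + e * C"
  shows "A \<le> B"
proof (rule field_le_epsilon)
  fix e :: real assume "0 < e"
  then have "A \<le> B + e / (\<bar>C\<bar> + 1) * C" by (intro assms) auto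
  also have "e / (\<bar>C\<bar> + 1) * C \<le> e / (\<bar>C\<bar> + 1) * (\<bar>C\<bar> + 1)"
    using \<open>0 < e\<close> by (intro mult_left_mono) auto
  finally show "A \<le> B + e" by simp
qed

text \<open>For monotone \<open>G\<close> this is the left limit \<open>G(t-)\<close>, so that
  \<open>G t - lft G t\<close> is the mass of the atom at \<open>t\<close>.\<close>

definition lft :: "(real \<Rightarrow> real) \<Rightarrow> real \<Rightarrow> real" where
  "lft G t = (SUP s\<in>{..<t}. G s)"

lemma lft_ge: "mono G \<Longrightarrow> s < t \<Longrightarrow> G s \<le> lft G t"
  unfolding lft_def by (intro cSUP_upper bdd_aboveI2[of _ _ "G t"]) (auto intro: monoD)

lemma lft_least: "(\<And>s. s < t \<Longrightarrow> G s \<le> c) \<Longrightarrow> lft G t \<le> c"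
  unfolding lft_def by (intro cSUP_least) (auto simp: lessThan_def intro: lt_ex)

lemma lft_le: "mono G \<Longrightarrow> lft G t \<le> G t"
  by (intro lft_least) (auto intro: monoD)

text \<open>Up to an additive constant these are the distribution functions of positive Stieltjes
  measures.\<close>

definition control :: "(real \<Rightarrow> real) \<Rightarrow> bool" where
  "control G \<longleftrightarrow> mono G \<and> (\<forall>t. continuous (at_right t) G)"

lemma control_add: "control G \<Longrightarrow> control H \<Longrightarrow> control (\<lambda>t. G t + H t)"
  unfolding control_def by (auto intro!: monoI add_mono continuous_add dest: monoD)

lemma control_mono: "control G \<Longrightarrow> s \<le> t \<Longrightarrow> G s \<le> G t"
  unfolding control_def by (auto dest: monoD)

text \<open>As \<open>]r,s]\<close> must avoid \<open>P\<close>, only the mass of the open cells is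
  bounded; atoms at points of \<open>P\<close> are free, which is why such partitions exist for
  discontinuous \<open>G\<close>. Quantifying over all \<open>r\<close> and \<open>s\<close>, not
  just over points of \<open>P\<close>, makes the property pass to supersets.\<close>

definition fine_partition :: "real \<Rightarrow> (real \<Rightarrow> real) \<Rightarrow> real \<Rightarrow> real set \<Rightarrow> bool" where
  "fine_partition T G e P \<longleftrightarrow> finite P \<and> P \<subseteq> {0..T} \<and> 0 \<in> P \<and> T \<in> P \<and>
     (\<forall>r s. 0 \<le> r \<longrightarrow> r \<le> s \<longrightarrow> s \<le> T \<longrightarrow> P \<inter> {r<..s} = {} \<longrightarrow> G s - G r \<le> e)"

lemma fineD:
  assumes "fine_partition T G e P"
  shows "finite P" "P \<subseteq> {0..T}" "0 \<in> P" "T \<in> P"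
    and "0 \<le> r \<Longrightarrow> r \<le> s \<Longrightarrow> s \<le> T \<Longrightarrow> P \<inter> {r<..s} = {} \<Longrightarrow> G s - G r \<le> e"
  using assms unfolding fine_partition_def by auto

lemma fine_superset: "fine_partition T G e P \<Longrightarrow> P \<subseteq> Q \<Longrightarrow> finite Q \<Longrightarrow> Q \<subseteq> {0..T} \<Longrightarrow> fine_partition T G e Q"
  unfolding fine_partition_def by blast

lemma fine_lft:
  assumes "fine_partition T G e Q" "mono G" "0 \<le> p" "p < q" "q \<le> T" "Q \<inter> {p<..<q} = {}"
  shows "lft G q - G p \<le> e"
proof -
  have "0 \<le> e" using fineD(5)[OF assms(1), of p p] assms by auto
  have "lft G q \<le> G p + e"
  proof (rule lft_least)
    fix s assume "s < q"
    show "G s \<le> G p + e"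
    proof (cases "s \<le> p")
      case True
      then show ?thesis using monoD[OF assms(2), of s p] \<open>0 \<le> e\<close> by simp
    next
      case False
      then have "Q \<inter> {p<..s} = {}" using assms(6) \<open>s < q\<close> by force
      then show ?thesis using fineD(5)[OF assms(1), of p s] assms False \<open>s < q\<close> by simp
    qed
  qed
  then show ?thesis by simp
qed

text \<open>The partition consists of the end points and the points where \<open>G\<close> first
  reaches a level \<open>G 0 + k e\<close>. By right continuity the level is attained there, so an
  interval \<open>]r,s]\<close> on which \<open>G\<close> grows by more than \<open>e\<close>
  contains such a point.\<close>

lemma fine_exists:
  assumes G: "control G" and "0 \<le> T" "0 < e"
  obtains P where "fine_partition T G e P"
proof -
  define A where "A k = {t \<in> {0..T}. G 0 + real k * e \<le> G t}" for k :: nat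
  define K where "K = {k::nat. real k * e \<le> G T - G 0}"
  define P where "P = {0, T} \<union> (\<lambda>k. Inf (A k)) ` K"
  have TA: "T \<in> A k" if "k \<in> K" for k
    using that \<open>0 \<le> T\<close> by (auto simp: A_def K_def)
  have bdd: "bdd_below (A k)" for k by (intro bdd_belowI[of _ 0]) (auto simp: A_def)
  have Inf_range: "Inf (A k) \<in> {0..T}" if "k \<in> K" for k
  proof -
    have "0 \<le> Inf (A k)" using TA[OF that] by (intro cInf_greatest) (auto simp: A_def)
    moreover have "Inf (A k) \<le> T" using TA[OF that] bdd by (intro cInf_lower)
    ultimately show ?thesis by simp
  qed
  have Inf_val: "G 0 + real k * e \<le> G (Inf (A k))" if k: "k \<in> K" for k
  proof -
    have "(G \<longlongrightarrow> G (Inf (A k))) (at_right (Inf (A k)))"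
      using G unfolding control_def continuous_within by blast
    moreover have "eventually (\<lambda>t. G 0 + real k * e \<le> G t) (at_right (Inf (A k)))"
    proof (rule eventually_at_rightI[of _ "Inf (A k) + 1"])
      fix t assume "t \<in> {Inf (A k)<..<Inf (A k) + 1}"
      then obtain a where "a \<in> A k" "a < t"
        using TA[OF k] bdd cInf_less_iff[of "A k" t] by auto
      then show "G 0 + real k * e \<le> G t"
        using control_mono[OF G, of a t] by (auto simp: A_def)
    qed simp
    ultimately show ?thesis by (rule tendsto_lowerbound) simp
  qed
  have "finite K"
  proof (rule finite_subset)
    show "K \<subseteq> {..nat \<lfloor>(G T - G 0) / e\<rfloor>}"
    proof
      fix k assume "k \<in> K"
      then have "real k \<le> (G T - G 0) / e" using \<open>0 < e\<close> by (simp add: K_def field_simps)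
      then show "k \<in> {..nat \<lfloor>(G T - G 0) / e\<rfloor>}" by (simp add: le_nat_floor)
    qed
  qed simp
  have "fine_partition T G e P"
    unfolding fine_partition_def
  proof (intro conjI allI impI)
    show "finite P" using \<open>finite K\<close> by (simp add: P_def)
    show "P \<subseteq> {0..T}" using Inf_range \<open>0 \<le> T\<close> by (auto simp: P_def)
    show "0 \<in> P" "T \<in> P" by (auto simp: P_def)
    fix r s assume rs: "0 \<le> r" "r \<le> s" "s \<le> T" "P \<inter> {r<..s} = {}"
    show "G s - G r \<le> e"
    proof (rule ccontr)
      assume big: "\<not> G s - G r \<le> e"
      \<comment> \<open>The first level strictly above \<open>G r\<close>. It is at most
        \<open>G r + e\<close>, hence below \<open>G s\<close>.\<close>
      define k where "k = Suc (nat \<lfloor>(G r - G 0) / e\<rfloor>)"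
      have nn: "0 \<le> (G r - G 0) / e" using control_mono[OF G rs(1)] \<open>0 < e\<close> by simp
      have "(G r - G 0) / e < real k" "real k \<le> (G r - G 0) / e + 1"
        unfolding k_def using nn by linarith+
      then have k: "G r < G 0 + real k * e" "G 0 + real k * e \<le> G s"
        using \<open>0 < e\<close> big by (auto simp: field_simps)
      then have kK: "k \<in> K" using control_mono[OF G rs(3)] by (simp add: K_def)
      have "Inf (A k) \<le> s"
        using k rs bdd by (intro cInf_lower) (auto simp: A_def)
      moreover have "r < Inf (A k)"
      proof (rule ccontr)
        assume "\<not> r < Inf (A k)"
        then have "G (Inf (A k)) \<le> G r" by (intro control_mono[OF G]) simp
        then show False using Inf_val[OF kK] k by simp
      qed
      ultimately have "Inf (A k) \<in> P \<inter> {r<..s}" using kK by (auto simp: P_def)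
      then show False using rs by blast
    qed
  qed
  then show thesis by (rule that)
qed

section \<open>The integrated variational inequality and its stability\<close>

text \<open>
  This is the variational inequality integrated over \<open>]s,t]\<close>, with \<open>x(\<tau>)\<close> replaced by \<open>x(t)\<close>. The
  replacement is exact at \<open>\<tau> = t\<close>, so the atom at \<open>t\<close> does not enter the last factor. Only this makes the
  errors sum to something small along fine partitions.
\<close>

definition sweep :: "'a::real_inner set \<Rightarrow> real \<Rightarrow> (real \<Rightarrow> real) \<Rightarrow> (real \<Rightarrow> 'a) \<Rightarrow> (real \<Rightarrow> 'a) \<Rightarrow> bool" where
  "sweep Z T G u y \<longleftrightarrow> (\<forall>t\<in>{0..T}. u t - y t \<in> Z) \<and>
    (\<forall>s t. 0 \<le> s \<longrightarrow> s < t \<longrightarrow> t \<le> T \<longrightarrow> (\<forall>z\<in>Z.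
      (y t - y s) \<bullet> (z - (u t - y t)) \<le> (G t - G s) * (lft G t - G s)))"

lemma sweepD:
  assumes "sweep Z T G u y"
  shows "t \<in> {0..T} \<Longrightarrow> u t - y t \<in> Z"
    and "0 \<le> s \<Longrightarrow> s < t \<Longrightarrow> t \<le> T \<Longrightarrow> z \<in> Z \<Longrightarrow>
      (y t - y s) \<bullet> (z - (u t - y t)) \<le> (G t - G s) * (lft G t - G s)"
  using assms unfolding sweep_def by auto

lemma sweep_fine:
  assumes "sweep Z T G u y" "control G" "fine_partition T G e Q"
    and "0 \<le> p" "p < q" "q \<le> T" "Q \<inter> {p<..<q} = {}" "z \<in> Z"
  shows "(y q - y p) \<bullet> (z - (u q - y q)) \<le> (G q - G p) * e"
proof -
  have "(y q - y p) \<bullet> (z - (u q - y q)) \<le> (G q - G p) * (lft G q - G p)"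
    using assms by (intro sweepD(2)) auto
  also have "\<dots> \<le> (G q - G p) * e"
    using assms fine_lft[OF assms(3) _ assms(4-7)] control_mono[OF assms(2), of p q]
    by (intro mult_left_mono) (auto simp: control_def)
  finally show ?thesis .
qed

text \<open>With \<open>x\<close> for the difference of the two states, the backward estimate
  \<open>|x q|^2 - |x p|^2 \<le> 2 <x q, x q - x p>\<close> matches \<open>sweep\<close>, which also
  evaluates the state at the right end. Testing each inequality with the other state makes the
  \<open>dy\<close> terms negligible. Only \<open>d(u1 - u2)\<close> remains, weighted by the a
  priori bound \<open>S\<close>.\<close>

lemma sweep_stability_step:
  fixes u1 u2 y1 y2 :: "real \<Rightarrow> 'a::real_inner"
  assumes G: "control G1" "control G2"
    and sw: "sweep Z T G1 u1 y1" "sweep Z T G2 u2 y2"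
    and d: "bounded_variation T (\<lambda>t. u1 t - u2 t)"
    and S: "\<And>t. t \<in> {0..T} \<Longrightarrow> norm ((u1 t - y1 t) - (u2 t - y2 t)) \<le> S"
    and t: "t \<in> {0..T}"
  shows "(norm ((u1 t - y1 t) - (u2 t - y2 t)))\<^sup>2 \<le>
    (norm ((u1 0 - y1 0) - (u2 0 - y2 0)))\<^sup>2 + 2 * S * cumvar T (\<lambda>t. u1 t - u2 t) T"
proof -
  interpret d: bounded_variation T "\<lambda>t. u1 t - u2 t" by fact
  define d where "d = (\<lambda>t. u1 t - u2 t)"
  define x where "x = (\<lambda>t. (u1 t - y1 t) - (u2 t - y2 t))"
  let ?D = "cumvar T d T"
  have S0: "0 \<le> S" using S[OF t] norm_ge_zero order_trans by blast
  have "(norm (x t))\<^sup>2 \<le> (norm (x 0))\<^sup>2 + 2 * S * ?D + e * (2 * (G1 t - G1 0 + (G2 t - G2 0)))"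
    if e: "0 < e" for e
  proof -
    obtain P1 where P1: "fine_partition T G1 e P1" using fine_exists[OF G(1) _ e] d.T by (metis less_imp_le)
    obtain P2 where P2: "fine_partition T G2 e P2" using fine_exists[OF G(2) _ e] d.T by (metis less_imp_le)
    define Q where "Q = insert t (P1 \<union> P2)"
    have Q: "finite Q" "Q \<subseteq> {0..T}" "0 \<in> Q" "t \<in> Q"
      using fineD(1-4)[OF P1] fineD(1-4)[OF P2] t by (auto simp: Q_def)
    have f1: "fine_partition T G1 e Q" by (rule fine_superset[OF P1]) (use Q in \<open>auto simp: Q_def\<close>)
    have f2: "fine_partition T G2 e Q" by (rule fine_superset[OF P2]) (use Q in \<open>auto simp: Q_def\<close>)
    have "(norm (x t))\<^sup>2 - (norm (x 0))\<^sup>2 = csum Q 0 t (\<lambda>p q. (norm (x q))\<^sup>2 - (norm (x p))\<^sup>2)"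
      using Q t by (subst csum_telescope) auto
    also have "\<dots> \<le> csum Q 0 t (\<lambda>p q. (2 * S) * norm (d q - d p) + (2 * e) * ((G1 q - G1 p) + (G2 q - G2 p)))"
    proof (rule csum_mono)
      fix p q assume pq: "p \<in> Q" "q \<in> Q" "0 \<le> p" "p < q" "q \<le> t" "Q \<inter> {p<..<q} = {}"
      have q: "q \<in> {0..T}" "q \<le> T" using pq Q by auto
      have sq: "(norm (x q))\<^sup>2 - (norm (x p))\<^sup>2 = 2 * (x q \<bullet> (x q - x p)) - (norm (x q - x p))\<^sup>2"
        by (simp add: power2_norm_eq_inner inner_diff inner_commute algebra_simps)
      have split: "x q \<bullet> (x q - x p) = x q \<bullet> (d q - d p) +
          (y1 q - y1 p) \<bullet> ((u2 q - y2 q) - (u1 q - y1 q)) + (y2 q - y2 p) \<bullet> ((u1 q - y1 q) - (u2 q - y2 q))"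
        by (simp add: x_def d_def inner_diff inner_commute algebra_simps)
      have "(y1 q - y1 p) \<bullet> ((u2 q - y2 q) - (u1 q - y1 q)) \<le> (G1 q - G1 p) * e"
        using sweep_fine[OF sw(1) G(1) f1 pq(3,4) q(2) pq(6)] sweepD(1)[OF sw(2) q(1)] by blast
      moreover have "(y2 q - y2 p) \<bullet> ((u1 q - y1 q) - (u2 q - y2 q)) \<le> (G2 q - G2 p) * e"
        using sweep_fine[OF sw(2) G(2) f2 pq(3,4) q(2) pq(6)] sweepD(1)[OF sw(1) q(1)] by blast
      moreover have "x q \<bullet> (d q - d p) \<le> S * norm (d q - d p)"
      proof -
        have "x q \<bullet> (d q - d p) \<le> norm (x q) * norm (d q - d p)" by (rule norm_cauchy_schwarz)
        also have "\<dots> \<le> S * norm (d q - d p)"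
          using S[OF q(1)] by (intro mult_right_mono) (auto simp: x_def)
        finally show ?thesis .
      qed
      ultimately have "2 * (x q \<bullet> (x q - x p)) \<le>
          (2 * S) * norm (d q - d p) + (2 * e) * ((G1 q - G1 p) + (G2 q - G2 p))"
        unfolding split by (simp add: algebra_simps)
      then show "(norm (x q))\<^sup>2 - (norm (x p))\<^sup>2 \<le>
          (2 * S) * norm (d q - d p) + (2 * e) * ((G1 q - G1 p) + (G2 q - G2 p))"
        unfolding sq using zero_le_power2[of "norm (x q - x p)"] by linarith
    qed (use Q in auto)
    also have "\<dots> = (2 * S) * csum Q 0 t (\<lambda>p q. norm (d q - d p)) + (2 * e) * ((G1 t - G1 0) + (G2 t - G2 0))"
      using Q t by (simp add: csum_add csum_cmult csum_telescope)
    also have "(2 * S) * csum Q 0 t (\<lambda>p q. norm (d q - d p)) \<le> (2 * S) * ?D"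
    proof (rule mult_left_mono)
      have "csum Q 0 t (\<lambda>p q. norm (d q - d p)) \<le> cumvar T d t - cumvar T d 0"
        unfolding d_def using Q t by (intro d.csum_le_cumvar) auto
      also have "\<dots> \<le> ?D"
        using monoD[OF d.mono_cumvar, of t T] d.cumvar_eq_0[of 0] t by (simp add: d_def)
      finally show "csum Q 0 t (\<lambda>p q. norm (d q - d p)) \<le> ?D" .
    qed (use S0 in simp)
    finally show ?thesis by (simp add: algebra_simps)
  qed
  then have "(norm (x t))\<^sup>2 \<le> (norm (x 0))\<^sup>2 + 2 * S * ?D" by (rule le_from_eps)
  then show ?thesis by (simp add: x_def d_def)
qed

text \<open>The supremum \<open>S\<close> of the distance serves as its own a priori bound. The
  preceding lemma then gives \<open>S^2 \<le> a^2 + 2 S D\<close>, with \<open>a\<close> the initial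
  distance, and this forces \<open>S \<le> a + 2 D\<close>. The variation hypotheses ensure that
  \<open>S\<close> is finite.\<close>

lemma sweep_stability:
  fixes u1 u2 y1 y2 :: "real \<Rightarrow> 'a::real_inner"
  assumes G: "control G1" "control G2"
    and sw: "sweep Z T G1 u1 y1" "sweep Z T G2 u2 y2"
    and d: "bounded_variation T (\<lambda>t. u1 t - u2 t)" "bounded_variation T (\<lambda>t. y1 t - y2 t)"
    and t: "t \<in> {0..T}"
  shows "norm ((u1 t - y1 t) - (u2 t - y2 t)) \<le>
    norm ((u1 0 - y1 0) - (u2 0 - y2 0)) + 2 * cumvar T (\<lambda>t. u1 t - u2 t) T"
proof -
  interpret u: bounded_variation T "\<lambda>t. u1 t - u2 t" by fact
  interpret y: bounded_variation T "\<lambda>t. y1 t - y2 t" by fact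
  define x where "x = (\<lambda>t. norm ((u1 t - y1 t) - (u2 t - y2 t)))"
  let ?D = "cumvar T (\<lambda>t. u1 t - u2 t) T"
  define S where "S = (SUP t\<in>{0..T}. x t)"
  have "x t \<le> norm (u1 0 - u2 0) + norm (y1 0 - y2 0) + ?D + cumvar T (\<lambda>t. y1 t - y2 t) T"
    if "t \<in> {0..T}" for t
  proof -
    have "x t = norm ((u1 0 - u2 0) - (y1 0 - y2 0) + ((u1 t - u2 t) - (u1 0 - u2 0)) - ((y1 t - y2 t) - (y1 0 - y2 0)))"
      by (simp add: x_def algebra_simps)
    also have "\<dots> \<le> norm (u1 0 - u2 0) + norm (y1 0 - y2 0) + norm ((u1 t - u2 t) - (u1 0 - u2 0))
      + norm ((y1 t - y2 t) - (y1 0 - y2 0))" by norm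
    finally show ?thesis
      using that u.norm_diff_le_cumvar[of 0 t] y.norm_diff_le_cumvar[of 0 t]
        monoD[OF u.mono_cumvar, of t T] monoD[OF y.mono_cumvar, of t T] u.cumvar_eq_0[of 0] y.cumvar_eq_0[of 0]
      by simp
  qed
  then have bdd: "bdd_above (x ` {0..T})" by (rule bdd_aboveI2)
  have xS: "x t \<le> S" if "t \<in> {0..T}" for t
    unfolding S_def using that bdd by (rule cSUP_upper)
  have D: "0 \<le> ?D" by (rule u.cumvar_nonneg)
  have x0: "0 \<le> x 0" by (simp add: x_def)
  have S0: "0 \<le> S" using xS[of 0] x0 u.T by simp
  have sq: "(x t)\<^sup>2 \<le> (x 0)\<^sup>2 + 2 * S * ?D" if "t \<in> {0..T}" for t
    unfolding x_def using xS that unfolding x_def by (intro sweep_stability_step[OF G sw d(1)]) auto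
  have "S \<le> sqrt ((x 0)\<^sup>2 + 2 * S * ?D)"
    unfolding S_def
  proof (rule cSUP_least)
    show "{0..T} \<noteq> {}" using u.T by simp
    fix t assume "t \<in> {0..T}"
    then show "x t \<le> sqrt ((x 0)\<^sup>2 + 2 * (SUP t\<in>{0..T}. x t) * ?D)"
      using sq by (intro real_le_rsqrt) (simp add: S_def)
  qed
  then have S2: "S\<^sup>2 \<le> (x 0)\<^sup>2 + 2 * S * ?D"
    using power_mono[OF _ S0, of "sqrt ((x 0)\<^sup>2 + 2 * S * ?D)" 2] S0 D by simp
  have "S \<le> x 0 + 2 * ?D"
  proof (rule ccontr)
    assume "\<not> S \<le> x 0 + 2 * ?D"
    then have less: "x 0 + 2 * ?D < S" by simp
    then have "S * (x 0 + 2 * ?D) < S * S" using x0 D by (intro mult_strict_left_mono) auto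
    moreover have "x 0 * x 0 \<le> S * x 0" using less x0 D by (intro mult_right_mono) auto
    ultimately show False using S2 by (simp add: power2_eq_square algebra_simps)
  qed
  then show ?thesis using xS[OF t] by (simp add: x_def)
qed

section \<open>Existence by the catching-up algorithm\<close>

text \<open>A minimising sequence is Cauchy by the parallelogram identity, because midpoints stay in
  the convex set \<open>Z\<close>; completeness takes the place of compactness.\<close>

lemma projection_exists:
  fixes Z :: "'a::{real_inner, banach} set"
  assumes "Z \<noteq> {}" "closed Z" "convex Z"
  obtains p where "p \<in> Z" "\<And>z. z \<in> Z \<Longrightarrow> (a - p) \<bullet> (z - p) \<le> 0"
proof -
  define d where "d = (INF z\<in>Z. (norm (a - z))\<^sup>2)"
  have bdd: "bdd_below ((\<lambda>z. (norm (a - z))\<^sup>2) ` Z)" by (intro bdd_belowI2[of _ 0]) auto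
  have d_le: "d \<le> (norm (a - z))\<^sup>2" if "z \<in> Z" for z
    unfolding d_def using bdd that by (rule cINF_lower)
  have "\<exists>z\<in>Z. (norm (a - z))\<^sup>2 < d + inverse (real (Suc n))" for n
    using cINF_less_iff[OF assms(1) bdd, of "d + inverse (real (Suc n))"] by (simp add: d_def)
  then obtain f where f: "\<And>n. f n \<in> Z" "\<And>n. (norm (a - f n))\<^sup>2 < d + inverse (real (Suc n))"
    by metis
  have par: "(norm (f m - f n))\<^sup>2 \<le> 2 * (inverse (real (Suc m)) + inverse (real (Suc n)))" for m n
  proof -
    have "(1/2) *\<^sub>R f m + (1/2) *\<^sub>R f n \<in> Z" using f(1) by (intro convexD[OF assms(3)]) auto
    then have "d \<le> (norm (a - ((1/2) *\<^sub>R f m + (1/2) *\<^sub>R f n)))\<^sup>2" by (rule d_le)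
    moreover have "(norm (f m - f n))\<^sup>2 = 2 * (norm (a - f m))\<^sup>2 + 2 * (norm (a - f n))\<^sup>2
        - 4 * (norm (a - ((1/2) *\<^sub>R f m + (1/2) *\<^sub>R f n)))\<^sup>2"
      by (simp add: power2_norm_eq_inner inner_diff inner_add inner_commute algebra_simps)
    ultimately show ?thesis using f(2)[of m] f(2)[of n] by (simp only: ring_distribs)
  qed
  define i where "i k = inverse (real (Suc k))" for k
  have "Cauchy f"
  proof (rule CauchyI)
    fix e :: real assume "0 < e"
    obtain N where N: "inverse (real (Suc N)) < e\<^sup>2 / 4"
      using reals_Archimedean[of "e\<^sup>2 / 4"] \<open>0 < e\<close> by auto
    have "norm (f m - f n) < e" if "N \<le> m" "N \<le> n" for m n
    proof -
      have "inverse (real (Suc k)) \<le> inverse (real (Suc N))" if "N \<le> k" for k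
        using that by (intro le_imp_inverse_le) auto
      from this[OF that(1)] this[OF that(2)] have "(norm (f m - f n))\<^sup>2 < e\<^sup>2"
        using par[of m n] N unfolding i_def[symmetric] by argo
      then show ?thesis using \<open>0 < e\<close> by (simp add: power2_less_imp_less)
    qed
    then show "\<exists>M. \<forall>m\<ge>M. \<forall>n\<ge>M. norm (f m - f n) < e" by blast
  qed
  then obtain p where p: "f \<longlonglongrightarrow> p" using Cauchy_convergent_iff convergent_def by blast
  have pZ: "p \<in> Z" using closed_sequentially[OF assms(2) _ p] f(1) by blast
  have "(\<lambda>n. (norm (a - f n))\<^sup>2) \<longlonglongrightarrow> (norm (a - p))\<^sup>2"
    by (intro tendsto_intros p)
  moreover have "(\<lambda>n. d + inverse (real (Suc n))) \<longlonglongrightarrow> d"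
    using tendsto_add[OF tendsto_const LIMSEQ_inverse_real_of_nat, of d] by simp
  ultimately have min: "(norm (a - p))\<^sup>2 \<le> d"
    by (rule LIMSEQ_le) (use f(2) in \<open>auto intro: less_imp_le\<close>)
  have "norm (a - p) \<le> norm (a - z)" if "z \<in> Z" for z
    using order_trans[OF min d_le[OF that]] by (rule power2_le_imp_le) simp
  then have "(a - p) \<bullet> (z - p) \<le> 0" if "z \<in> Z" for z
    using any_closest_point_dot[OF assms(3,2) pZ that, of a] by (simp add: dist_norm)
  then show thesis using that pZ by blast
qed

text \<open>Inserting \<open>0\<close> supplies the initial time as value when \<open>P\<close> has
  no point up to \<open>t\<close>. The function \<open>t \<mapsto> u (floor_in P t)\<close> is the
  piecewise constant sample of \<open>u\<close>.\<close>

definition floor_in :: "real set \<Rightarrow> real \<Rightarrow> real" where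
  "floor_in P t = Max (insert 0 (P \<inter> {..t}))"

lemma floor_in:
  assumes "finite P" "P \<subseteq> {0..}" "0 \<le> t"
  shows "0 \<le> floor_in P t" and "floor_in P t \<le> t"
    and "P \<inter> {floor_in P t<..t} = {}"
proof -
  have "floor_in P t \<in> insert 0 (P \<inter> {..t})"
    unfolding floor_in_def using assms by (intro Max_in) auto
  then show "floor_in P t \<le> t" using assms by auto
  show "0 \<le> floor_in P t" unfolding floor_in_def using assms by (intro Max_ge) auto
  have "r \<le> floor_in P t" if "r \<in> P" "r \<le> t" for r
    unfolding floor_in_def using assms that by (intro Max_ge) auto
  then show "P \<inter> {floor_in P t<..t} = {}" by force
qed

lemma floor_in_mono:
  assumes "finite P" "s \<le> t"
  shows "floor_in P s \<le> floor_in P t"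
  unfolding floor_in_def using assms by (intro Max_mono) auto

text \<open>Between nodes \<open>y\<close> is constant, and at a node \<open>q\<close> it is
  projected onto \<open>u q - Z\<close>; the last clause is the variational form of that projection.
  It is stated for every \<open>p\<close> from the preceding node up to \<open>q\<close>, so that it
  can be read along any refinement of \<open>P\<close>.\<close>

definition catching_up :: "'a::real_inner set \<Rightarrow> 'a \<Rightarrow> (real \<Rightarrow> 'a) \<Rightarrow> real set \<Rightarrow> (real \<Rightarrow> 'a) \<Rightarrow> bool" where
  "catching_up Z z0 u P y \<longleftrightarrow> y 0 = u 0 - z0 \<and>
    (\<forall>t\<ge>0. u (floor_in P t) - y t \<in> Z) \<and>
    (\<forall>s t. 0 \<le> s \<longrightarrow> s \<le> t \<longrightarrow> P \<inter> {s<..t} = {} \<longrightarrow> y s = y t) \<and>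
    (\<forall>p q. q \<in> P \<longrightarrow> 0 \<le> p \<longrightarrow> p < q \<longrightarrow> P \<inter> {p<..<q} = {} \<longrightarrow>
      (\<forall>z\<in>Z. (y q - y p) \<bullet> (z - (u (floor_in P q) - y q)) \<le> 0))"

text \<open>Nodes are added in increasing order, so a new node \<open>b\<close> leaves the process
  before \<open>b\<close> untouched. The old \<open>y\<close> is constant after its last node, hence
  \<open>y b\<close> is still the value just before the new jump and is the point to be
  projected.\<close>

lemma catching_up_exists:
  fixes Z :: "'a::{real_inner, banach} set"
  assumes Z: "Z \<noteq> {}" "closed Z" "convex Z" and z0: "z0 \<in> Z"
    and "finite P" "P \<subseteq> {0<..}"
  shows "\<exists>y. catching_up Z z0 u P y"
  using assms(5,6)
proof (induction P rule: finite_linorder_max_induct)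
  case empty
  show ?case
    by (intro exI[of _ "\<lambda>_. u 0 - z0"]) (auto simp: catching_up_def floor_in_def z0)
next
  case (insert b P)
  then obtain y where y: "catching_up Z z0 u P y" by auto
  have b: "0 < b" using insert by auto
  from projection_exists[OF Z, of "u b - y b"] obtain x
    where x: "x \<in> Z" "\<And>z. z \<in> Z \<Longrightarrow> (u b - y b - x) \<bullet> (z - x) \<le> 0" by blast
  define y' where "y' t = (if t < b then y t else u b - x)" for t
  have lo: "insert b P \<inter> {..t} = P \<inter> {..t}" if "t < b" for t using that by auto
  have fl_lo: "floor_in (insert b P) t = floor_in P t" if "t < b" for t
    unfolding floor_in_def lo[OF that] ..
  have fl_hi: "floor_in (insert b P) t = b" if "b \<le> t" for t
    unfolding floor_in_def using insert that b by (intro Max_eqI) (auto intro: less_imp_le)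
  have "catching_up Z z0 u (insert b P) y'"
    unfolding catching_up_def
  proof (intro conjI allI impI ballI)
    show "y' 0 = u 0 - z0" using y b by (simp add: y'_def catching_up_def)
  next
    fix t :: real assume "0 \<le> t"
    then show "u (floor_in (insert b P) t) - y' t \<in> Z"
      using y x fl_lo fl_hi by (auto simp: y'_def catching_up_def)
  next
    fix s t assume st: "0 \<le> s" "s \<le> t" "insert b P \<inter> {s<..t} = {}"
    then have "P \<inter> {s<..t} = {}" "\<not> (s < b \<and> b \<le> t)" by auto
    moreover have "y s = y t" using y st calculation unfolding catching_up_def by blast
    ultimately show "y' s = y' t" using st(2) by (auto simp: y'_def)
  next
    fix p q z assume pq: "q \<in> insert b P" "0 \<le> p" "p < q" "insert b P \<inter> {p<..<q} = {}" and z: "z \<in> Z"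
    show "(y' q - y' p) \<bullet> (z - (u (floor_in (insert b P) q) - y' q)) \<le> 0"
    proof (cases "q = b")
      case True
      have "P \<inter> {p<..b} = {}" using pq True insert.hyps by force
      then have "y p = y b" using y pq True unfolding catching_up_def by (metis less_imp_le)
      then show ?thesis using x(2)[OF z] True pq fl_hi[of b] by (simp add: y'_def algebra_simps)
    next
      case False
      then have "q \<in> P" "q < b" using pq insert.hyps by auto
      moreover have "P \<inter> {p<..<q} = {}" using pq by auto
      ultimately show ?thesis using y pq z fl_lo[of q] unfolding catching_up_def by (simp add: y'_def)
    qed
  qed
  then show ?case by blast
qed

text \<open>Fine partitions contain \<open>0\<close>, while the construction takes positive nodes. A
  node at \<open>0\<close> is harmless: no \<open>p\<close> with \<open>0 \<le> p < 0\<close>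
  precedes it, and \<open>floor_in\<close> returns \<open>0\<close> by default.\<close>

lemma catching_up_remove_0:
  assumes "catching_up Z z0 u (P - {0}) y"
  shows "catching_up Z z0 u P y"
proof -
  have fl: "floor_in (P - {0}) t = floor_in P t" if "0 \<le> t" for t
  proof -
    have "insert 0 ((P - {0}) \<inter> {..t}) = insert 0 (P \<inter> {..t})" by auto
    then show ?thesis unfolding floor_in_def by simp
  qed
  have gap: "(P - {0}) \<inter> {s<..t} = P \<inter> {s<..t}" "(P - {0}) \<inter> {s<..<t} = P \<inter> {s<..<t}"
    if "0 \<le> s" for s t
    using that by auto
  show ?thesis
    unfolding catching_up_def
  proof (intro conjI allI impI ballI)
    show "y 0 = u 0 - z0" using assms by (simp add: catching_up_def)
    show "u (floor_in P t) - y t \<in> Z" if "0 \<le> t" for t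
      using assms that fl[OF that] by (metis catching_up_def)
    show "y s = y t" if "0 \<le> s" "s \<le> t" "P \<inter> {s<..t} = {}" for s t
      using assms that gap(1)[OF that(1)] by (metis catching_up_def)
    show "(y q - y p) \<bullet> (z - (u (floor_in P q) - y q)) \<le> 0"
      if "q \<in> P" "0 \<le> p" "p < q" "P \<inter> {p<..<q} = {}" "z \<in> Z" for p q z
    proof -
      have "q \<in> P - {0}" "0 \<le> q" using that by auto
      moreover have "(P - {0}) \<inter> {p<..<q} = {}" using that gap(2)[OF that(2)] by simp
      ultimately show ?thesis using assms that fl[of q] unfolding catching_up_def by metis
    qed
  qed
qed

locale catching_up_process = bounded_variation T u
  for T and u :: "real \<Rightarrow> 'a::real_inner" +
  fixes Z :: "'a set" and z0 :: 'a and e :: real and P :: "real set" and y :: "real \<Rightarrow> 'a"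
  assumes P: "fine_partition T (cumvar T u) e P" and y: "catching_up Z z0 u P y"
begin

abbreviation "fl \<equiv> floor_in P"
abbreviation "us \<equiv> \<lambda>t. u (fl t)"
abbreviation "Vs \<equiv> \<lambda>t. V (fl t)"

lemma fin: "finite P" and P_nonneg: "P \<subseteq> {0..}"
  using fineD[OF P] by auto

lemmas fl = floor_in[OF fin P_nonneg]

lemma Vs_le: "0 \<le> t \<Longrightarrow> Vs t \<le> V t"
  using fl(2) by (intro monoD[OF mono_cumvar])

lemma Vs_mono: "s \<le> t \<Longrightarrow> Vs s \<le> Vs t"
  by (intro monoD[OF mono_cumvar] floor_in_mono fin)

lemma Vs_ge: "0 \<le> t \<Longrightarrow> t \<le> T \<Longrightarrow> V t - Vs t \<le> e"
  by (intro fineD(5)[OF P] fl)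

lemma us_close: "0 \<le> t \<Longrightarrow> t \<le> T \<Longrightarrow> norm (u t - us t) \<le> e"
  using norm_diff_le_cumvar[of "fl t" t] Vs_ge[of t] fl[of t] by simp

text \<open>Testing the projection inequality with the state at \<open>p\<close> gives
  \<open><\<Delta>y, \<Delta>x> \<ge> 0\<close> for \<open>x = us - y\<close>. Hence
  \<open>\<Delta>x\<close>, \<open>\<Delta>y\<close> and \<open>\<Delta>y - \<Delta>x\<close> are no
  longer than \<open>\<Delta>x + \<Delta>y\<close>, the increment of the sampled input.\<close>

lemma cell:
  assumes Q: "P \<subseteq> Q" and pq: "0 \<le> p" "p < q" "q \<le> T" "Q \<inter> {p<..<q} = {}"
  shows cell_variational: "z \<in> Z \<Longrightarrow> (y q - y p) \<bullet> (z - (us q - y q)) \<le> 0"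
    and cell_y: "norm (y q - y p) \<le> Vs q - Vs p"
    and cell_x: "norm ((us q - y q) - (us p - y p)) \<le> Vs q - Vs p"
    and cell_w: "norm ((y q - (us q - y q)) - (y p - (us p - y p))) \<le> Vs q - Vs p"
proof -
  show var: "(y q - y p) \<bullet> (z - (us q - y q)) \<le> 0" if "z \<in> Z" for z
  proof (cases "q \<in> P")
    case True
    have "P \<inter> {p<..<q} = {}" using Q pq by auto
    then show ?thesis using y True pq that unfolding catching_up_def by blast
  next
    case False
    have "P \<inter> {p<..q} = {}"
    proof safe
      fix r assume "r \<in> P" "r \<in> {p<..q}"
      then show "r \<in> {}" using False Q pq(4) by (cases "r = q") auto
    qed
    then have "y p = y q" using y pq unfolding catching_up_def by (meson less_imp_le)
    then show ?thesis by simp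
  qed
  define a where "a = y q - y p"
  define b where "b = (us q - y q) - (us p - y p)"
  have "us p - y p \<in> Z" using y pq unfolding catching_up_def by blast
  from var[OF this] have ab: "0 \<le> a \<bullet> b" by (simp add: a_def b_def inner_diff algebra_simps)
  have "norm (a + b) = norm (us q - us p)" by (simp add: a_def b_def algebra_simps)
  also have "\<dots> \<le> Vs q - Vs p"
    using pq floor_in_mono[OF fin, of p q] fl[of p] fl[of q] by (intro norm_diff_le_cumvar) auto
  finally have *: "norm (a + b) \<le> Vs q - Vs p" .
  have sq: "(norm (a + b))\<^sup>2 = (norm a)\<^sup>2 + (norm b)\<^sup>2 + 2 * (a \<bullet> b)"
    "(norm (a - b))\<^sup>2 = (norm a)\<^sup>2 + (norm b)\<^sup>2 - 2 * (a \<bullet> b)"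
    by (auto simp: power2_norm_eq_inner inner_diff inner_add inner_commute algebra_simps)
  have "(norm a)\<^sup>2 \<le> (norm (a + b))\<^sup>2" "(norm b)\<^sup>2 \<le> (norm (a + b))\<^sup>2" "(norm (a - b))\<^sup>2 \<le> (norm (a + b))\<^sup>2"
    unfolding sq using ab by auto
  then have "norm a \<le> norm (a + b)" "norm b \<le> norm (a + b)" "norm (a - b) \<le> norm (a + b)"
    by (simp_all only: power2_le_imp_le norm_ge_zero)
  with * show "norm (y q - y p) \<le> Vs q - Vs p"
    "norm ((us q - y q) - (us p - y p)) \<le> Vs q - Vs p"
    "norm ((y q - (us q - y q)) - (y p - (us p - y p))) \<le> Vs q - Vs p"
    by (auto simp: a_def b_def algebra_simps)
qed

lemma increments_le:
  assumes f: "\<And>Q p q. P \<subseteq> Q \<Longrightarrow> 0 \<le> p \<Longrightarrow> p < q \<Longrightarrow> q \<le> T \<Longrightarrow> Q \<inter> {p<..<q} = {} \<Longrightarrow>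
      norm (f q - f p :: 'a) \<le> Vs q - Vs p"
    and st: "0 \<le> s" "s \<le> t" "t \<le> T"
  shows "norm (f t - f s) \<le> Vs t - Vs s"
proof -
  define Q where "Q = P \<union> {s, t}"
  have Q: "finite Q" "s \<in> Q" "t \<in> Q" "P \<subseteq> Q" using fin by (auto simp: Q_def)
  have "norm (f t - f s) \<le> csum Q s t (\<lambda>p q. norm (f q - f p))"
    using Q st by (intro norm_diff_le_csum)
  also have "\<dots> \<le> csum Q s t (\<lambda>p q. Vs q - Vs p)"
    using Q st by (intro csum_mono f[of Q]) auto
  finally show ?thesis using Q st by (simp add: csum_telescope)
qed

lemma y_increment: "0 \<le> s \<Longrightarrow> s \<le> t \<Longrightarrow> t \<le> T \<Longrightarrow> norm (y t - y s) \<le> Vs t - Vs s"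
  by (rule increments_le) (use cell_y in auto)

lemma x_increment: "0 \<le> s \<Longrightarrow> s \<le> t \<Longrightarrow> t \<le> T \<Longrightarrow>
    norm ((us t - y t) - (us s - y s)) \<le> Vs t - Vs s"
  by (rule increments_le[of "\<lambda>t. us t - y t"]) (use cell_x in auto)

lemma w_increment: "0 \<le> s \<Longrightarrow> s \<le> t \<Longrightarrow> t \<le> T \<Longrightarrow>
    norm ((y t - (us t - y t)) - (y s - (us s - y s))) \<le> Vs t - Vs s"
  by (rule increments_le[of "\<lambda>t. y t - (us t - y t)"]) (use cell_w in auto)

text \<open>In the last cell the state is already the one at \<open>t\<close>, so its contribution
  is nonpositive. In an earlier cell the state at \<open>q\<close> is exchanged for the state at
  \<open>t\<close>, at a cost bounded by the product of the two increments of \<open>Vs\<close>.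
  These cells all end before \<open>t\<close>, which is how \<open>lft V t\<close> arises instead of
  \<open>V t\<close>.\<close>

lemma variational:
  assumes st: "0 \<le> s" "s < t" "t \<le> T" and z: "z \<in> Z"
  shows "(y t - y s) \<bullet> (z - (us t - y t)) \<le> (Vs t - Vs s) * (lft V t - Vs s)"
proof -
  define Q where "Q = P \<union> {s, t}"
  have Q: "finite Q" "s \<in> Q" "t \<in> Q" "P \<subseteq> Q" using fin by (auto simp: Q_def)
  note r = prv[OF Q(1,2) st(2)]
  let ?c = "z - (us t - y t)"
  let ?F = "\<lambda>p q. (y q - y p) \<bullet> ?c"
  have "(y t - y s) \<bullet> ?c = csum Q s t (\<lambda>p q. y q - y p) \<bullet> ?c"
    using Q st by (simp add: csum_telescope)
  also have "\<dots> = csum Q s t ?F"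
    by (simp add: csum_inner_left)
  also have "\<dots> = csum Q s (prv Q t) ?F + ?F (prv Q t) t"
    using Q st by (intro csum_last) auto
  also have "?F (prv Q t) t \<le> 0"
    using r st Q z by (intro cell_variational[of Q]) auto
  also have "csum Q s (prv Q t) ?F \<le> csum Q s (prv Q t) (\<lambda>p q. (Vs t - Vs s) * (Vs q - Vs p))"
  proof (rule csum_mono)
    fix p q assume pq: "p \<in> Q" "q \<in> Q" "s \<le> p" "p < q" "q \<le> prv Q t" "Q \<inter> {p<..<q} = {}"
    have q: "0 \<le> p" "q < t" "0 \<le> q" "q \<le> T" using pq r st by auto
    have "?F p q = (y q - y p) \<bullet> (z - (us q - y q)) + (y q - y p) \<bullet> ((us q - y q) - (us t - y t))"
      by (simp add: inner_diff algebra_simps)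
    also have "\<dots> \<le> norm (y q - y p) * norm ((us q - y q) - (us t - y t))"
      using cell_variational[OF Q(4) q(1) pq(4) q(4) pq(6) z] norm_cauchy_schwarz[of "y q - y p" "(us q - y q) - (us t - y t)"]
      by linarith
    also have "\<dots> \<le> (Vs q - Vs p) * (Vs t - Vs s)"
    proof (rule mult_mono)
      show "norm (y q - y p) \<le> Vs q - Vs p" using q pq by (intro y_increment) auto
      have "norm ((us q - y q) - (us t - y t)) \<le> Vs t - Vs q"
        using x_increment[of q t] q st by (simp add: norm_minus_commute)
      also have "\<dots> \<le> Vs t - Vs s" using Vs_mono[of s q] pq by simp
      finally show "norm ((us q - y q) - (us t - y t)) \<le> Vs t - Vs s" .
    qed (use Vs_mono[of p q] pq in auto)
    finally show "?F p q \<le> (Vs t - Vs s) * (Vs q - Vs p)" by (simp add: mult.commute)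
  qed (use Q in auto)
  also have "\<dots> = (Vs t - Vs s) * (Vs (prv Q t) - Vs s)"
    using Q r by (simp add: csum_cmult csum_telescope)
  also have "\<dots> \<le> (Vs t - Vs s) * (lft V t - Vs s)"
  proof (rule mult_left_mono)
    have "Vs (prv Q t) \<le> V (prv Q t)" using r st by (intro Vs_le) auto
    also have "\<dots> \<le> lft V t" using r mono_cumvar by (intro lft_ge)
    finally show "Vs (prv Q t) - Vs s \<le> lft V t - Vs s" by simp
    show "0 \<le> Vs t - Vs s" using Vs_mono[of s t] st by simp
  qed
  finally show ?thesis by simp
qed

end

text \<open>On a common refinement the variational inequalities of both schemes hold without error.
  The squared distance telescopes as in the stability estimate, and what remains is the distance
  \<open>e1 + e2\<close> of the sampled inputs times the variations of the two discrete
  solutions.\<close>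

lemma catching_up_close:
  assumes "catching_up_process T u Z z0 e1 P1 y1" "catching_up_process T u Z z0 e2 P2 y2"
    and t: "t \<in> {0..T}"
  shows "(norm (y1 t - y2 t))\<^sup>2 \<le> 4 * (e1 + e2) * cumvar T u T"
proof -
  interpret A: catching_up_process T u Z z0 e1 P1 y1 by fact
  interpret B: catching_up_process T u Z z0 e2 P2 y2 by fact
  define Q where "Q = insert t (P1 \<union> P2)"
  have Q: "finite Q" "0 \<in> Q" "t \<in> Q" "P1 \<subseteq> Q" "P2 \<subseteq> Q"
    using fineD[OF A.P] B.fin by (auto simp: Q_def)
  define y where "y = (\<lambda>t. y1 t - y2 t)"
  have e: "0 \<le> e1" "0 \<le> e2"
    using fineD(5)[OF A.P, of 0 0] fineD(5)[OF B.P, of 0 0] A.T by auto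
  have "y 0 = 0" using A.y B.y by (simp add: y_def catching_up_def)
  then have "(norm (y t))\<^sup>2 = csum Q 0 t (\<lambda>p q. (norm (y q))\<^sup>2 - (norm (y p))\<^sup>2)"
    using Q t by (simp add: csum_telescope)
  also have "\<dots> \<le> csum Q 0 t (\<lambda>p q. (2 * (e1 + e2)) * ((A.Vs q - A.Vs p) + (B.Vs q - B.Vs p)))"
  proof (rule csum_mono)
    fix p q assume pq: "p \<in> Q" "q \<in> Q" "0 \<le> p" "p < q" "q \<le> t" "Q \<inter> {p<..<q} = {}"
    have q: "0 \<le> q" "q \<le> T" using pq t by auto
    define x where "x = (\<lambda>t. (A.us t - y1 t) - (B.us t - y2 t))"
    have sq: "(norm (y q))\<^sup>2 - (norm (y p))\<^sup>2 = 2 * (y q \<bullet> (y q - y p)) - (norm (y q - y p))\<^sup>2"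
      by (simp add: power2_norm_eq_inner inner_diff inner_commute algebra_simps)
    have split: "y q \<bullet> (y q - y p) = (A.us q - B.us q) \<bullet> (y q - y p) +
        (y1 q - y1 p) \<bullet> ((B.us q - y2 q) - (A.us q - y1 q)) + (y2 q - y2 p) \<bullet> ((A.us q - y1 q) - (B.us q - y2 q))"
      by (simp add: y_def inner_diff inner_commute algebra_simps)
    have "B.us q - y2 q \<in> Z" "A.us q - y1 q \<in> Z"
      using A.y B.y q unfolding catching_up_def by auto
    then have "(y1 q - y1 p) \<bullet> ((B.us q - y2 q) - (A.us q - y1 q)) \<le> 0"
      "(y2 q - y2 p) \<bullet> ((A.us q - y1 q) - (B.us q - y2 q)) \<le> 0"
      using A.cell_variational[OF Q(4) pq(3,4) q(2) pq(6)] B.cell_variational[OF Q(5) pq(3,4) q(2) pq(6)] by auto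
    moreover have "(A.us q - B.us q) \<bullet> (y q - y p) \<le> (e1 + e2) * ((A.Vs q - A.Vs p) + (B.Vs q - B.Vs p))"
    proof -
      have "(A.us q - B.us q) \<bullet> (y q - y p) \<le> norm (A.us q - B.us q) * norm (y q - y p)"
        by (rule norm_cauchy_schwarz)
      also have "\<dots> \<le> (e1 + e2) * ((A.Vs q - A.Vs p) + (B.Vs q - B.Vs p))"
      proof (rule mult_mono)
        have "norm (A.us q - B.us q) \<le> norm (u q - A.us q) + norm (u q - B.us q)" by norm
        then show "norm (A.us q - B.us q) \<le> e1 + e2"
          using A.us_close[OF q] B.us_close[OF q] by simp
        have "norm (y q - y p) \<le> norm (y1 q - y1 p) + norm (y2 q - y2 p)"
          unfolding y_def by norm
        then show "norm (y q - y p) \<le> (A.Vs q - A.Vs p) + (B.Vs q - B.Vs p)"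
          using A.y_increment[of p q] B.y_increment[of p q] pq q by simp
      qed (use e in auto)
      finally show ?thesis .
    qed
    moreover have "2 * (a + b + c) - n \<le> (2 * E) * X" if "b \<le> 0" "c \<le> 0" "a \<le> E * X" "0 \<le> n" for a b c n E X :: real
        using that by argo
    ultimately show "(norm (y q))\<^sup>2 - (norm (y p))\<^sup>2 \<le> (2 * (e1 + e2)) * ((A.Vs q - A.Vs p) + (B.Vs q - B.Vs p))"
      unfolding sq split using zero_le_power2 by blast
  qed (use Q in auto)
  also have "\<dots> = (2 * (e1 + e2)) * ((A.Vs t - A.Vs 0) + (B.Vs t - B.Vs 0))"
    using Q t by (simp add: csum_cmult csum_add csum_telescope)
  also have "\<dots> \<le> (2 * (e1 + e2)) * (A.V T + A.V T)"
  proof (rule mult_left_mono)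
    have "A.Vs t \<le> A.V T" "B.Vs t \<le> A.V T"
      using A.Vs_le[of t] B.Vs_le[of t] t monoD[OF A.mono_cumvar, of t T] by auto
    then show "(A.Vs t - A.Vs 0) + (B.Vs t - B.Vs 0) \<le> A.V T + A.V T"
      using A.cumvar_nonneg[of "A.fl 0"] A.cumvar_nonneg[of "B.fl 0"] by linarith
  qed (use e in auto)
  finally show ?thesis by (simp add: y_def algebra_simps)
qed

text \<open>
  The domination of \<open>y\<close>, \<open>x\<close> and \<open>w\<close> by \<open>V\<close> stems from \<open>\<langle>\<Delta>x, \<Delta>y\<rangle> \<ge> 0\<close> in each step of the algorithm. It cannot
  be read off from the integrated inequality, whose error is of the same order as \<open>\<langle>\<Delta>x, \<Delta>y\<rangle>\<close>.
\<close>

definition regular_solution :: "'a::real_inner set \<Rightarrow> real \<Rightarrow> 'a \<Rightarrow> (real \<Rightarrow> 'a) \<Rightarrow> (real \<Rightarrow> 'a) \<Rightarrow> bool" where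
  "regular_solution Z T z0 u y \<longleftrightarrow> y 0 = u 0 - z0 \<and> sweep Z T (cumvar T u) u y \<and>
    (\<forall>s t. 0 \<le> s \<longrightarrow> s \<le> t \<longrightarrow> t \<le> T \<longrightarrow>
      norm (y t - y s) \<le> cumvar T u t - cumvar T u s \<and>
      norm ((u t - y t) - (u s - y s)) \<le> cumvar T u t - cumvar T u s \<and>
      norm ((y t - (u t - y t)) - (y s - (u s - y s))) \<le> cumvar T u t - cumvar T u s)"

text \<open>With tolerances \<open>1/(n+1)\<close> the discrete solutions form pointwise Cauchy
  sequences, and the samples of \<open>u\<close> and \<open>V\<close> converge too. Each clause of
  \<open>regular_solution\<close> is an equality, a weak inequality or membership in the closed set
  \<open>Z\<close>, and so survives the limit.\<close>

lemma regular_solution_exists: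
  fixes Z :: "'a::{real_inner, banach} set"
  assumes Z: "Z \<noteq> {}" "closed Z" "convex Z" and z0: "z0 \<in> Z"
    and u: "bounded_variation T u" and rc: "\<forall>t\<in>{0..<T}. (u \<longlongrightarrow> u t) (at_right t)"
  obtains y where "regular_solution Z T z0 u y"
proof -
  interpret bounded_variation T u by fact
  have ctrl: "control V" unfolding control_def using mono_cumvar cumvar_right_cont[OF rc] by blast
  have "\<exists>P y. catching_up_process T u Z z0 (inverse (real (Suc n))) P y" for n
  proof -
    obtain P where P: "fine_partition T V (inverse (real (Suc n))) P"
      using fine_exists[OF ctrl, of T "inverse (real (Suc n))"] T by auto
    have "finite (P - {0})" "P - {0} \<subseteq> {0<..}" using fineD[OF P] by (auto simp: less_le)
    from catching_up_exists[OF Z z0 this, of u] obtain y where "catching_up Z z0 u P y"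
      using catching_up_remove_0 by blast
    with P show ?thesis
      by (intro exI[of _ P] exI[of _ y]) (unfold_locales, auto)
  qed
  then obtain P Y where proc: "\<And>n. catching_up_process T u Z z0 (inverse (real (Suc n))) (P n) (Y n)"
    by metis
  interpret A: catching_up_process T u Z z0 "inverse (real (Suc n))" "P n" "Y n" for n by (rule proc)
  have inv: "(\<lambda>n. inverse (real (Suc n))) \<longlonglongrightarrow> 0" by (rule LIMSEQ_inverse_real_of_nat)
  have "convergent (\<lambda>n. Y n t)" if t: "t \<in> {0..T}" for t
  proof -
    have "Cauchy (\<lambda>n. Y n t)"
    proof (rule CauchyI)
      fix e :: real assume "0 < e"
      have VT: "0 \<le> V T" by (rule cumvar_nonneg)
      obtain N where N: "inverse (real (Suc N)) < e\<^sup>2 / (8 * (V T + 1))"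
        using reals_Archimedean[of "e\<^sup>2 / (8 * (V T + 1))"] \<open>0 < e\<close> VT by auto
      have "norm (Y m t - Y n t) < e" if "N \<le> m" "N \<le> n" for m n
      proof -
        have "inverse (real (Suc k)) \<le> inverse (real (Suc N))" if "N \<le> k" for k
          using that by (intro le_imp_inverse_le) auto
        from this[OF that(1)] this[OF that(2)]
        have "inverse (real (Suc m)) + inverse (real (Suc n)) \<le> 2 * inverse (real (Suc N))" by linarith
        then have "4 * (inverse (real (Suc m)) + inverse (real (Suc n))) * V T \<le> 4 * (2 * inverse (real (Suc N))) * (V T + 1)"
          using VT by (intro mult_mono) auto
        also have "\<dots> < e\<^sup>2" using N VT by (simp add: field_simps)
        finally have "(norm (Y m t - Y n t))\<^sup>2 < e\<^sup>2"
          using catching_up_close[OF proc proc t, of m n] by linarith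
        then show ?thesis using \<open>0 < e\<close> by (simp add: power2_less_imp_less)
      qed
      then show "\<exists>M. \<forall>m\<ge>M. \<forall>n\<ge>M. norm (Y m t - Y n t) < e" by blast
    qed
    then show ?thesis by (simp add: Cauchy_convergent_iff)
  qed
  then obtain y where y: "\<And>t. t \<in> {0..T} \<Longrightarrow> (\<lambda>n. Y n t) \<longlonglongrightarrow> y t"
    unfolding convergent_def by metis
  have us: "(\<lambda>n. A.us n t) \<longlonglongrightarrow> u t" if "t \<in> {0..T}" for t
  proof -
    have "(\<lambda>n. u t - A.us n t) \<longlonglongrightarrow> 0"
      by (rule Lim_null_comparison[OF _ inv]) (use A.us_close that in auto)
    then have "(\<lambda>n. u t - (u t - A.us n t)) \<longlonglongrightarrow> u t - 0" by (intro tendsto_diff tendsto_const)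
    then show ?thesis by simp
  qed
  have Vs: "(\<lambda>n. A.Vs n t) \<longlonglongrightarrow> V t" if "t \<in> {0..T}" for t
  proof -
    have "norm (V t - A.Vs n t) \<le> inverse (real (Suc n))" for n
      using A.Vs_ge[of t n] A.Vs_le[of t n] that by auto
    then have "(\<lambda>n. V t - A.Vs n t) \<longlonglongrightarrow> 0"
      by (intro Lim_null_comparison[OF _ inv]) auto
    then have "(\<lambda>n. V t - (V t - A.Vs n t)) \<longlonglongrightarrow> V t - 0" by (intro tendsto_diff tendsto_const)
    then show ?thesis by simp
  qed
  have "regular_solution Z T z0 u y"
    unfolding regular_solution_def sweep_def
  proof (intro conjI allI impI ballI)
    have "0 \<in> {0..T}" using T by simp
    from y[OF this] show "y 0 = u 0 - z0"
      using A.y unfolding catching_up_def by (simp add: LIMSEQ_const_iff)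
  next
    fix t assume t: "t \<in> {0..T}"
    have "(\<lambda>n. A.us n t - Y n t) \<longlonglongrightarrow> u t - y t" by (intro tendsto_diff us y t)
    moreover have "A.us n t - Y n t \<in> Z" for n using A.y t unfolding catching_up_def by auto
    ultimately show "u t - y t \<in> Z" using closed_sequentially[OF Z(2), of "\<lambda>n. A.us n t - Y n t"] by blast
  next
    fix s t z assume st: "0 \<le> s" "s < t" "t \<le> T" and z: "z \<in> Z"
    then have *: "s \<in> {0..T}" "t \<in> {0..T}" by auto
    have "(\<lambda>n. (Y n t - Y n s) \<bullet> (z - (A.us n t - Y n t))) \<longlonglongrightarrow> (y t - y s) \<bullet> (z - (u t - y t))"
      by (intro tendsto_intros us y *)
    moreover have "(\<lambda>n. (A.Vs n t - A.Vs n s) * (lft V t - A.Vs n s)) \<longlonglongrightarrow> (V t - V s) * (lft V t - V s)"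
      by (intro tendsto_intros Vs *)
    ultimately show "(y t - y s) \<bullet> (z - (u t - y t)) \<le> (V t - V s) * (lft V t - V s)"
      by (rule LIMSEQ_le) (use A.variational[OF st z] in auto)
  next
    fix s t assume st: "0 \<le> s" "s \<le> t" "t \<le> T"
    then have *: "s \<in> {0..T}" "t \<in> {0..T}" by auto
    have V: "(\<lambda>n. A.Vs n t - A.Vs n s) \<longlonglongrightarrow> V t - V s" by (intro tendsto_intros Vs *)
    have "(\<lambda>n. norm (Y n t - Y n s)) \<longlonglongrightarrow> norm (y t - y s)" by (intro tendsto_intros y *)
    from LIMSEQ_le[OF this V] show "norm (y t - y s) \<le> V t - V s" using A.y_increment[OF st] by auto
    have "(\<lambda>n. norm ((A.us n t - Y n t) - (A.us n s - Y n s))) \<longlonglongrightarrow> norm ((u t - y t) - (u s - y s))"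
      by (intro tendsto_intros y us *)
    from LIMSEQ_le[OF this V] show "norm ((u t - y t) - (u s - y s)) \<le> V t - V s"
      using A.x_increment[OF st] by auto
    have "(\<lambda>n. norm ((Y n t - (A.us n t - Y n t)) - (Y n s - (A.us n s - Y n s)))) \<longlonglongrightarrow>
        norm ((y t - (u t - y t)) - (y s - (u s - y s)))"
      by (intro tendsto_intros y us *)
    from LIMSEQ_le[OF this V] show "norm ((y t - (u t - y t)) - (y s - (u s - y s))) \<le> V t - V s"
      using A.w_increment[OF st] by auto
  qed
  then show thesis by (rule that)
qed

section \<open>Strong integrals\<close>

lemma strongly_measurable_inner:
  fixes f :: "'b \<Rightarrow> 'a::real_inner"
  assumes "strongly_measurable M f"
  shows "(\<lambda>x. f x \<bullet> h) \<in> borel_measurable M"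
proof -
  from assms obtain s where s: "\<And>i. simple_function M (s i)" "\<And>x. x \<in> space M \<Longrightarrow> (\<lambda>i. s i x) \<longlonglongrightarrow> f x"
    unfolding strongly_measurable_def by blast
  show ?thesis
    by (rule borel_measurable_LIMSEQ_real[where u = "\<lambda>i x. s i x \<bullet> h"])
       (auto intro!: tendsto_intros s borel_measurable_simple_function simple_function_compose1[OF s(1)])
qed

lemma strongly_measurable_norm_diff:
  fixes f g :: "'b \<Rightarrow> 'a::real_normed_vector"
  assumes "strongly_measurable M f" "strongly_measurable M g"
  shows "(\<lambda>x. norm (f x - g x)) \<in> borel_measurable M"
proof -
  from assms obtain s r where s: "\<And>i. simple_function M (s i)" "\<And>x. x \<in> space M \<Longrightarrow> (\<lambda>i. s i x) \<longlonglongrightarrow> f x"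
    and r: "\<And>i. simple_function M (r i)" "\<And>x. x \<in> space M \<Longrightarrow> (\<lambda>i. r i x) \<longlonglongrightarrow> g x"
    unfolding strongly_measurable_def by metis
  show ?thesis
    by (rule borel_measurable_LIMSEQ_real[where u = "\<lambda>i x. norm (s i x - r i x)"])
       (auto intro!: tendsto_intros s r borel_measurable_simple_function simple_function_compose2[OF s(1) r(1)])
qed

lemma simple_function_strongly_measurable: "simple_function M f \<Longrightarrow> strongly_measurable M f"
  unfolding strongly_measurable_def by (intro exI[of _ "\<lambda>_. f"]) auto

lemma strongly_measurable_norm:
  fixes f :: "'b \<Rightarrow> 'a::real_normed_vector"
  assumes "strongly_measurable M f"
  shows "(\<lambda>x. norm (f x)) \<in> borel_measurable M"
  using strongly_measurable_norm_diff[OF assms simple_function_strongly_measurable, of "\<lambda>_. 0"] by simp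

text \<open>Pairing with a fixed \<open>h\<close> turns the strong integral into a real Bochner
  integral, whose theory is available. Vector identities are recovered by letting \<open>h\<close>
  vary.\<close>

lemma has_strong_integral_inner:
  fixes f :: "'b \<Rightarrow> 'a::real_inner"
  assumes "has_strong_integral M f I"
  shows "has_bochner_integral M (\<lambda>x. f x \<bullet> h) (I \<bullet> h)"
proof -
  from assms obtain s where f: "strongly_measurable M f"
    and s: "\<And>i. Bochner_Integration.simple_bochner_integrable M (s i)"
    and lim: "(\<lambda>i. \<integral>\<^sup>+x. ennreal (norm (f x - s i x)) \<partial>M) \<longlonglongrightarrow> 0"
    and I: "(\<lambda>i. Bochner_Integration.simple_bochner_integral M (s i)) \<longlonglongrightarrow> I"
    unfolding has_strong_integral_def L1_space_def by blast
  have sf: "simple_function M (s i)" for i using s by (auto elim: simple_bochner_integrable.cases)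
  show ?thesis
  proof (rule has_bochner_integral.intros)
    show "(\<lambda>x. f x \<bullet> h) \<in> borel_measurable M" by (rule strongly_measurable_inner[OF f])
    show "Bochner_Integration.simple_bochner_integrable M (\<lambda>x. s i x \<bullet> h)" for i
      using simple_bochner_integrable_compose2[OF _ s s, of "\<lambda>x y. x \<bullet> h" i i] by simp
    show "(\<lambda>i. \<integral>\<^sup>+x. ennreal (norm (f x \<bullet> h - s i x \<bullet> h)) \<partial>M) \<longlonglongrightarrow> 0"
    proof (rule tendsto_sandwich)
      show "\<forall>\<^sub>F i in sequentially. 0 \<le> (\<integral>\<^sup>+x. ennreal (norm (f x \<bullet> h - s i x \<bullet> h)) \<partial>M)" by simp
      show "\<forall>\<^sub>F i in sequentially. (\<integral>\<^sup>+x. ennreal (norm (f x \<bullet> h - s i x \<bullet> h)) \<partial>M)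
          \<le> ennreal (norm h) * (\<integral>\<^sup>+x. ennreal (norm (f x - s i x)) \<partial>M)"
      proof (intro always_eventually allI)
        fix i
        have "(\<integral>\<^sup>+x. ennreal (norm (f x \<bullet> h - s i x \<bullet> h)) \<partial>M) \<le> (\<integral>\<^sup>+x. ennreal (norm h) * ennreal (norm (f x - s i x)) \<partial>M)"
        proof (rule nn_integral_mono)
          fix x
          have "norm (f x \<bullet> h - s i x \<bullet> h) \<le> norm h * norm (f x - s i x)"
            using Cauchy_Schwarz_ineq2[of "f x - s i x" h] by (simp add: inner_diff_left mult.commute)
          then show "ennreal (norm (f x \<bullet> h - s i x \<bullet> h)) \<le> ennreal (norm h) * ennreal (norm (f x - s i x))"
            by (simp add: ennreal_mult[symmetric] ennreal_leI)
        qed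
        also have "\<dots> = ennreal (norm h) * (\<integral>\<^sup>+x. ennreal (norm (f x - s i x)) \<partial>M)"
          using strongly_measurable_norm_diff[OF f simple_function_strongly_measurable[OF sf]]
          by (intro nn_integral_cmult measurable_compose[OF _ measurable_ennreal])
        finally show "(\<integral>\<^sup>+x. ennreal (norm (f x \<bullet> h - s i x \<bullet> h)) \<partial>M)
          \<le> ennreal (norm h) * (\<integral>\<^sup>+x. ennreal (norm (f x - s i x)) \<partial>M)" .
      qed
      show "(\<lambda>i. ennreal (norm h) * (\<integral>\<^sup>+x. ennreal (norm (f x - s i x)) \<partial>M)) \<longlonglongrightarrow> 0"
        using ennreal_tendsto_cmult[OF _ lim, of "ennreal (norm h)"] by simp
    qed auto
    have "Bochner_Integration.simple_bochner_integral M (\<lambda>x. s i x \<bullet> h) = Bochner_Integration.simple_bochner_integral M (s i) \<bullet> h" for i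
      by (intro simple_bochner_integral_linear[OF _ s, of "\<lambda>x. x \<bullet> h"])
         (auto intro!: linearI simp: inner_add_left)
    then show "(\<lambda>i. Bochner_Integration.simple_bochner_integral M (\<lambda>x. s i x \<bullet> h)) \<longlonglongrightarrow> I \<bullet> h"
      using tendsto_inner[OF I tendsto_const, of h] by simp
  qed
qed

section \<open>Play solutions satisfy the integrated inequality\<close>

lemma BVr_bounded_variation: "f \<in> BVr T \<Longrightarrow> 0 < T \<Longrightarrow> bounded_variation T f"
  unfolding BVr_def bounded_variation_def by auto

lemma BVr_diff_bounded_variation:
  "f \<in> BVr T \<Longrightarrow> g \<in> BVr T \<Longrightarrow> 0 < T \<Longrightarrow> bounded_variation T (\<lambda>t. f t - g t)"
  unfolding BVr_def bounded_variation_def using variation_diff_finite by blast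

lemma BVr_right_cont: "f \<in> BVr T \<Longrightarrow> \<forall>t\<in>{0..<T}. (f \<longlongrightarrow> f t) (at_right t)"
  unfolding BVr_def by auto

lemma BVr_control: "f \<in> BVr T \<Longrightarrow> 0 < T \<Longrightarrow> control (cumvar T f)"
  using bounded_variation.mono_cumvar bounded_variation.cumvar_right_cont BVr_bounded_variation BVr_right_cont
  unfolding control_def by blast

text \<open>The measure \<open>|v| \<mu>\<close> lives on \<open>[0,T]\<close>. Pushed forward by
  the identity to the Borel sets of the line, it acquires a distribution function that can enter a
  control.\<close>

lemma density_measure_exists:
  fixes v :: "real \<Rightarrow> 'a::real_normed_vector"
  assumes sets: "sets \<mu> = sets (borel_on T)" and v: "v \<in> L1_space \<mu>"
  obtains M where "finite_borel_measure M"
    "\<And>A. A \<in> sets \<mu> \<Longrightarrow> has_bochner_integral \<mu> (\<lambda>x. indicator A x * norm (v x)) (measure M A)"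
proof -
  have [measurable]: "(\<lambda>x. norm (v x)) \<in> borel_measurable \<mu>"
    using v strongly_measurable_norm unfolding L1_space_def by auto
  have id: "(\<lambda>x. x) \<in> measurable \<mu> borel"
    using measurable_restrict_space1[of "\<lambda>x::real. x" borel borel "{0..T}"]
    by (simp add: measurable_cong_sets[OF sets refl])
  define M where "M = distr (density \<mu> (\<lambda>x. ennreal (norm (v x)))) borel (\<lambda>x. x)"
  have M: "emeasure M A = (\<integral>\<^sup>+x. ennreal (indicator A x * norm (v x)) \<partial>\<mu>)" if "A \<in> sets borel" "A \<inter> space \<mu> = B" "B \<in> sets \<mu>" for A B
  proof -
    have "emeasure M A = emeasure (density \<mu> (\<lambda>x. ennreal (norm (v x)))) B"
      unfolding M_def using that id by (subst emeasure_distr) auto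
    also have "\<dots> = (\<integral>\<^sup>+x. ennreal (norm (v x)) * indicator B x \<partial>\<mu>)"
      using that by (intro emeasure_density) auto
    also have "\<dots> = (\<integral>\<^sup>+x. ennreal (indicator A x * norm (v x)) \<partial>\<mu>)"
      using that(2) by (intro nn_integral_cong) (auto simp: indicator_def)
    finally show ?thesis .
  qed
  have fin: "emeasure M (space M) < \<infinity>"
  proof -
    have "emeasure M (space M) = (\<integral>\<^sup>+x. ennreal (norm (v x)) \<partial>\<mu>)"
      using M[of UNIV "space \<mu>"] by (simp add: M_def)
    then show ?thesis using v by (auto simp: L1_space_def)
  qed
  have "finite_borel_measure M"
    unfolding finite_borel_measure_def finite_borel_measure_axioms_def
    using fin by (auto simp: M_def intro!: finite_measureI)
  then interpret M: finite_borel_measure M .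
  show thesis
  proof (rule that)
    show "finite_borel_measure M" by fact
    fix A assume A: "A \<in> sets \<mu>"
    have A': "A \<in> sets borel" "A \<subseteq> space \<mu>"
      using A sets.sets_into_space[OF A] sets by (auto simp: sets_restrict_space)
    have "(\<integral>\<^sup>+x. ennreal (indicator A x * norm (v x)) \<partial>\<mu>) = ennreal (measure M A)"
      using M[of A A] A A' M.emeasure_eq_measure by auto
    then show "has_bochner_integral \<mu> (\<lambda>x. indicator A x * norm (v x)) (measure M A)"
      using A by (intro has_bochner_integral_nn_integral) auto
  qed
qed

text \<open>Write \<open><v(\<tau>), z - x(t)>\<close> as \<open><v(\<tau>), z - x(\<tau>)>\<close>,
  nonpositive by the cone condition, plus \<open><v(\<tau>), x(\<tau>) - x(t)>\<close>, which
  vanishes at \<open>\<tau> = t\<close> and is otherwise bounded by \<open>norm (v \<tau>)\<close>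
  times the oscillation of \<open>x\<close> on \<open>[s,t]\<close>. So \<open>G\<close> collects
  the distribution function of \<open>|v| \<mu>\<close> and the cumulative variations of
  \<open>u\<close> and \<open>y\<close>.\<close>

lemma play_solution_sweep:
  fixes Z :: "'a::{real_inner, banach} set"
  assumes sol: "is_play_solution T Z z0 u y" and u: "u \<in> BVr T" and T: "0 < T"
  obtains G where "control G" "sweep Z T G u y"
proof -
  from sol obtain \<mu> v m where y: "y \<in> BVr T" and sets: "sets \<mu> = sets (borel_on T)"
    and v: "v \<in> L1_space \<mu>" and yZ: "\<And>t. t \<in> {0..T} \<Longrightarrow> y t \<in> (\<lambda>z. u t - z) ` Z"
    and m: "is_differential_measure T y m" "has_density \<mu> v m"
    and cone: "AE t in \<mu>. - v t \<in> normal_cone ((\<lambda>z. u t - z) ` Z) (y t)"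
    unfolding is_play_solution_def by blast
  interpret u: bounded_variation T u using u T by (rule BVr_bounded_variation)
  interpret y: bounded_variation T y using y T by (rule BVr_bounded_variation)
  obtain M where "finite_borel_measure M"
    and M: "\<And>A. A \<in> sets \<mu> \<Longrightarrow> has_bochner_integral \<mu> (\<lambda>x. indicator A x * norm (v x)) (measure M A)"
    using density_measure_exists[OF sets v] by blast
  then interpret M: finite_borel_measure M by simp
  define K where "K = cdf M"
  define W where "W t = u.V t + y.V t" for t
  define G where "G t = K t + W t" for t
  have K: "control K"
    unfolding control_def K_def by (auto intro!: monoI M.cdf_nondecreasing M.cdf_is_right_cont)
  have W: "control W" unfolding W_def by (intro control_add BVr_control u y T)
  have G: "control G" unfolding G_def by (intro control_add K W)
  have xZ: "u t - y t \<in> Z" if "t \<in> {0..T}" for t using yZ[OF that] by auto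
  have "sweep Z T G u y"
    unfolding sweep_def
  proof (intro conjI allI impI ballI)
    fix s t z assume st: "0 \<le> s" "s < t" "t \<le> T" and z: "z \<in> Z"
    define b where "b = G t - G s"
    have b: "norm ((u \<tau> - y \<tau>) - (u t - y t)) \<le> b" if "s \<le> \<tau>" "\<tau> \<le> t" for \<tau>
    proof -
      have "norm ((u \<tau> - y \<tau>) - (u t - y t)) \<le> norm (u t - u \<tau>) + norm (y t - y \<tau>)" by norm
      also have "\<dots> \<le> W t - W \<tau>"
        using u.norm_diff_le_cumvar[of \<tau> t] y.norm_diff_le_cumvar[of \<tau> t] that st by (simp add: W_def)
      also have "\<dots> \<le> b"
        using control_mono[OF W that(1)] control_mono[OF K, of s t] st by (simp add: b_def G_def)
      finally show ?thesis .
    qed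
    have b0: "0 \<le> b" using control_mono[OF G, of s t] st by (simp add: b_def)
    let ?c = "z - (u t - y t)"
    have B: "{s<..t} \<in> sets \<mu>" "{s<..<t} \<in> sets \<mu>"
      unfolding sets using st by (auto simp: sets_restrict_space_iff)
    have "m {s<..t} = y t - y s" using m(1) st unfolding is_differential_measure_def by blast
    with m(2) B have "has_strong_integral \<mu> (\<lambda>x. indicator {s<..t} x *\<^sub>R v x) (y t - y s)"
      unfolding has_density_def by metis
    from has_strong_integral_inner[OF this, of ?c]
    have I1: "has_bochner_integral \<mu> (\<lambda>x. (indicator {s<..t} x *\<^sub>R v x) \<bullet> ?c) ((y t - y s) \<bullet> ?c)" .
    have I2: "has_bochner_integral \<mu> (\<lambda>x. b * (indicator {s<..<t} x * norm (v x))) (b * measure M {s<..<t})"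
      by (intro has_bochner_integral_mult_right M B)
    have "AE \<tau> in \<mu>. (indicator {s<..t} \<tau> *\<^sub>R v \<tau>) \<bullet> ?c \<le> b * (indicator {s<..<t} \<tau> * norm (v \<tau>))"
      using cone
    proof eventually_elim
      case (elim \<tau>)
      then have "- v \<tau> \<bullet> ((u \<tau> - z) - y \<tau>) \<le> 0" using z unfolding normal_cone_def by blast
      then have *: "v \<tau> \<bullet> (z - (u \<tau> - y \<tau>)) \<le> 0" by (simp add: inner_diff algebra_simps)
      consider "\<tau> \<in> {s<..<t}" | "\<tau> = t" | "\<tau> \<notin> {s<..t}" by force
      then show ?case
      proof cases
        case 1
        have "v \<tau> \<bullet> ?c = v \<tau> \<bullet> (z - (u \<tau> - y \<tau>)) + v \<tau> \<bullet> ((u \<tau> - y \<tau>) - (u t - y t))"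
          by (simp add: inner_diff algebra_simps)
        also have "\<dots> \<le> norm (v \<tau>) * norm ((u \<tau> - y \<tau>) - (u t - y t))"
          using * norm_cauchy_schwarz[of "v \<tau>" "(u \<tau> - y \<tau>) - (u t - y t)"] by linarith
        also have "\<dots> \<le> norm (v \<tau>) * b" using 1 b[of \<tau>] by (intro mult_left_mono) auto
        finally show ?thesis using 1 by (simp add: mult.commute)
      qed (use * st in auto)
    qed
    from integral_mono_AE[OF integrable.intros[OF I1] integrable.intros[OF I2] this]
    have "(y t - y s) \<bullet> ?c \<le> b * measure M {s<..<t}"
      unfolding has_bochner_integral_integral_eq[OF I1] has_bochner_integral_integral_eq[OF I2] .
    \<comment> \<open>The open interval has mass \<open>K(t-) - K(s)\<close>, and adding the
      increasing function \<open>W\<close> to \<open>K\<close> can only enlarge this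
      difference.\<close>
    also have "measure M {s<..<t} \<le> lft G t - G s"
    proof -
      have "measure M {..<t} \<le> lft K t"
        using M.cdf_at_left[of t]
      proof (rule tendsto_upperbound)
        show "\<forall>\<^sub>F r in at_left t. cdf M r \<le> lft K t"
          using K by (intro eventually_at_leftI[of "t - 1"]) (auto intro!: lft_ge simp: K_def[symmetric] control_def)
      qed simp
      moreover have "measure M {..<t} = measure M {..s} + measure M {s<..<t}"
        using st by (subst M.finite_measure_Union[symmetric]) (auto intro!: arg_cong[where f="measure M"] simp: M.M_is_borel)
      moreover have "measure M {..s} = K s" by (simp add: K_def cdf_def)
      moreover have "lft K t \<le> lft G t - W s"
      proof (rule lft_least)
        fix r assume r: "r < t"
        show "K r \<le> lft G t - W s"
        proof (cases "s \<le> r")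
          case True
          then show ?thesis
            using lft_ge[of G r t] control_mono[OF W True] r G by (auto simp: G_def control_def)
        next
          case False
          then show ?thesis
            using lft_ge[of G s t] control_mono[OF K, of r s] st G by (auto simp: G_def control_def)
        qed
      qed
      ultimately show ?thesis by (simp add: G_def)
    qed
    finally show "(y t - y s) \<bullet> ?c \<le> (G t - G s) * (lft G t - G s)"
      using b0 by (simp add: b_def mult_left_mono)
  qed (use xZ in auto)
  with G show thesis by (rule that)
qed

lemma play_solution_initial: "is_play_solution T Z z0 u y \<Longrightarrow> y 0 = u 0 - z0"
  unfolding is_play_solution_def by blast

lemma play_solution_BVr: "is_play_solution T Z z0 u y \<Longrightarrow> y \<in> BVr T"
  unfolding is_play_solution_def by blast

lemma play_solution_unique:
  fixes Z :: "'a::{real_inner, banach} set"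
  assumes "is_play_solution T Z z0 u y1" "is_play_solution T Z z0 u y2" "u \<in> BVr T" "0 < T"
  shows "y1 = y2"
proof -
  obtain G1 where 1: "control G1" "sweep Z T G1 u y1" using play_solution_sweep assms by blast
  obtain G2 where 2: "control G2" "sweep Z T G2 u y2" using play_solution_sweep assms by blast
  have bv: "bounded_variation T (\<lambda>t. u t - u t)" "bounded_variation T (\<lambda>t. y1 t - y2 t)"
    using assms play_solution_BVr by (blast intro: BVr_diff_bounded_variation)+
  have "cumvar T (\<lambda>t. u t - u t) T = 0" by (simp add: cumvar_def variation_zero)
  then have "y1 t = y2 t" if "t \<in> {0..T}" for t
    using sweep_stability[OF 1(1) 2(1) 1(2) 2(2) bv that] play_solution_initial[OF assms(1)]
      play_solution_initial[OF assms(2)] by simp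
  then show ?thesis
    using assms(1,2)[THEN play_solution_BVr] by (intro extensionalityI[of y1 "{0..T}" y2]) (auto simp: BVr_def)
qed

section \<open>Slopes and energy\<close>

definition is_part :: "real \<Rightarrow> real set \<Rightarrow> bool" where
  "is_part T P \<longleftrightarrow> finite P \<and> P \<subseteq> {0..T} \<and> 0 \<in> P \<and> T \<in> P"

lemma fine_is_part: "fine_partition T G e P \<Longrightarrow> is_part T P"
  unfolding fine_partition_def is_part_def by blast

lemma is_part_Un: "is_part T P \<Longrightarrow> is_part T Q \<Longrightarrow> is_part T (P \<union> Q)"
  unfolding is_part_def by blast

text \<open>By monotonicity, refinements of a near-maximal partition are near-maximal as well.
  Stating the bound for all refinements \<open>R\<close> lets one union of partitions serve several
  functionals at once.\<close>

lemma near_maximal_part: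
  fixes \<Phi> :: "real set \<Rightarrow> real"
  assumes bound: "\<And>P. is_part T P \<Longrightarrow> \<Phi> P \<le> M"
    and mono: "\<And>P Q. is_part T P \<Longrightarrow> is_part T Q \<Longrightarrow> P \<subseteq> Q \<Longrightarrow> \<Phi> P \<le> \<Phi> Q"
    and "0 < e" "0 < T"
  obtains P where "is_part T P" "\<And>R Q. is_part T R \<Longrightarrow> P \<subseteq> R \<Longrightarrow> is_part T Q \<Longrightarrow> \<Phi> Q \<le> \<Phi> R + e"
proof -
  let ?S = "SUP P\<in>{P. is_part T P}. \<Phi> P"
  have ne: "{P. is_part T P} \<noteq> {}"
    using \<open>0 < T\<close> by (auto simp: is_part_def intro!: exI[of _ "{0, T}"])
  have bdd: "bdd_above (\<Phi> ` {P. is_part T P})" using bound by (intro bdd_aboveI2) auto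
  obtain P where P: "is_part T P" "?S - e < \<Phi> P"
    using less_cSUP_iff[OF ne bdd, of "?S - e"] \<open>0 < e\<close> by auto
  show thesis
  proof (rule that[OF P(1)])
    fix R Q assume "is_part T R" "P \<subseteq> R" "is_part T Q"
    moreover from this have "\<Phi> Q \<le> ?S" using bdd by (intro cSUP_upper) auto
    ultimately show "\<Phi> Q \<le> \<Phi> R + e" using mono[OF P(1), of R] P(2) by linarith
  qed
qed

section \<open>Step functions over the cells of a partition\<close>

definition step :: "real set \<Rightarrow> (real \<Rightarrow> real \<Rightarrow> 'a::real_vector) \<Rightarrow> real \<Rightarrow> 'a" where
  "step P g t = (\<Sum>q\<in>P \<inter> {0<..}. indicator {prv P q<..q} t *\<^sub>R g (prv P q) q)"

lemma step_cell:
  assumes P: "finite P" "0 \<in> P" and pq: "p \<in> P" "q \<in> P" "0 \<le> p" "p < q" "P \<inter> {p<..<q} = {}"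
    and t: "t \<in> {p<..q}"
  shows "step P g t = g p q"
proof -
  have "step P g t = (\<Sum>r\<in>{q}. indicator {prv P r<..r} t *\<^sub>R g (prv P r) r)"
    unfolding step_def
  proof (rule sum.mono_neutral_right)
    show "\<forall>r\<in>P \<inter> {0<..} - {q}. indicator {prv P r<..r} t *\<^sub>R g (prv P r) r = 0"
    proof
      fix r assume r: "r \<in> P \<inter> {0<..} - {q}"
      then have rp: "prv P r \<in> P" "P \<inter> {prv P r<..<r} = {}" using prv[OF P(1,2), of r] by auto
      have "\<not> (prv P r < t \<and> t \<le> r)"
      proof
        assume *: "prv P r < t \<and> t \<le> r"
        show False
        proof (cases "r < q")
          case True
          then have "r \<in> P \<inter> {p<..<q}" using * t r by auto
          then show False using pq by blast
        next
          case False
          then have "q \<in> P \<inter> {prv P r<..<r}" using * t r pq by auto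
          then show False using rp by blast
        qed
      qed
      then show "indicator {prv P r<..r} t *\<^sub>R g (prv P r) r = 0" by auto
    qed
  qed (use P pq in auto)
  also have "\<dots> = indicator {prv P q<..q} t *\<^sub>R g (prv P q) q"
    by (simp only: sum.insert sum.empty finite.emptyI empty_iff not_False_eq_True add_0_right)
  finally show ?thesis using prv_eqI[OF P(1) pq(1,4,5)] t by simp
qed

lemma step_norm_le:
  fixes g :: "real \<Rightarrow> real \<Rightarrow> 'a::real_normed_vector"
  assumes P: "finite P" "0 \<in> P" and C: "0 \<le> C"
    and g: "\<And>p q. p \<in> P \<Longrightarrow> q \<in> P \<Longrightarrow> 0 \<le> p \<Longrightarrow> p < q \<Longrightarrow> P \<inter> {p<..<q} = {} \<Longrightarrow> norm (g p q) \<le> C"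
  shows "norm (step P g t) \<le> C"
proof (cases "\<exists>q\<in>P \<inter> {0<..}. t \<in> {prv P q<..q}")
  case True
  then obtain q where q: "q \<in> P" "0 < q" "t \<in> {prv P q<..q}" by auto
  note p = prv[OF P q(2)]
  show ?thesis using step_cell[OF P p(1) q(1) p(2,3,4) q(3), of g] g[OF p(1) q(1) p(2,3,4)] by simp
next
  case False
  then have "step P g t = 0" unfolding step_def by (intro sum.neutral) auto
  then show ?thesis using C by simp
qed

definition ceil_in :: "real set \<Rightarrow> real \<Rightarrow> real" where
  "ceil_in P t = Min (P \<inter> {t..})"

lemma ceil_in:
  assumes "is_part T P" "0 < t" "t \<le> T"
  shows "ceil_in P t \<in> P" and "t \<le> ceil_in P t"
    and "prv P (ceil_in P t) < t" and "P \<inter> {t..<ceil_in P t} = {}"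
proof -
  have fin: "finite P" "T \<in> P" "0 \<in> P" using assms by (auto simp: is_part_def)
  have mem: "ceil_in P t \<in> P \<inter> {t..}"
    unfolding ceil_in_def using fin assms by (intro Min_in) auto
  then show "ceil_in P t \<in> P" "t \<le> ceil_in P t" by auto
  have least: "ceil_in P t \<le> r" if "r \<in> P" "t \<le> r" for r
    unfolding ceil_in_def using fin that by (intro Min_le) auto
  then show "P \<inter> {t..<ceil_in P t} = {}" by force
  have "prv P (ceil_in P t) \<in> P" "prv P (ceil_in P t) < ceil_in P t"
    using prv[OF fin(1,3), of "ceil_in P t"] mem assms by auto
  then show "prv P (ceil_in P t) < t" using least[of "prv P (ceil_in P t)"] by linarith
qed

locale dominated =
  fixes T :: real and V :: "real \<Rightarrow> real" and f :: "real \<Rightarrow> 'a::real_inner"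
  assumes T: "0 < T" and V: "control V" and V_neg: "\<And>t. t \<le> 0 \<Longrightarrow> V t = 0"
    and dom: "\<And>s t. 0 \<le> s \<Longrightarrow> s \<le> t \<Longrightarrow> t \<le> T \<Longrightarrow> norm (f t - f s) \<le> V t - V s"
begin

text \<open>This is the average over \<open>]p,q]\<close> of the density of \<open>df\<close> with
  respect to \<open>dV\<close>. When \<open>V q = V p\<close> the quotient is \<open>0\<close> by
  the convention on division, in agreement with \<open>f q = f p\<close>, so
  \<open>slope_increment\<close> holds without exception.\<close>

definition slope :: "real \<Rightarrow> real \<Rightarrow> 'a" where
  "slope p q = (f q - f p) /\<^sub>R (V q - V p)"

text \<open>The squared \<open>L^2(dV)\<close> norm of the step function of slopes. Along
  refinements the slopes form a martingale, which is why this quantity increases and stays bounded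
  by \<open>V T\<close>.\<close>

definition energy :: "real set \<Rightarrow> real" where
  "energy Q = csum Q 0 T (\<lambda>p q. (norm (f q - f p))\<^sup>2 / (V q - V p))"

lemma V_mono: "s \<le> t \<Longrightarrow> V s \<le> V t"
  by (rule control_mono[OF V])

lemma norm_slope: "0 \<le> p \<Longrightarrow> p \<le> q \<Longrightarrow> q \<le> T \<Longrightarrow> norm (slope p q) \<le> 1"
  using dom[of p q] V_mono[of p q] by (simp add: slope_def divide_le_eq inverse_eq_divide)

lemma slope_increment: "0 \<le> p \<Longrightarrow> p \<le> q \<Longrightarrow> q \<le> T \<Longrightarrow> (V q - V p) *\<^sub>R slope p q = f q - f p"
  using dom[of p q] by (cases "V q = V p") (auto simp: slope_def)

text \<open>The mean square deviation from the average slope is the mean square minus the square of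
  the mean: expanding the square, the mixed term telescopes.\<close>

lemma cell_variance:
  assumes Q: "is_part T Q" and ab: "a \<in> Q" "b \<in> Q" "a \<le> b"
  shows "csum Q a b (\<lambda>p q. (norm ((f q - f p) - (V q - V p) *\<^sub>R slope a b))\<^sup>2 / (V q - V p)) =
    csum Q a b (\<lambda>p q. (norm (f q - f p))\<^sup>2 / (V q - V p)) - (norm (f b - f a))\<^sup>2 / (V b - V a)"
proof -
  have fin: "finite Q" and range: "Q \<subseteq> {0..T}" using Q by (auto simp: is_part_def)
  let ?c = "slope a b"
  have "csum Q a b (\<lambda>p q. (norm ((f q - f p) - (V q - V p) *\<^sub>R ?c))\<^sup>2 / (V q - V p)) =
    csum Q a b (\<lambda>p q. ((norm (f q - f p))\<^sup>2 / (V q - V p) - (2 *\<^sub>R (f q - f p)) \<bullet> ?c) + (?c \<bullet> ?c) * (V q - V p))"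
  proof (rule csum_cong[OF fin ab(1)])
    fix p q assume pq: "p \<in> Q" "q \<in> Q" "p < q"
    then have d: "norm (f q - f p) \<le> V q - V p" using range by (intro dom) auto
    show "(norm ((f q - f p) - (V q - V p) *\<^sub>R ?c))\<^sup>2 / (V q - V p) =
        ((norm (f q - f p))\<^sup>2 / (V q - V p) - (2 *\<^sub>R (f q - f p)) \<bullet> ?c) + (?c \<bullet> ?c) * (V q - V p)"
    proof (cases "V q - V p = 0")
      case True
      then show ?thesis using d by simp
    next
      case False
      define k where "k = V q - V p"
      define w where "w = f q - f p"
      have "(norm (w - k *\<^sub>R ?c))\<^sup>2 = (norm w)\<^sup>2 - k * ((2 *\<^sub>R w) \<bullet> ?c) + k * (k * (?c \<bullet> ?c))"
        unfolding power2_norm_eq_inner by (simp add: inner_diff inner_commute algebra_simps)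
      then have "(norm (w - k *\<^sub>R ?c))\<^sup>2 / k = (norm w)\<^sup>2 / k - (2 *\<^sub>R w) \<bullet> ?c + (?c \<bullet> ?c) * k"
        using False by (simp add: k_def[symmetric] field_simps)
      then show ?thesis by (simp add: k_def w_def)
    qed
  qed
  also have "\<dots> = csum Q a b (\<lambda>p q. (norm (f q - f p))\<^sup>2 / (V q - V p))
      - csum Q a b (\<lambda>p q. 2 *\<^sub>R f q - 2 *\<^sub>R f p) \<bullet> ?c + (?c \<bullet> ?c) * (V b - V a)"
    using csum_telescope[OF fin ab, of V]
    by (simp only: csum_add csum_diff csum_cmult csum_inner_left scaleR_diff_right)
  also have "csum Q a b (\<lambda>p q. 2 *\<^sub>R f q - 2 *\<^sub>R f p) = 2 *\<^sub>R (f b - f a)"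
    using csum_telescope[OF fin ab, of "\<lambda>t. 2 *\<^sub>R f t"] by (simp add: scaleR_diff_right)
  also have "csum Q a b (\<lambda>p q. (norm (f q - f p))\<^sup>2 / (V q - V p)) - (2 *\<^sub>R (f b - f a)) \<bullet> ?c + (?c \<bullet> ?c) * (V b - V a)
    = csum Q a b (\<lambda>p q. (norm (f q - f p))\<^sup>2 / (V q - V p)) - (norm (f b - f a))\<^sup>2 / (V b - V a)"
  proof (cases "V b - V a = 0")
    case False
    define k where "k = V b - V a"
    define w where "w = f b - f a"
    have "k \<noteq> 0" using False by (simp add: k_def)
    then have "(2 *\<^sub>R w) \<bullet> (w /\<^sub>R k) = 2 * ((norm w)\<^sup>2 / k)" "((w /\<^sub>R k) \<bullet> (w /\<^sub>R k)) * k = (norm w)\<^sup>2 / k"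
      by (simp_all add: power2_norm_eq_inner field_simps)
    then show ?thesis unfolding slope_def k_def[symmetric] w_def[symmetric] by simp
  qed (simp add: slope_def)
  finally show ?thesis .
qed

lemma step_slope:
  assumes "is_part T P" "p \<in> P" "q \<in> P" "p < q" "P \<inter> {p<..<q} = {}" "t \<in> {p<..q}"
  shows "step P slope t = slope p q"
  using assms by (intro step_cell) (auto simp: is_part_def)

text \<open>Pythagoras for conditional expectations: refining \<open>P\<close> to \<open>Q\<close>
  adds to the energy exactly the mean square deviation of the new slopes from the old ones.\<close>

lemma variance:
  assumes P: "is_part T P" and Q: "is_part T Q" and sub: "P \<subseteq> Q"
  shows "csum Q 0 T (\<lambda>p q. (norm ((f q - f p) - (V q - V p) *\<^sub>R step P slope q))\<^sup>2 / (V q - V p)) =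
    energy Q - energy P"
proof -
  have fin: "finite P" "finite Q" "0 \<in> P" "T \<in> P" "P \<subseteq> {0..T}" using P Q by (auto simp: is_part_def)
  have T0: "0 \<le> T" using T by simp
  have "csum Q 0 T (\<lambda>p q. (norm ((f q - f p) - (V q - V p) *\<^sub>R step P slope q))\<^sup>2 / (V q - V p)) =
    csum P 0 T (\<lambda>a b. csum Q a b (\<lambda>p q. (norm ((f q - f p) - (V q - V p) *\<^sub>R step P slope q))\<^sup>2 / (V q - V p)))"
    by (rule csum_nested[symmetric, OF fin(2) sub fin(3,4) T0])
  also have "\<dots> = csum P 0 T (\<lambda>a b. csum Q a b (\<lambda>p q. (norm (f q - f p))\<^sup>2 / (V q - V p)) -
      (norm (f b - f a))\<^sup>2 / (V b - V a))"
  proof (rule csum_cong[OF fin(1,3)])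
    fix a b assume ab: "a \<in> P" "b \<in> P" "a < b" "P \<inter> {a<..<b} = {}"
    have "csum Q a b (\<lambda>p q. (norm ((f q - f p) - (V q - V p) *\<^sub>R step P slope q))\<^sup>2 / (V q - V p)) =
      csum Q a b (\<lambda>p q. (norm ((f q - f p) - (V q - V p) *\<^sub>R slope a b))\<^sup>2 / (V q - V p))"
    proof (rule csum_cong[OF fin(2)])
      fix p q assume "a \<le> p" "p < q" "q \<le> b"
      then have "step P slope q = slope a b" by (intro step_slope[OF P ab]) auto
      then show "(norm ((f q - f p) - (V q - V p) *\<^sub>R step P slope q))\<^sup>2 / (V q - V p) =
        (norm ((f q - f p) - (V q - V p) *\<^sub>R slope a b))\<^sup>2 / (V q - V p)" by simp
    qed (use ab sub in auto)
    also have "\<dots> = csum Q a b (\<lambda>p q. (norm (f q - f p))\<^sup>2 / (V q - V p)) - (norm (f b - f a))\<^sup>2 / (V b - V a)"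
      using ab sub by (intro cell_variance Q) auto
    finally show "csum Q a b (\<lambda>p q. (norm ((f q - f p) - (V q - V p) *\<^sub>R step P slope q))\<^sup>2 / (V q - V p)) =
      csum Q a b (\<lambda>p q. (norm (f q - f p))\<^sup>2 / (V q - V p)) - (norm (f b - f a))\<^sup>2 / (V b - V a)" .
  qed
  also have "\<dots> = energy Q - energy P"
    unfolding csum_diff energy_def csum_nested[OF fin(2) sub fin(3,4) T0] ..
  finally show ?thesis .
qed

lemma energy_mono:
  assumes P: "is_part T P" and Q: "is_part T Q" and sub: "P \<subseteq> Q"
  shows "energy P \<le> energy Q"
proof -
  have "0 \<le> csum Q 0 T (\<lambda>p q. (norm ((f q - f p) - (V q - V p) *\<^sub>R step P slope q))\<^sup>2 / (V q - V p))"
    using Q by (intro csum_nonneg divide_nonneg_nonneg) (auto simp: is_part_def V_mono)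
  then show ?thesis unfolding variance[OF assms] by simp
qed

lemma energy_le:
  assumes Q: "is_part T Q"
  shows "energy Q \<le> V T"
proof -
  have fin: "finite Q" "0 \<in> Q" "T \<in> Q" "Q \<subseteq> {0..T}" using Q by (auto simp: is_part_def)
  have "energy Q \<le> csum Q 0 T (\<lambda>p q. V q - V p)"
    unfolding energy_def
  proof (rule csum_mono[OF fin(1,2)])
    fix p q assume "p \<in> Q" "q \<in> Q" "p < q"
    then have d: "norm (f q - f p) \<le> V q - V p" using fin by (intro dom) auto
    show "(norm (f q - f p))\<^sup>2 / (V q - V p) \<le> V q - V p"
    proof (cases "V q - V p = 0")
      case False
      then have "0 < V q - V p" using d norm_ge_zero[of "f q - f p"] by linarith
      then show ?thesis using power_mono[OF d, of 2] by (simp add: divide_le_eq power2_eq_square)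
    qed simp
  qed
  then show ?thesis using csum_telescope[OF fin(1-3), of V] T V_neg[of 0] by simp
qed

lemma energy_near_max:
  assumes "0 < e"
  obtains P where "is_part T P" "\<And>R Q. is_part T R \<Longrightarrow> P \<subseteq> R \<Longrightarrow> is_part T Q \<Longrightarrow> energy Q \<le> energy R + e"
  by (rule near_maximal_part[of T energy "V T" e]) (use energy_le energy_mono assms T in auto)

text \<open>Cauchy-Schwarz with the weights \<open>sqrt (V q - V p)\<close> passes from the mean
  square deviation to the mean deviation. On cells without \<open>dV\<close>-mass the increment of
  \<open>f\<close> vanishes, so the division there does no harm.\<close>

lemma deviation_le:
  assumes P: "is_part T P" and Q: "is_part T Q" and sub: "P \<subseteq> Q"
  shows "csum Q 0 T (\<lambda>p q. norm ((f q - f p) - (V q - V p) *\<^sub>R step P slope q)) \<le>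
    sqrt (V T * (energy Q - energy P))"
proof -
  have fin: "finite Q" "0 \<in> Q" "T \<in> Q" "Q \<subseteq> {0..T}" using Q by (auto simp: is_part_def)
  let ?r = "\<lambda>p q. norm ((f q - f p) - (V q - V p) *\<^sub>R step P slope q)"
  let ?k = "\<lambda>p q. V q - V p"
  have "csum Q 0 T ?r = csum Q 0 T (\<lambda>p q. sqrt (?k p q) * (?r p q / sqrt (?k p q)))"
  proof (rule csum_cong[OF fin(1,2)])
    fix p q assume "p \<in> Q" "q \<in> Q" "p < q"
    then have d: "norm (f q - f p) \<le> V q - V p" using fin by (intro dom) auto
    then show "?r p q = sqrt (?k p q) * (?r p q / sqrt (?k p q))"
      by (cases "V q = V p") auto
  qed
  also have "\<dots> \<le> sqrt (csum Q 0 T (\<lambda>p q. (sqrt (?k p q))\<^sup>2) * csum Q 0 T (\<lambda>p q. (?r p q / sqrt (?k p q))\<^sup>2))"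
    by (rule real_le_rsqrt) (rule csum_cauchy_schwarz)
  also have "csum Q 0 T (\<lambda>p q. (sqrt (?k p q))\<^sup>2) = csum Q 0 T ?k"
    by (rule csum_cong[OF fin(1,2)]) (simp add: V_mono)
  also have "csum Q 0 T ?k = V T"
    using csum_telescope[OF fin(1-3), of V] T V_neg[of 0] by simp
  also have "csum Q 0 T (\<lambda>p q. (?r p q / sqrt (?k p q))\<^sup>2) = csum Q 0 T (\<lambda>p q. (?r p q)\<^sup>2 / ?k p q)"
    by (rule csum_cong[OF fin(1,2)]) (simp add: V_mono power_divide)
  finally show ?thesis unfolding variance[OF assms] .
qed

end

section \<open>The differential measure and its density\<close>

lemma simple_integral_diff_le:
  fixes s t :: "'b \<Rightarrow> 'a::real_normed_vector"
  assumes s: "Bochner_Integration.simple_bochner_integrable M s" and t: "Bochner_Integration.simple_bochner_integrable M t"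
  shows "ennreal (norm (Bochner_Integration.simple_bochner_integral M s - Bochner_Integration.simple_bochner_integral M t))
    \<le> (\<integral>\<^sup>+x. ennreal (norm (s x - t x)) \<partial>M)"
proof -
  have st: "Bochner_Integration.simple_bochner_integrable M (\<lambda>x. s x - t x)"
    by (rule simple_bochner_integrable_compose2[OF _ s t]) simp
  have "ennreal (norm (Bochner_Integration.simple_bochner_integral M (\<lambda>x. s x - t x)))
      \<le> ennreal (Bochner_Integration.simple_bochner_integral M (\<lambda>x. norm (s x - t x)))"
    by (intro ennreal_leI simple_bochner_integral_norm_bound st)
  also have "\<dots> = (\<integral>\<^sup>+x. ennreal (norm (s x - t x)) \<partial>M)"
    by (intro simple_bochner_integral_eq_nn_integral simple_bochner_integrable_compose2[OF _ s t]) auto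
  finally show ?thesis using simple_bochner_integral_diff[OF s t] by simp
qed

lemma has_strong_integral_exists:
  fixes f :: "'b \<Rightarrow> 'a::banach"
  assumes f: "f \<in> L1_space M" and s: "\<And>i. Bochner_Integration.simple_bochner_integrable M (s i)"
    and lim: "(\<lambda>i::nat. \<integral>\<^sup>+x. ennreal (norm (f x - s i x)) \<partial>M) \<longlonglongrightarrow> 0"
  shows "\<exists>I. has_strong_integral M f I"
proof -
  let ?I = "\<lambda>i. Bochner_Integration.simple_bochner_integral M (s i)"
  let ?N = "\<lambda>i. \<integral>\<^sup>+x. ennreal (norm (f x - s i x)) \<partial>M"
  have sf: "simple_function M (s i)" for i using s by (auto elim: simple_bochner_integrable.cases)
  have meas: "(\<lambda>x. ennreal (norm (f x - s i x))) \<in> borel_measurable M" for i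
    using f strongly_measurable_norm_diff[OF _ simple_function_strongly_measurable[OF sf]]
    by (auto simp: L1_space_def intro: measurable_compose[OF _ measurable_ennreal])
  have le: "ennreal (norm (?I i - ?I j)) \<le> ?N i + ?N j" for i j
  proof -
    have "ennreal (norm (?I i - ?I j)) \<le> (\<integral>\<^sup>+x. ennreal (norm (s i x - s j x)) \<partial>M)"
      by (rule simple_integral_diff_le[OF s s])
    also have "\<dots> \<le> (\<integral>\<^sup>+x. ennreal (norm (f x - s i x)) + ennreal (norm (f x - s j x)) \<partial>M)"
    proof (rule nn_integral_mono)
      fix x
      have "norm (s i x - s j x) \<le> norm (f x - s i x) + norm (f x - s j x)" by norm
      then show "ennreal (norm (s i x - s j x)) \<le> ennreal (norm (f x - s i x)) + ennreal (norm (f x - s j x))"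
        by (simp flip: ennreal_plus)
    qed
    also have "\<dots> = ?N i + ?N j" by (rule nn_integral_add[OF meas meas])
    finally show ?thesis .
  qed
  have "Cauchy ?I"
  proof (rule CauchyI)
    fix e :: real assume e: "0 < e"
    then have "eventually (\<lambda>i. ?N i < ennreal (e/2)) sequentially"
      using order_tendstoD(2)[OF lim, of "ennreal (e/2)"] by simp
    then obtain K where K: "\<And>i. K \<le> i \<Longrightarrow> ?N i < ennreal (e/2)"
      unfolding eventually_sequentially by blast
    have "norm (?I i - ?I j) < e" if "K \<le> i" "K \<le> j" for i j
    proof -
      have "ennreal (norm (?I i - ?I j)) < ennreal (e/2) + ennreal (e/2)"
        using le[of i j] add_strict_mono[OF K[OF that(1)] K[OF that(2)]] by (rule le_less_trans)
      also have "\<dots> = ennreal e" using e by (simp flip: ennreal_plus)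
      finally show ?thesis using e by (simp add: ennreal_less_iff)
    qed
    then show "\<exists>K. \<forall>i\<ge>K. \<forall>j\<ge>K. norm (?I i - ?I j) < e" by blast
  qed
  then obtain I where "?I \<longlonglongrightarrow> I" using Cauchy_convergent_iff convergent_def by blast
  then show ?thesis using f s lim unfolding has_strong_integral_def by blast
qed

lemma right_cont_sequence:
  fixes g :: "real \<Rightarrow> real"
  assumes "continuous (at_right t) g" "r \<longlonglongrightarrow> t" "\<And>n. t \<le> r n"
  shows "(\<lambda>n. g (r n)) \<longlonglongrightarrow> g t"
proof (rule continuous_within_tendsto_compose'[OF _ _ assms(2)])
  show "continuous (at t within {t..}) g" unfolding at_within_Ici_at_right by (rule assms(1))
  show "r n \<in> {t..}" for n using assms(3)[of n] by simp
qed

text \<open>Adding \<open>t\<close> to \<open>V\<close> makes the mesh tend to \<open>0\<close> also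
  where \<open>V\<close> is constant. The energy tolerance \<open>(1/16)^n\<close> becomes
  \<open>(1/4)^n\<close> under the square root in \<open>deviation_le\<close>, a summable bound on
  the \<open>L^1\<close> distances between successive slope functions.\<close>

locale density_process = dominated T V f for T V and f :: "real \<Rightarrow> 'a::{real_inner, banach}" +
  fixes P :: "nat \<Rightarrow> real set"
  assumes P_mono: "P n \<subseteq> P (Suc n)"
    and P_fine: "fine_partition T (\<lambda>t. V t + t) (inverse (real (Suc n))) (P n)"
    and P_energy: "is_part T Q \<Longrightarrow> P n \<subseteq> Q \<Longrightarrow> energy Q \<le> energy (P n) + (1/16) ^ n"
begin

text \<open>Since \<open>V\<close> vanishes up to \<open>0\<close>, this measure has no atom at
  \<open>0\<close>, in accordance with \<open>Df({0}) = 0\<close>.\<close>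

definition \<mu> :: "real measure" where
  "\<mu> = restrict_space (interval_measure V) {0..T}"

definition vk :: "nat \<Rightarrow> real \<Rightarrow> 'a" where
  "vk n = step (P n) slope"

lemma P_part: "is_part T (P n)"
  using P_fine by (rule fine_is_part)

lemma P_le: "m \<le> n \<Longrightarrow> P m \<subseteq> P n"
  by (rule lift_Suc_mono_le[of P]) (use P_mono in auto)

lemma sets_\<mu>: "sets \<mu> = sets (borel_on T)"
  unfolding \<mu>_def by (intro sets_restrict_space_cong) simp

lemma space_\<mu>: "space \<mu> = {0..T}"
  by (simp add: \<mu>_def space_restrict_space)

lemma emeasure_\<mu>: "A \<in> sets borel \<Longrightarrow> A \<subseteq> {0..T} \<Longrightarrow> emeasure \<mu> A = emeasure (interval_measure V) A"
  unfolding \<mu>_def by (intro emeasure_restrict_space) auto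

lemma emeasure_Ioc: "a \<le> b \<Longrightarrow> emeasure (interval_measure V) {a<..b} = ennreal (V b - V a)"
  using V by (intro emeasure_interval_measure_Ioc) (auto simp: V_mono control_def)

lemma sets_Ioc: "0 \<le> a \<Longrightarrow> b \<le> T \<Longrightarrow> {a<..b} \<in> sets \<mu>"
  and sets_Ioo: "0 \<le> a \<Longrightarrow> b \<le> T \<Longrightarrow> {a<..<b} \<in> sets \<mu>"
  and sets_Icc: "0 \<le> a \<Longrightarrow> b \<le> T \<Longrightarrow> {a..b} \<in> sets \<mu>"
  unfolding sets_\<mu> by (auto simp: sets_restrict_space_iff)

sublocale \<mu>: finite_measure \<mu>
proof
  have "emeasure \<mu> (space \<mu>) \<le> emeasure (interval_measure V) {-1<..T}"
    unfolding space_\<mu> using T by (subst emeasure_\<mu>) (auto intro!: emeasure_mono)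
  also have "\<dots> < \<infinity>" using T by (subst emeasure_Ioc) auto
  finally show "emeasure \<mu> (space \<mu>) \<noteq> \<infinity>" by simp
qed

lemma measure_Ioc: "0 \<le> a \<Longrightarrow> a \<le> b \<Longrightarrow> b \<le> T \<Longrightarrow> measure \<mu> {a<..b} = V b - V a"
  using emeasure_\<mu>[of "{a<..b}"] emeasure_Ioc[of a b] V_mono[of a b]
  by (simp add: measure_def subset_eq)

lemma measure_0: "measure \<mu> {0} = 0"
proof -
  have "emeasure \<mu> {0} \<le> emeasure (interval_measure V) {-1<..0}"
    using T by (subst emeasure_\<mu>) (auto intro!: emeasure_mono)
  also have "\<dots> = 0" by (subst emeasure_Ioc) (auto simp: V_neg)
  finally show ?thesis by (simp add: measure_def)
qed

lemma AE_pos: "AE t in \<mu>. 0 < t"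
proof (rule AE_I)
  show "{t \<in> space \<mu>. \<not> 0 < t} \<subseteq> {0}" by (auto simp: space_\<mu>)
  show "{0} \<in> sets \<mu>" using sets_Icc[of 0 0] T by simp
  show "emeasure \<mu> {0} = 0" using measure_0 by (simp add: \<mu>.emeasure_eq_measure)
qed

lemma step_simple:
  fixes g :: "real \<Rightarrow> real \<Rightarrow> 'c::real_vector"
  assumes "is_part T Q"
  shows "simple_function \<mu> (step Q g)"
  unfolding step_def
proof (intro simple_function_sum)
  fix q assume q: "q \<in> Q \<inter> {0<..}"
  then have "{prv Q q<..q} \<in> sets \<mu>"
    using assms prv_ge[of Q 0 q] by (intro sets_Ioc) (auto simp: is_part_def)
  from simple_function_compose1[OF simple_function_indicator[OF this], of "\<lambda>r. r *\<^sub>R g (prv Q q) q"]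
  show "simple_function \<mu> (\<lambda>t. indicator {prv Q q<..q} t *\<^sub>R g (prv Q q) q)" .
qed

lemma step_integral:
  fixes g :: "real \<Rightarrow> real \<Rightarrow> real"
  assumes Q: "is_part T Q" and d: "d \<in> Q"
  shows "has_bochner_integral \<mu> (\<lambda>t. indicator {0<..d} t * step Q g t) (csum Q 0 d (\<lambda>p q. g p q * (V q - V p)))"
proof -
  have fin: "finite Q" "0 \<in> Q" "Q \<subseteq> {0..T}" using Q by (auto simp: is_part_def)
  have "indicator {0<..d} t * step Q g t = (\<Sum>q\<in>Q \<inter> {0<..d}. indicator {prv Q q<..q} t * g (prv Q q) q)" for t
  proof -
    have "indicator {0<..d} t * step Q g t = (\<Sum>q\<in>Q \<inter> {0<..}. indicator {0<..d} t * (indicator {prv Q q<..q} t * g (prv Q q) q))"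
      unfolding step_def by (simp add: sum_distrib_left)
    also have "\<dots> = (\<Sum>q\<in>Q \<inter> {0<..d}. indicator {0<..d} t * (indicator {prv Q q<..q} t * g (prv Q q) q))"
    proof (rule sum.mono_neutral_right)
      show "\<forall>q\<in>Q \<inter> {0<..} - Q \<inter> {0<..d}. indicator {0<..d} t * (indicator {prv Q q<..q} t * g (prv Q q) q) = 0"
      proof
        fix q assume "q \<in> Q \<inter> {0<..} - Q \<inter> {0<..d}"
        then have "d \<le> prv Q q" using prv_ge[OF fin(1) d, of q] by auto
        then show "indicator {0<..d} t * (indicator {prv Q q<..q} t * g (prv Q q) q) = 0"
          by (auto simp: indicator_def)
      qed
    qed (use fin in auto)
    also have "\<dots> = (\<Sum>q\<in>Q \<inter> {0<..d}. indicator {prv Q q<..q} t * g (prv Q q) q)"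
    proof (rule sum.cong)
      fix q assume "q \<in> Q \<inter> {0<..d}"
      then have "0 \<le> prv Q q" "q \<le> d" using prv_ge[OF fin(1,2), of q] by auto
      then show "indicator {0<..d} t * (indicator {prv Q q<..q} t * g (prv Q q) q) = indicator {prv Q q<..q} t * g (prv Q q) q"
        by (auto simp: indicator_def)
    qed simp
    finally show ?thesis .
  qed
  moreover have "has_bochner_integral \<mu> (\<lambda>t. \<Sum>q\<in>Q \<inter> {0<..d}. indicator {prv Q q<..q} t * g (prv Q q) q)
      (\<Sum>q\<in>Q \<inter> {0<..d}. measure \<mu> {prv Q q<..q} * g (prv Q q) q)"
  proof (intro has_bochner_integral_sum has_bochner_integral_mult_left has_bochner_integral_real_indicator)
    fix q assume "q \<in> Q \<inter> {0<..d}"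
    then show "{prv Q q<..q} \<in> sets \<mu>" using prv_ge[OF fin(1,2), of q] fin by (intro sets_Ioc) auto
  qed (simp add: \<mu>.emeasure_finite less_top[symmetric])
  moreover have "(\<Sum>q\<in>Q \<inter> {0<..d}. measure \<mu> {prv Q q<..q} * g (prv Q q) q) = csum Q 0 d (\<lambda>p q. g p q * (V q - V p))"
    unfolding csum_def
  proof (rule sum.cong)
    fix q assume "q \<in> Q \<inter> {0<..d}"
    then show "measure \<mu> {prv Q q<..q} * g (prv Q q) q = g (prv Q q) q * (V q - V (prv Q q))"
      using prv[OF fin(1,2), of q] fin by (subst measure_Ioc) auto
  qed simp
  ultimately show ?thesis by simp
qed

lemma cell_of:
  assumes Q: "is_part T Q" and t: "0 < t" "t \<le> T"
  obtains p q where "p \<in> Q" "q \<in> Q" "0 \<le> p" "p < t" "t \<le> q" "Q \<inter> {p<..<q} = {}"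
    "q \<le> T" "q = ceil_in Q t"
proof -
  have fin: "finite Q" "0 \<in> Q" "Q \<subseteq> {0..T}" using Q by (auto simp: is_part_def)
  note c = ceil_in[OF Q t]
  have "0 < ceil_in Q t" using c t by simp
  note p = prv[OF fin(1,2) this]
  show thesis by (rule that[OF p(1) c(1) p(2) c(3) c(2) p(4)]) (use c fin in auto)
qed

lemma step_zero: "is_part T Q \<Longrightarrow> t \<le> 0 \<Longrightarrow> step Q g t = 0"
  unfolding step_def
proof (intro sum.neutral ballI)
  fix q assume "is_part T Q" "t \<le> 0" "q \<in> Q \<inter> {0<..}"
  then have "0 \<le> prv Q q" using prv_ge[of Q 0 q] by (auto simp: is_part_def)
  then show "indicator {prv Q q<..q} t *\<^sub>R g (prv Q q) q = 0" using \<open>t \<le> 0\<close> by simp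
qed

text \<open>The coarser function \<open>vk n\<close> is constant on each cell of \<open>P m\<close>,
  so its value at \<open>t\<close> can be read off at the right end of the cell. The distance is
  therefore a step function over \<open>P m\<close>, and its integral a finite sum.\<close>

lemma vk_difference:
  assumes "n \<le> m" and t: "t \<in> {0..T}"
  shows "norm (vk m t - vk n t) = step (P m) (\<lambda>p q. norm (slope p q - vk n q)) t"
proof (cases "t = 0")
  case True
  then show ?thesis by (simp add: vk_def step_zero[OF P_part])
next
  case False
  then have t: "0 < t" "t \<le> T" using t by auto
  obtain p q where pq: "p \<in> P m" "q \<in> P m" "0 \<le> p" "p < t" "t \<le> q" "P m \<inter> {p<..<q} = {}" "q \<le> T"
    using cell_of[OF P_part t] by metis
  obtain a b where ab: "a \<in> P n" "b \<in> P n" "0 \<le> a" "a < t" "t \<le> b" "P n \<inter> {a<..<b} = {}" "b \<le> T"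
    using cell_of[OF P_part t] by metis
  have "b \<in> P m" using ab P_le[OF assms(1)] by auto
  then have "q \<le> b" using pq ab by force
  have "vk n t = slope a b" "vk n q = slope a b"
    unfolding vk_def using ab pq \<open>q \<le> b\<close> by (auto intro!: step_slope P_part)
  moreover have "vk m t = slope p q" unfolding vk_def using pq by (intro step_slope P_part) auto
  moreover have "step (P m) (\<lambda>p q. norm (slope p q - vk n q)) t = norm (slope p q - vk n q)"
    using pq P_part[of m] by (intro step_cell) (auto simp: is_part_def)
  ultimately show ?thesis by simp
qed

lemma vk_difference_integral:
  assumes "n \<le> m"
  shows "(\<integral>\<^sup>+t. ennreal (norm (vk m t - vk n t)) \<partial>\<mu>) \<le> ennreal (sqrt (V T) * (1/4) ^ n)"
proof -
  have fin: "finite (P m)" "0 \<in> P m" "T \<in> P m" "P m \<subseteq> {0..T}" using P_part[of m] by (auto simp: is_part_def)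
  let ?g = "\<lambda>p q. norm (slope p q - vk n q)"
  have I: "has_bochner_integral \<mu> (\<lambda>t. indicator {0<..T} t * step (P m) ?g t) (csum (P m) 0 T (\<lambda>p q. ?g p q * (V q - V p)))"
    by (rule step_integral[OF P_part fin(3)])
  have eq: "indicator {0<..T} t * step (P m) ?g t = norm (vk m t - vk n t)" if "t \<in> space \<mu>" for t
    using that vk_difference[OF assms, of t] step_zero[OF P_part, of t m ?g]
    by (cases "t = 0") (auto simp: space_\<mu>)
  have "(\<integral>\<^sup>+t. ennreal (norm (vk m t - vk n t)) \<partial>\<mu>) = (\<integral>\<^sup>+t. ennreal (indicator {0<..T} t * step (P m) ?g t) \<partial>\<mu>)"
    by (intro nn_integral_cong) (simp add: eq)
  also have "\<dots> = ennreal (csum (P m) 0 T (\<lambda>p q. ?g p q * (V q - V p)))"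
    using nn_integral_eq_integral[OF integrable.intros[OF I]] has_bochner_integral_integral_eq[OF I]
      eq by (auto simp: AE_space)
  also have "csum (P m) 0 T (\<lambda>p q. ?g p q * (V q - V p)) =
      csum (P m) 0 T (\<lambda>p q. norm ((f q - f p) - (V q - V p) *\<^sub>R step (P n) slope q))"
  proof (rule csum_cong[OF fin(1,2)])
    fix p q assume pq: "p \<in> P m" "q \<in> P m" "p < q"
    have "(f q - f p) - (V q - V p) *\<^sub>R step (P n) slope q = (V q - V p) *\<^sub>R (slope p q - vk n q)"
    proof -
      have "(V q - V p) *\<^sub>R slope p q = f q - f p" using pq fin by (intro slope_increment) auto
      then show ?thesis by (simp only: vk_def scaleR_diff_right)
    qed
    then show "?g p q * (V q - V p) = norm ((f q - f p) - (V q - V p) *\<^sub>R step (P n) slope q)"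
      using V_mono[of p q] pq by simp
  qed
  also have "\<dots> \<le> sqrt (V T * (energy (P m) - energy (P n)))"
    by (rule deviation_le[OF P_part P_part P_le[OF assms]])
  also have "\<dots> \<le> sqrt (V T * ((1/4) ^ n)\<^sup>2)"
  proof (intro real_sqrt_le_mono mult_left_mono)
    have "((1/4::real) ^ n)\<^sup>2 = (1/16) ^ n" by (simp add: power2_eq_square flip: power_mult_distrib)
    then show "energy (P m) - energy (P n) \<le> ((1/4) ^ n)\<^sup>2"
      using P_energy[OF P_part P_le[OF assms]] by simp
    show "0 \<le> V T" using V_mono[of 0 T] V_neg[of 0] T by simp
  qed
  finally show ?thesis by (simp add: real_sqrt_mult ennreal_leI)
qed

section \<open>Almost everywhere limit of the slopes\<close>

definition A :: "real set" where
  "A = {t \<in> space \<mu>. (\<Sum>n. ennreal (norm (vk (Suc n) t - vk n t))) \<noteq> \<infinity>}"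

definition v :: "real \<Rightarrow> 'a" where
  "v t = (if t \<in> A then lim (\<lambda>n. vk n t) else 0)"

lemma vk_simple: "simple_function \<mu> (vk n)"
  unfolding vk_def by (rule step_simple[OF P_part])

lemma vk_difference_measurable [measurable]: "(\<lambda>t. norm (vk m t - vk n t)) \<in> borel_measurable \<mu>"
  by (intro strongly_measurable_norm_diff simple_function_strongly_measurable vk_simple)

lemma A_sets [measurable]: "A \<in> sets \<mu>"
  unfolding A_def by measurable

text \<open>The integrals of the successive distances are bounded by a geometric series, so their
  sum is integrable and hence finite almost everywhere.\<close>

lemma AE_A: "AE t in \<mu>. t \<in> A"
proof -
  have sum: "summable (\<lambda>n. sqrt (V T) * (1/4) ^ n)" by (intro summable_mult summable_geometric) simp
  have VT: "0 \<le> V T" using V_mono[of 0 T] V_neg[of 0] T by simp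
  have "(\<integral>\<^sup>+t. (\<Sum>n. ennreal (norm (vk (Suc n) t - vk n t))) \<partial>\<mu>) = (\<Sum>n. \<integral>\<^sup>+t. ennreal (norm (vk (Suc n) t - vk n t)) \<partial>\<mu>)"
    by (rule nn_integral_suminf) measurable
  also have "\<dots> \<le> (\<Sum>n. ennreal (sqrt (V T) * (1/4) ^ n))"
    by (intro suminf_le vk_difference_integral) auto
  also have "\<dots> = ennreal (\<Sum>n. sqrt (V T) * (1/4) ^ n)"
    using sum VT by (intro suminf_ennreal2) auto
  finally have "(\<integral>\<^sup>+t. (\<Sum>n. ennreal (norm (vk (Suc n) t - vk n t))) \<partial>\<mu>) \<noteq> \<infinity>"
    by (auto simp: top_unique)
  then have "AE t in \<mu>. (\<Sum>n. ennreal (norm (vk (Suc n) t - vk n t))) \<noteq> \<infinity>"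
    by (intro nn_integral_PInf_AE) measurable
  with AE_space show ?thesis by eventually_elim (simp add: A_def)
qed

lemma vk_tendsto:
  assumes "t \<in> A"
  shows "(\<lambda>n. vk n t) \<longlonglongrightarrow> v t"
proof -
  have "summable (\<lambda>n. norm (vk (Suc n) t - vk n t))"
    using assms unfolding A_def by (intro summable_suminf_not_top) auto
  then have "summable (\<lambda>n. vk (Suc n) t - vk n t)" by (rule summable_norm_cancel)
  from summable_LIMSEQ[OF this]
  have "(\<lambda>n. vk n t - vk 0 t) \<longlonglongrightarrow> (\<Sum>n. vk (Suc n) t - vk n t)"
    by (simp add: sum_lessThan_telescope[of "\<lambda>n. vk n t"])
  then have "convergent (\<lambda>n. vk n t - vk 0 t)" by (rule convergentI)
  then have "convergent (\<lambda>n. (vk n t - vk 0 t) + vk 0 t)" by (intro convergent_add convergent_const)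
  then show ?thesis using assms by (simp add: v_def convergent_LIMSEQ_iff)
qed

lemma norm_vk: "norm (vk n t) \<le> 1"
  unfolding vk_def using P_part[of n] by (intro step_norm_le norm_slope) (auto simp: is_part_def)

lemma norm_v: "norm (v t) \<le> 1"
proof (cases "t \<in> A")
  case True
  have "(\<lambda>n. norm (vk n t)) \<longlonglongrightarrow> norm (v t)" by (intro tendsto_norm vk_tendsto True)
  then show ?thesis by (rule LIMSEQ_le_const2) (use norm_vk in auto)
qed (simp add: v_def)

lemma indicator_simple:
  assumes "B \<in> sets \<mu>"
  shows "simple_function \<mu> (\<lambda>t. indicator B t *\<^sub>R vk n t)"
  by (rule simple_function_compose2[OF simple_function_indicator[OF assms] vk_simple])

lemma restricted_v_L1:
  assumes B: "B \<in> sets \<mu>"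
  shows "(\<lambda>t. indicator B t *\<^sub>R v t) \<in> L1_space \<mu>"
proof -
  have "strongly_measurable \<mu> (\<lambda>t. indicator B t *\<^sub>R v t)"
    unfolding strongly_measurable_def
  proof (intro exI conjI allI ballI)
    fix t
    \<comment> \<open>Cutting the approximants off with \<open>A\<close> makes them converge at
      every point, as strong measurability demands; outside \<open>A\<close> both sides are
      \<open>0\<close>.\<close>
    show "(\<lambda>n. indicator (B \<inter> A) t *\<^sub>R vk n t) \<longlonglongrightarrow> indicator B t *\<^sub>R v t"
      using tendsto_scaleR[OF tendsto_const vk_tendsto[of t], of "indicator B t"]
      by (cases "t \<in> A") (auto simp: v_def indicator_def)
  qed (use B in \<open>auto intro!: indicator_simple\<close>)
  moreover have "(\<integral>\<^sup>+t. ennreal (norm (indicator B t *\<^sub>R v t)) \<partial>\<mu>) < \<infinity>"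
  proof -
    have "(\<integral>\<^sup>+t. ennreal (norm (indicator B t *\<^sub>R v t)) \<partial>\<mu>) \<le> (\<integral>\<^sup>+t. 1 \<partial>\<mu>)"
      using norm_v by (intro nn_integral_mono) (auto simp: indicator_def)
    also have "\<dots> < \<infinity>" by (simp add: less_top[symmetric])
    finally show ?thesis .
  qed
  ultimately show ?thesis by (simp add: L1_space_def)
qed

lemma v_L1: "v \<in> L1_space \<mu>"
proof -
  have "(\<lambda>t. indicator (space \<mu>) t *\<^sub>R v t) \<in> L1_space \<mu>" by (rule restricted_v_L1) simp
  then show ?thesis
    unfolding L1_space_def strongly_measurable_def
    by (auto cong: nn_integral_cong_simp)
qed

lemma AE_tendsto: "AE t in \<mu>. (\<lambda>n. vk n t) \<longlonglongrightarrow> v t"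
  using AE_A by eventually_elim (rule vk_tendsto)

section \<open>The vector measure with density \<open>v\<close>\<close>

definition m :: "real set \<Rightarrow> 'a" where
  "m B = (SOME I. has_strong_integral \<mu> (\<lambda>t. indicator B t *\<^sub>R v t) I)"

lemma m_integral:
  assumes B: "B \<in> sets \<mu>"
  shows "has_strong_integral \<mu> (\<lambda>t. indicator B t *\<^sub>R v t) (m B)"
proof -
  let ?f = "\<lambda>t. indicator B t *\<^sub>R v t"
  let ?s = "\<lambda>n t. indicator B t *\<^sub>R vk n t"
  have meas: "strongly_measurable \<mu> ?f" using restricted_v_L1[OF B] by (simp add: L1_space_def)
  have "\<exists>I. has_strong_integral \<mu> ?f I"
  proof (rule has_strong_integral_exists[OF restricted_v_L1[OF B], of ?s])
    fix n
    show "Bochner_Integration.simple_bochner_integrable \<mu> (?s n)"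
      using indicator_simple[OF B] \<mu>.emeasure_finite by (intro simple_bochner_integrable.intros) auto
  next
    have "(\<lambda>n. \<integral>\<^sup>+t. ennreal (norm (?f t - ?s n t)) \<partial>\<mu>) \<longlonglongrightarrow> (\<integral>\<^sup>+t. 0 \<partial>\<mu>)"
    proof (rule nn_integral_dominated_convergence[where w = "\<lambda>_. 2"])
      fix n
      show "(\<lambda>t. ennreal (norm (?f t - ?s n t))) \<in> borel_measurable \<mu>"
        by (intro measurable_compose[OF _ measurable_ennreal] strongly_measurable_norm_diff meas
            simple_function_strongly_measurable indicator_simple B)
      have "norm (?f t - ?s n t) \<le> 2" for t
        using norm_triangle_ineq4[of "?f t" "?s n t"] norm_v[of t] norm_vk[of n t] by (auto simp: indicator_def)
      then show "AE t in \<mu>. ennreal (norm (?f t - ?s n t)) \<le> 2"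
        by (intro AE_I2) (metis ennreal_leI ennreal_numeral zero_le_numeral)
    next
      show "(\<integral>\<^sup>+t. 2 \<partial>\<mu>) < \<infinity>" by (simp add: ennreal_mult_eq_top_iff less_top[symmetric])
      show "AE t in \<mu>. (\<lambda>n. ennreal (norm (?f t - ?s n t))) \<longlonglongrightarrow> 0"
        using AE_tendsto
      proof eventually_elim
        case (elim t)
        have "(\<lambda>n. ennreal (norm (?f t - ?s n t))) \<longlonglongrightarrow> ennreal (norm (?f t - indicator B t *\<^sub>R v t))"
          by (intro tendsto_ennrealI tendsto_norm tendsto_diff tendsto_const tendsto_scaleR elim)
        then show ?case by simp
      qed
    qed auto
    then show "(\<lambda>n. \<integral>\<^sup>+t. ennreal (norm (?f t - ?s n t)) \<partial>\<mu>) \<longlonglongrightarrow> 0" by simp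
  qed
  then show ?thesis unfolding m_def by (rule someI_ex)
qed

lemma m_inner:
  assumes "B \<in> sets \<mu>"
  shows "has_bochner_integral \<mu> (\<lambda>t. indicator B t * (v t \<bullet> h)) (m B \<bullet> h)"
  using has_strong_integral_inner[OF m_integral[OF assms], of h] by simp

text \<open>Testing with the vector \<open>m B\<close> itself turns the scalar estimate
  \<open><v t, h> \<le> norm h\<close> into a bound on the norm.\<close>

lemma norm_m:
  assumes B: "B \<in> sets \<mu>"
  shows "norm (m B) \<le> measure \<mu> B"
proof -
  note I1 = m_inner[OF B, of "m B"]
  have I2: "has_bochner_integral \<mu> (\<lambda>t. indicator B t * norm (m B)) (measure \<mu> B * norm (m B))"
    by (intro has_bochner_integral_mult_left has_bochner_integral_real_indicator B)
      (simp add: \<mu>.emeasure_finite less_top[symmetric])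
  have "v t \<bullet> m B \<le> norm (m B)" for t
    using norm_cauchy_schwarz[of "v t" "m B"] mult_right_mono[OF norm_v, of "norm (m B)" t] by simp
  then have "AE t in \<mu>. indicator B t * (v t \<bullet> m B) \<le> indicator B t * norm (m B)"
    by (intro AE_I2 mult_left_mono) auto
  from integral_mono_AE[OF integrable.intros[OF I1] integrable.intros[OF I2] this]
  have "m B \<bullet> m B \<le> measure \<mu> B * norm (m B)"
    unfolding has_bochner_integral_integral_eq[OF I1] has_bochner_integral_integral_eq[OF I2] .
  then have "norm (m B) * norm (m B) \<le> measure \<mu> B * norm (m B)"
    by (simp add: power2_norm_eq_inner flip: power2_eq_square)
  then show ?thesis by (cases "norm (m B) = 0") (auto simp: mult_le_cancel_right)
qed

lemma m_Un:
  assumes "B \<in> sets \<mu>" "C \<in> sets \<mu>" "B \<inter> C = {}"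
  shows "m (B \<union> C) = m B + m C"
proof -
  have "m (B \<union> C) \<bullet> h = (m B + m C) \<bullet> h" for h
  proof -
    have "has_bochner_integral \<mu> (\<lambda>t. indicator B t * (v t \<bullet> h) + indicator C t * (v t \<bullet> h)) (m B \<bullet> h + m C \<bullet> h)"
      by (intro has_bochner_integral_add m_inner assms)
    moreover have "indicator B t * (v t \<bullet> h) + indicator C t * (v t \<bullet> h) = indicator (B \<union> C) t * (v t \<bullet> h)" for t
      using assms(3) by (auto simp: indicator_def)
    ultimately show ?thesis
      using has_bochner_integral_eq[OF m_inner[of "B \<union> C" h]] assms by (simp add: inner_add_left)
  qed
  then show ?thesis by (metis vector_eq_rdot)
qed

lemma m_empty: "m {} = 0"
  using norm_m[of "{}"] by simp

text \<open>Finite additivity reduces the claim to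
  \<open>m (C n) \<longlonglongrightarrow> 0\<close> for the remainders \<open>C n\<close>. These
  decrease to the empty set, and \<open>norm_m\<close> transfers the continuity of \<mu> along them
  to \<open>m\<close>.\<close>

lemma vector_measure_m: "vector_measure (borel_on T) m"
  unfolding vector_measure_def sets_\<mu>[symmetric]
proof (intro allI impI)
  fix B :: "nat \<Rightarrow> real set" assume B: "range B \<subseteq> sets \<mu>" and disj: "disjoint_family B"
  define C where "C n = (\<Union>i. B i) - (\<Union>i<n. B i)" for n
  have C: "C n \<in> sets \<mu>" for n unfolding C_def using B by (intro sets.Diff sets.countable_UN) auto
  have CB: "C n = C (Suc n) \<union> B n" "C (Suc n) \<inter> B n = {}" for n
  proof -
    have "B i \<inter> B n = {}" if "i < n" for i
      using disj that unfolding disjoint_family_on_def by auto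
    then show "C n = C (Suc n) \<union> B n" "C (Suc n) \<inter> B n = {}"
      unfolding C_def by (auto simp: less_Suc_eq)
  qed
  have Bn: "B n \<in> sets \<mu>" for n using B by auto
  have mC: "m (C n) = m (\<Union>i. B i) - (\<Sum>i<n. m (B i))" for n
  proof (induction n)
    case (Suc n)
    have "m (C n) = m (C (Suc n)) + m (B n)"
      using m_Un[OF C Bn CB(2)] CB(1) by metis
    then show ?case using Suc by (simp add: algebra_simps)
  qed (simp add: C_def)
  have "(\<lambda>n. measure \<mu> (C n)) \<longlonglongrightarrow> measure \<mu> (\<Inter>n. C n)"
    using C by (intro \<mu>.finite_Lim_measure_decseq) (auto simp: decseq_def C_def)
  moreover have "(\<Inter>n. C n) = {}" by (auto simp: C_def)
  ultimately have "(\<lambda>n. measure \<mu> (C n)) \<longlonglongrightarrow> 0" by simp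
  then have "(\<lambda>n. m (C n)) \<longlonglongrightarrow> 0"
    by (rule Lim_null_comparison[rotated]) (use norm_m C in auto)
  then have "(\<lambda>n. m (\<Union>i. B i) - m (C n)) \<longlonglongrightarrow> m (\<Union>i. B i) - 0" by (intro tendsto_diff tendsto_const)
  then show "(\<lambda>n. m (B n)) sums m (\<Union>n. B n)" unfolding sums_def mC by simp
qed

lemma measure_variation_m: "measure_variation (borel_on T) m < \<infinity>"
proof -
  have "measure_variation (borel_on T) m \<le> ennreal (measure \<mu> (space \<mu>))"
    unfolding measure_variation_def
  proof (rule SUP_least, clarify)
    fix R assume R: "finite R" "partition_on (space (borel_on T)) R" "R \<subseteq> sets (borel_on T)"
    then have RS: "R \<subseteq> sets \<mu>" by (simp add: sets_\<mu>)
    have "(\<Sum>B\<in>R. norm (m B)) \<le> (\<Sum>B\<in>R. measure \<mu> B)" using RS by (intro sum_mono norm_m) auto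
    also have "\<dots> = measure \<mu> (\<Union>B\<in>R. B)"
      using R RS by (intro \<mu>.finite_measure_finite_Union[symmetric])
        (auto simp: partition_on_def disjoint_def disjoint_family_on_def)
    also have "\<dots> \<le> measure \<mu> (space \<mu>)" by (rule \<mu>.bounded_measure)
    finally show "(\<Sum>B\<in>R. ennreal (norm (m B))) \<le> ennreal (measure \<mu> (space \<mu>))"
      by (simp add: sum_ennreal ennreal_leI)
  qed
  also have "\<dots> < \<infinity>" by simp
  finally show ?thesis .
qed

text \<open>At a partition point \<open>d\<close> the integral of \<open>vk n\<close> over
  \<open>]0,d]\<close> telescopes to \<open>f d - f 0\<close> exactly, for every
  \<open>n \<ge> k\<close>. Dominated convergence carries this over to \<open>v\<close>.\<close>

lemma m_Ioc_part:
  assumes d: "d \<in> P k"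
  shows "m {0<..d} = f d - f 0"
proof -
  have d0: "0 \<le> d" "d \<le> T" using d P_part[of k] by (auto simp: is_part_def)
  have B: "{0<..d} \<in> sets \<mu>" using d0 by (intro sets_Ioc) auto
  have "m {0<..d} \<bullet> h = (f d - f 0) \<bullet> h" for h
  proof -
    have meas: "(\<lambda>t. v t \<bullet> h) \<in> borel_measurable \<mu>" "(\<lambda>t. vk n t \<bullet> h) \<in> borel_measurable \<mu>" for n
      using v_L1 strongly_measurable_inner[OF simple_function_strongly_measurable[OF vk_simple]]
      by (auto simp: L1_space_def intro: strongly_measurable_inner)
    have "(\<lambda>n. \<integral>t. indicator {0<..d} t * (vk n t \<bullet> h) \<partial>\<mu>) \<longlonglongrightarrow> (\<integral>t. indicator {0<..d} t * (v t \<bullet> h) \<partial>\<mu>)"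
    proof (rule integral_dominated_convergence[where w = "\<lambda>_. norm h"])
      show "AE t in \<mu>. (\<lambda>n. indicator {0<..d} t * (vk n t \<bullet> h)) \<longlonglongrightarrow> indicator {0<..d} t * (v t \<bullet> h)"
        using AE_tendsto by eventually_elim (intro tendsto_intros)
      have "norm (indicator {0<..d} t * (vk n t \<bullet> h)) \<le> norm h" for n t
        using Cauchy_Schwarz_ineq2[of "vk n t" h] mult_right_mono[OF norm_vk[of n t], of "norm h"]
        by (auto simp: indicator_def)
      then show "AE t in \<mu>. norm (indicator {0<..d} t * (vk n t \<bullet> h)) \<le> norm h" for n by simp
    qed (use meas B in auto)
    moreover have "(\<integral>t. indicator {0<..d} t * (vk n t \<bullet> h) \<partial>\<mu>) = (f d - f 0) \<bullet> h" if "k \<le> n" for n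
    proof -
      have dn: "d \<in> P n" using d P_le[OF that] by auto
      have fin: "finite (P n)" "0 \<in> P n" "P n \<subseteq> {0..T}" using P_part[of n] by (auto simp: is_part_def)
      have "vk n t \<bullet> h = step (P n) (\<lambda>p q. slope p q \<bullet> h) t" for t
        by (simp add: vk_def step_def inner_sum_left)
      then have "(\<integral>t. indicator {0<..d} t * (vk n t \<bullet> h) \<partial>\<mu>) = csum (P n) 0 d (\<lambda>p q. (slope p q \<bullet> h) * (V q - V p))"
        using has_bochner_integral_integral_eq[OF step_integral[OF P_part dn, of "\<lambda>p q. slope p q \<bullet> h"]] by simp
      also have "\<dots> = csum (P n) 0 d (\<lambda>p q. (f q - f p) \<bullet> h)"
      proof (rule csum_cong[OF fin(1,2)])
        fix p q assume "p \<in> P n" "q \<in> P n" "p < q"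
        then show "(slope p q \<bullet> h) * (V q - V p) = (f q - f p) \<bullet> h"
          using slope_increment[of p q] fin by (metis atLeastAtMost_iff inner_scaleR_left less_imp_le mult.commute subsetD)
      qed
      also have "\<dots> = (f d - f 0) \<bullet> h"
        using fin dn d0 by (simp add: csum_inner_left csum_telescope)
      finally show ?thesis .
    qed
    ultimately have "(\<integral>t. indicator {0<..d} t * (v t \<bullet> h) \<partial>\<mu>) = (f d - f 0) \<bullet> h"
      by (intro LIMSEQ_unique[OF _ tendsto_eventually]) (auto simp: eventually_sequentially)
    then show ?thesis using has_bochner_integral_integral_eq[OF m_inner[OF B, of h]] by simp
  qed
  then show ?thesis by (metis vector_eq_rdot)
qed

section \<open>From partition points to arbitrary intervals\<close>

lemma V_fine: "fine_partition T V (inverse (real (Suc n))) (P n)"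
  unfolding fine_partition_def
proof (intro conjI allI impI)
  fix r s assume "0 \<le> r" "r \<le> s" "s \<le> T" "P n \<inter> {r<..s} = {}"
  then show "V s - V r \<le> inverse (real (Suc n))" using fineD(5)[OF P_fine, of r s n] by linarith
qed (use fineD(1-4)[OF P_fine] in auto)

text \<open>Between \<open>t\<close> and the next partition point the function
  \<open>V t + t\<close> grows by at most \<open>1/(n+1)\<close>, and so does its second
  summand.\<close>

lemma ceil_in_tendsto:
  assumes t: "0 < t" "t \<le> T"
  shows "(\<lambda>n. ceil_in (P n) t) \<longlonglongrightarrow> t"
proof -
  have "norm (ceil_in (P n) t - t) \<le> inverse (real (Suc n))" for n
  proof -
    note c = ceil_in[OF P_part t, of n]
    have cT: "ceil_in (P n) t \<le> T" using c P_part[of n] by (auto simp: is_part_def)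
    have "ceil_in (P n) t \<le> t + inverse (real (Suc n))"
    proof (rule dense_le)
      fix s assume s: "s < ceil_in (P n) t"
      show "s \<le> t + inverse (real (Suc n))"
      proof (cases "t \<le> s")
        case True
        have "P n \<inter> {t<..s} = {}" using c(4) s by force
        then show ?thesis
          using fineD(5)[OF P_fine, of t s n] V_mono[OF True] t True s cT by linarith
      next
        case False
        moreover have "0 \<le> inverse (real (Suc n))" by simp
        ultimately show ?thesis by linarith
      qed
    qed
    then show ?thesis using c by simp
  qed
  then have "(\<lambda>n. ceil_in (P n) t - t) \<longlonglongrightarrow> 0"
    by (intro Lim_null_comparison[OF _ LIMSEQ_inverse_real_of_nat]) auto
  then show ?thesis by (simp add: LIM_zero_iff)
qed

lemma V_ceil_in_tendsto:
  assumes t: "0 < t" "t \<le> T"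
  shows "(\<lambda>n. V (ceil_in (P n) t)) \<longlonglongrightarrow> V t"
proof (rule right_cont_sequence[of t V])
  show "continuous (at_right t) V" using V by (simp add: control_def)
  show "(\<lambda>n. ceil_in (P n) t) \<longlonglongrightarrow> t" by (rule ceil_in_tendsto[OF t])
  show "t \<le> ceil_in (P n) t" for n by (rule ceil_in(2)[OF P_part t])
qed

lemma dominated_ceil_in_tendsto:
  fixes g :: "real \<Rightarrow> 'c::real_normed_vector"
  assumes t: "0 < t" "t \<le> T" and g: "\<And>s t. 0 \<le> s \<Longrightarrow> s \<le> t \<Longrightarrow> t \<le> T \<Longrightarrow> norm (g t - g s) \<le> V t - V s"
  shows "(\<lambda>n. g (ceil_in (P n) t)) \<longlonglongrightarrow> g t"
proof -
  have "norm (g (ceil_in (P n) t) - g t) \<le> V (ceil_in (P n) t) - V t" for n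
    using ceil_in(1,2)[OF P_part[of n] t] P_part[of n] t by (intro g) (auto simp: is_part_def)
  moreover have "(\<lambda>n. V (ceil_in (P n) t) - V t) \<longlonglongrightarrow> 0"
    using tendsto_diff[OF V_ceil_in_tendsto[OF t] tendsto_const, of "V t"] by simp
  ultimately have "(\<lambda>n. g (ceil_in (P n) t) - g t) \<longlonglongrightarrow> 0"
    by (intro Lim_null_comparison[of "\<lambda>n. g (ceil_in (P n) t) - g t"]) auto
  then show ?thesis by (simp add: LIM_zero_iff)
qed

text \<open>Partition points approximate \<open>t\<close> from the right. The excess interval
  \<open>]t, ?c n]\<close> has \<open>dV\<close>-mass tending to \<open>0\<close> by right
  continuity of \<open>V\<close>.\<close>

lemma m_0_Ioc:
  assumes t: "0 < t" "t \<le> T"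
  shows "m {0<..t} = f t - f 0"
proof -
  let ?c = "\<lambda>n. ceil_in (P n) t"
  have c: "t \<le> ?c n" "?c n \<le> T" "?c n \<in> P n" for n
    using ceil_in(1,2)[OF P_part[of n] t] P_part[of n] by (auto simp: is_part_def)
  have eq: "m {0<..t} = f (?c n) - f 0 - m {t<..?c n}" for n
  proof -
    have "m ({0<..t} \<union> {t<..?c n}) = m {0<..t} + m {t<..?c n}"
      using t c[of n] by (intro m_Un sets_Ioc) auto
    moreover have "{0<..t} \<union> {t<..?c n} = {0<..?c n}" using t c[of n] by auto
    ultimately show ?thesis using m_Ioc_part[OF c(3)[of n]] by simp
  qed
  have "(\<lambda>n. m {t<..?c n}) \<longlonglongrightarrow> 0"
  proof (rule Lim_null_comparison)
    show "(\<lambda>n. V (?c n) - V t) \<longlonglongrightarrow> 0"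
      using tendsto_diff[OF V_ceil_in_tendsto[OF t] tendsto_const, of "V t"] by simp
    have "norm (m {t<..?c n}) \<le> V (?c n) - V t" for n
      using norm_m[OF sets_Ioc[of t "?c n"]] measure_Ioc[of t "?c n"] t c[of n] by simp
    then show "\<forall>\<^sub>F n in sequentially. norm (m {t<..?c n}) \<le> V (?c n) - V t" by simp
  qed
  moreover have "(\<lambda>n. f (?c n)) \<longlonglongrightarrow> f t" using t dom by (rule dominated_ceil_in_tendsto)
  ultimately have "(\<lambda>n. f (?c n) - f 0 - m {t<..?c n}) \<longlonglongrightarrow> f t - f 0 - 0"
    by (intro tendsto_diff tendsto_const)
  then show ?thesis unfolding eq[symmetric] by (simp add: LIMSEQ_const_iff)
qed

lemma m_Ioc:
  assumes "0 \<le> c" "c \<le> d" "d \<le> T"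
  shows "m {c<..d} = f d - f c"
proof -
  have "m ({0<..c} \<union> {c<..d}) = m {0<..c} + m {c<..d}"
    using assms by (intro m_Un sets_Ioc) auto
  moreover have "{0<..c} \<union> {c<..d} = {0<..d}" using assms by auto
  moreover have "m {0<..t} = f t - f 0" if "0 \<le> t" "t \<le> T" for t
    using m_0_Ioc[of t] m_empty that by (cases "t = 0") auto
  ultimately show ?thesis using assms by simp
qed

text \<open>For \<open>r < c\<close> additivity gives
  \<open>f r = f d - m {c..d} - m {r<..<c}\<close>, and the last term tends to \<open>0\<close> as
  \<open>r\<close> increases to \<open>c\<close>. So the left limit exists and has the required
  value; at \<open>c = 0\<close> the convention \<open>f(0-) = f(0)\<close> fits because \<mu> has
  no mass there.\<close>

lemma m_Icc:
  assumes "0 \<le> c" "c < d" "d \<le> T"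
  shows "m {c..d} = f d - left_limit f c"
proof (cases "c = 0")
  case True
  have "m ({0} \<union> {0<..d}) = m {0} + m {0<..d}"
    using assms sets_Icc[of 0 0] T by (intro m_Un sets_Ioc) auto
  moreover have "m {0} = 0" using norm_m[of "{0}"] sets_Icc[of 0 0] T measure_0 by simp
  moreover have "{0} \<union> {0<..d} = {c..d}" using True assms by auto
  ultimately show ?thesis using m_Ioc[of 0 d] assms True by (simp add: left_limit_def)
next
  case False
  then have c: "0 < c" using assms by simp
  let ?s = "\<lambda>n::nat. c - c * inverse (real (Suc n))"
  have s: "0 \<le> ?s n" "?s n < c" for n using c by (auto simp: field_simps)
  have lim: "?s \<longlonglongrightarrow> c"
    using tendsto_diff[OF tendsto_const tendsto_mult[OF tendsto_const LIMSEQ_inverse_real_of_nat], of c c] by simp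
  have "(\<lambda>n. measure \<mu> {?s n<..<c}) \<longlonglongrightarrow> measure \<mu> (\<Inter>n. {?s n<..<c})"
  proof (rule \<mu>.finite_Lim_measure_decseq)
    show "range (\<lambda>n. {?s n<..<c}) \<subseteq> sets \<mu>" using s assms by (auto intro!: sets_Ioo)
    show "decseq (\<lambda>n. {?s n<..<c})"
    proof (rule decseq_SucI)
      fix n
      have "inverse (real (Suc (Suc n))) \<le> inverse (real (Suc n))" by (intro le_imp_inverse_le) auto
      then have "?s n \<le> ?s (Suc n)" using c by (simp add: mult_left_mono del: of_nat_Suc)
      then show "{?s (Suc n)<..<c} \<subseteq> {?s n<..<c}" by auto
    qed
  qed
  moreover have "(\<Inter>n. {?s n<..<c}) = {}"
  proof safe
    fix r assume r: "r \<in> (\<Inter>n. {?s n<..<c})"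
    then have "c \<le> r" by (intro LIMSEQ_le_const2[OF lim]) (auto intro: less_imp_le)
    then show "r \<in> {}" using r by auto
  qed
  ultimately have small: "(\<lambda>n. measure \<mu> {?s n<..<c}) \<longlonglongrightarrow> 0" by simp
  have "(f \<longlongrightarrow> f d - m {c..d}) (at_left c)"
  proof (rule tendstoI)
    fix e :: real assume "0 < e"
    then have "eventually (\<lambda>n. measure \<mu> {?s n<..<c} < e) sequentially" using order_tendstoD(2)[OF small] by blast
    then obtain n where n: "measure \<mu> {?s n<..<c} < e" by (auto simp: eventually_sequentially)
    show "\<forall>\<^sub>F r in at_left c. dist (f r) (f d - m {c..d}) < e"
    proof (rule eventually_at_leftI[OF _ s(2)[of n]])
      fix r assume r: "r \<in> {?s n<..<c}"
      then have r0: "0 \<le> r" "r < c" using s(1)[of n] by auto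
      have "m ({r<..<c} \<union> {c..d}) = m {r<..<c} + m {c..d}"
        using r0 assms by (intro m_Un sets_Ioo sets_Icc) auto
      moreover have "{r<..<c} \<union> {c..d} = {r<..d}" using r0 assms by auto
      ultimately have "f r - (f d - m {c..d}) = - m {r<..<c}"
        using m_Ioc[of r d] r0 assms by (simp add: algebra_simps)
      moreover have "norm (m {r<..<c}) \<le> measure \<mu> {r<..<c}" using r0 assms by (intro norm_m sets_Ioo) auto
      moreover have "measure \<mu> {r<..<c} \<le> measure \<mu> {?s n<..<c}"
        using r r0 s assms by (intro \<mu>.finite_measure_mono sets_Ioo) auto
      ultimately show "dist (f r) (f d - m {c..d}) < e" using n by (simp add: dist_norm)
    qed
  qed
  then have "Lim (at_left c) f = f d - m {c..d}" by (intro tendsto_Lim) simp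
  then show ?thesis using False by (simp add: left_limit_def)
qed

lemma differential_measure: "is_differential_measure T f m"
  unfolding is_differential_measure_def
  using vector_measure_m measure_variation_m m_Icc m_Ioc by auto

lemma density: "has_density \<mu> v m"
  unfolding has_density_def using m_integral by blast

end

text \<open>Fineness and near-maximality of the energy both survive refinement. The union of the
  partitions chosen up to index \<open>n\<close> therefore keeps the properties for
  \<open>n\<close>, and these unions are nested.\<close>

lemma (in dominated) partition_sequence_exists:
  obtains P where "\<And>n. P n \<subseteq> P (Suc n)"
    "\<And>n. fine_partition T (\<lambda>t. V t + t) (inverse (real (Suc n))) (P n)"
    "\<And>n Q. is_part T Q \<Longrightarrow> P n \<subseteq> Q \<Longrightarrow> energy Q \<le> energy (P n) + (1/16) ^ n"
proof -
  have ctrl: "control (\<lambda>t. V t + t)"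
    by (intro control_add V) (auto simp: control_def mono_def)
  define good where "good n A \<longleftrightarrow> fine_partition T (\<lambda>t. V t + t) (inverse (real (Suc n))) A \<and>
    (\<forall>R Q. is_part T R \<longrightarrow> A \<subseteq> R \<longrightarrow> is_part T Q \<longrightarrow> energy Q \<le> energy R + (1/16) ^ n)" for n A
  have "\<exists>A. good n A" for n
  proof -
    obtain F where F: "fine_partition T (\<lambda>t. V t + t) (inverse (real (Suc n))) F"
      using fine_exists[OF ctrl, of T "inverse (real (Suc n))"] T by auto
    obtain E where E: "is_part T E" "\<And>R Q. is_part T R \<Longrightarrow> E \<subseteq> R \<Longrightarrow> is_part T Q \<Longrightarrow> energy Q \<le> energy R + (1/16) ^ n"
      using energy_near_max[of "(1/16) ^ n"] by auto
    have "fine_partition T (\<lambda>t. V t + t) (inverse (real (Suc n))) (F \<union> E)"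
      by (rule fine_superset[OF F]) (use fineD(1,2)[OF F] E(1) in \<open>auto simp: is_part_def\<close>)
    moreover have "energy Q \<le> energy R + (1/16) ^ n" if "is_part T R" "F \<union> E \<subseteq> R" "is_part T Q" for R Q
      using that by (intro E(2)) auto
    ultimately have "good n (F \<union> E)" unfolding good_def by blast
    then show ?thesis by blast
  qed
  then obtain A where good: "\<And>n. good n (A n)" by metis
  have A: "fine_partition T (\<lambda>t. V t + t) (inverse (real (Suc n))) (A n)"
    "is_part T R \<Longrightarrow> A n \<subseteq> R \<Longrightarrow> is_part T Q \<Longrightarrow> energy Q \<le> energy R + (1/16) ^ n" for n R Q
    using good[of n] unfolding good_def by blast+
  define P where "P n = (\<Union>k\<le>n. A k)" for n
  have fine: "fine_partition T (\<lambda>t. V t + t) (inverse (real (Suc n))) (P n)" for n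
  proof (rule fine_superset[OF A(1)])
    show "A n \<subseteq> P n" by (auto simp: P_def)
    show "finite (P n)" "P n \<subseteq> {0..T}" using fineD(1,2)[OF A(1)] by (auto simp: P_def)
  qed
  show thesis
  proof (rule that[of P])
    show "P n \<subseteq> P (Suc n)" for n by (auto simp: P_def atMost_Suc)
    show "energy Q \<le> energy (P n) + (1/16) ^ n" if "is_part T Q" "P n \<subseteq> Q" for n Q
      using A(2)[OF fine_is_part[OF fine] _ that(1), of n n] by (auto simp: P_def)
  qed (rule fine)
qed

section \<open>The play operator yields regular solutions\<close>

text \<open>As \<open>y\<close> is dominated by \<open>V\<close>, the measure \<open>dV\<close> can
  serve as \<mu> and the limit of the slopes as density. The domination of \<open>x\<close> is
  needed as well: the inequality on a cell involves \<open>x\<close> at its right end, which must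
  converge to \<open>x t\<close>.\<close>

lemma regular_solution_is_play_solution:
  fixes Z :: "'a::{real_inner, banach} set"
  assumes reg: "regular_solution Z T z0 u y" and u: "u \<in> BVr T" and y: "y \<in> BVr T" and T: "0 < T"
  shows "is_play_solution T Z z0 u y"
proof -
  let ?V = "cumvar T u"
  define x where "x = (\<lambda>t. u t - y t)"
  interpret bounded_variation T u using u T by (rule BVr_bounded_variation)
  have V: "control ?V" by (rule BVr_control[OF u T])
  have sw: "sweep Z T ?V u y" and y0: "y 0 = u 0 - z0" using reg by (auto simp: regular_solution_def)
  have dom_y: "norm (y t - y s) \<le> ?V t - ?V s" and dom_x: "norm (x t - x s) \<le> ?V t - ?V s"
    if "0 \<le> s" "s \<le> t" "t \<le> T" for s t
    using reg that unfolding regular_solution_def x_def by blast+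
  interpret dominated T ?V y
    by unfold_locales (use T V cumvar_eq_0 dom_y in auto)
  obtain P where P: "\<And>n. P n \<subseteq> P (Suc n)"
    "\<And>n. fine_partition T (\<lambda>t. ?V t + t) (inverse (real (Suc n))) (P n)"
    "\<And>n Q. is_part T Q \<Longrightarrow> P n \<subseteq> Q \<Longrightarrow> energy Q \<le> energy (P n) + (1/16) ^ n"
    using partition_sequence_exists by blast
  interpret D: density_process T ?V y P
    by unfold_locales (use P in auto)
  have xZ: "x t \<in> Z" if "t \<in> {0..T}" for t using sweepD(1)[OF sw that] by (simp add: x_def)
  \<comment> \<open>Dividing the integrated inequality on a cell by \<open>V q - V p\<close> leaves an error that tends to \<open>0\<close> at every
     point where the slopes converge, so the exceptional null set does not depend on \<open>z\<close>.\<close>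
  have "AE t in D.\<mu>. - D.v t \<in> normal_cone ((\<lambda>z. u t - z) ` Z) (y t)"
    using D.AE_tendsto D.AE_pos AE_space
  proof eventually_elim
    case (elim t)
    then have t: "0 < t" "t \<le> T" by (auto simp: D.space_\<mu>)
    have "D.v t \<bullet> (z - x t) \<le> 0" if z: "z \<in> Z" for z
    proof -
      let ?c = "\<lambda>n. ceil_in (P n) t"
      have "D.vk n t \<bullet> (z - x (?c n)) \<le> inverse (real (Suc n))" for n
      proof -
        obtain p q where pq: "p \<in> P n" "q \<in> P n" "0 \<le> p" "p < t" "t \<le> q" "P n \<inter> {p<..<q} = {}"
          "q \<le> T" "q = ?c n"
          using D.cell_of[OF D.P_part t] by metis
        then have "p < q" by simp
        have vk: "D.vk n t = slope p q" unfolding D.vk_def using pq by (intro step_slope D.P_part) auto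
        have "(y q - y p) \<bullet> (z - x q) \<le> (?V q - ?V p) * inverse (real (Suc n))"
          unfolding x_def by (rule sweep_fine[OF sw V D.V_fine pq(3) \<open>p < q\<close> pq(7,6) z])
        then show ?thesis
        proof (cases "?V q = ?V p")
          case False
          then have "0 < ?V q - ?V p" using V_mono[of p q] \<open>p < q\<close> by simp
          moreover have "(?V q - ?V p) * (slope p q \<bullet> (z - x q)) \<le> (?V q - ?V p) * inverse (real (Suc n))"
            using \<open>(y q - y p) \<bullet> (z - x q) \<le> _\<close> slope_increment[of p q] pq \<open>p < q\<close>
            by (metis inner_scaleR_left less_imp_le)
          ultimately show ?thesis using vk pq(8) by (simp add: mult_le_cancel_left_pos del: of_nat_Suc)
        qed (simp add: vk slope_def)
      qed
      moreover have "(\<lambda>n. D.vk n t \<bullet> (z - x (?c n))) \<longlonglongrightarrow> D.v t \<bullet> (z - x t)"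
        using elim(1) D.dominated_ceil_in_tendsto[OF t dom_x] by (intro tendsto_intros) auto
      ultimately show ?thesis
        using LIMSEQ_le[OF _ LIMSEQ_inverse_real_of_nat] by blast
    qed
    moreover have "- D.v t \<bullet> ((u t - z) - y t) = D.v t \<bullet> (z - x t)" for z
      by (simp add: x_def inner_diff algebra_simps)
    ultimately show ?case unfolding normal_cone_def by auto
  qed
  moreover have "y t \<in> (\<lambda>z. u t - z) ` Z" if "t \<in> {0..T}" for t
    by (rule image_eqI[of _ _ "x t"]) (use xZ that in \<open>auto simp: x_def\<close>)
  ultimately show ?thesis
    unfolding is_play_solution_def
    using y y0 D.sets_\<mu> D.\<mu>.finite_measure_axioms D.v_L1 D.differential_measure D.density by blast
qed

lemma dominated_BVr:
  fixes f :: "real \<Rightarrow> 'a::real_normed_vector"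
  assumes T: "0 < T" and V: "control V" and ext: "f \<in> extensional {0..T}"
    and dom: "\<And>s t. 0 \<le> s \<Longrightarrow> s \<le> t \<Longrightarrow> t \<le> T \<Longrightarrow> norm (f t - f s) \<le> V t - V s"
  shows "f \<in> BVr T"
proof -
  have "variation f {0..T} \<le> ennreal (V T - V 0)"
  proof (rule variation_le[of "{}"])
    fix Q assume Q: "finite Q" "Q \<subseteq> {0..T}" "0 \<in> Q" "T \<in> Q"
    have "csum Q 0 T (\<lambda>p q. norm (f q - f p)) \<le> csum Q 0 T (\<lambda>p q. V q - V p)"
      using Q by (intro csum_mono dom) auto
    then show "csum Q 0 T (\<lambda>p q. norm (f q - f p)) \<le> V T - V 0"
      using csum_telescope[OF Q(1,3,4), of V] T by simp
  qed (use T in auto)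
  then have "variation f {0..T} < \<infinity>" by (rule le_less_trans) simp
  moreover have "(f \<longlongrightarrow> f t) (at_right t)" if t: "t \<in> {0..<T}" for t
  proof -
    have "(V \<longlongrightarrow> V t) (at_right t)" using V by (simp add: control_def continuous_within)
    then have lim: "((\<lambda>s. V s - V t) \<longlongrightarrow> 0) (at_right t)" by (simp add: LIM_zero_iff)
    have "\<forall>\<^sub>F s in at_right t. norm (f s - f t) \<le> V s - V t"
      using t by (intro eventually_at_rightI[of t T]) (auto intro!: dom)
    then have "((\<lambda>s. f s - f t) \<longlongrightarrow> 0) (at_right t)" by (rule Lim_null_comparison[OF _ lim])
    then show ?thesis by (simp add: LIM_zero_iff)
  qed
  ultimately show ?thesis using ext by (simp add: BVr_def)
qed

text \<open>This permits passing to the extensional version of a solution, which membership in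
  \<open>BVr\<close> demands.\<close>

lemma regular_solution_cong:
  assumes y': "regular_solution Z T z0 u y'" and T: "0 < T" and eq: "\<And>t. t \<in> {0..T} \<Longrightarrow> y t = y' t"
  shows "regular_solution Z T z0 u y"
proof -
  have eq': "y t = y' t" if "0 \<le> t" "t \<le> T" for t using eq that by simp
  show ?thesis
    unfolding regular_solution_def sweep_def
  proof (intro conjI allI impI ballI)
    show "y 0 = u 0 - z0" using y' T eq'[of 0] by (simp add: regular_solution_def)
    show "u t - y t \<in> Z" if "t \<in> {0..T}" for t
      using y' that eq[of t] unfolding regular_solution_def sweep_def by metis
    show "(y t - y s) \<bullet> (z - (u t - y t)) \<le> (cumvar T u t - cumvar T u s) * (lft (cumvar T u) t - cumvar T u s)"
      if "0 \<le> s" "s < t" "t \<le> T" "z \<in> Z" for s t z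
      using y' that eq'[of s] eq'[of t] sweepD(2)[of Z T "cumvar T u" u y' s t z]
      unfolding regular_solution_def by simp
    fix s t assume st: "0 \<le> s" "s \<le> t" "t \<le> T"
    then have [simp]: "y s = y' s" "y t = y' t" using eq' by auto
    show "norm (y t - y s) \<le> cumvar T u t - cumvar T u s"
      "norm ((u t - y t) - (u s - y s)) \<le> cumvar T u t - cumvar T u s"
      "norm ((y t - (u t - y t)) - (y s - (u s - y s))) \<le> cumvar T u t - cumvar T u s"
      using y' st unfolding regular_solution_def by simp_all
  qed
qed

text \<open>The restricted catching-up limit is a play solution. By uniqueness the definite
  description in \<open>play\<close> denotes it, so \<open>play\<close> inherits the domination by
  \<open>V\<close>, which its definition does not mention.\<close>

lemma play_regular_solution:
  fixes Z :: "'a::{real_inner, banach} set"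
  assumes Z: "Z \<noteq> {}" "closed Z" "convex Z" and z0: "z0 \<in> Z" and u: "u \<in> BVr T" and T: "0 < T"
  shows "play T Z z0 u \<in> BVr T" "regular_solution Z T z0 u (play T Z z0 u)"
proof -
  obtain y' where y': "regular_solution Z T z0 u y'"
    using regular_solution_exists[OF Z z0 BVr_bounded_variation[OF u T] BVr_right_cont[OF u]] .
  define y where "y = restrict y' {0..T}"
  have y: "regular_solution Z T z0 u y"
    using y' T by (rule regular_solution_cong) (simp add: y_def)
  have "y \<in> BVr T"
    using y by (intro dominated_BVr[OF T BVr_control[OF u T]]) (auto simp: y_def regular_solution_def)
  then have sol: "is_play_solution T Z z0 u y"
    using y u T by (intro regular_solution_is_play_solution)
  have "play T Z z0 u = y"
    unfolding play_def using sol play_solution_unique[OF _ sol u T] by blast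
  then show "play T Z z0 u \<in> BVr T" "regular_solution Z T z0 u (play T Z z0 u)"
    using \<open>y \<in> BVr T\<close> y by auto
qed

section \<open>Orthogonality of the increments off the large jumps\<close>

locale regular = bounded_variation T u for T and u :: "real \<Rightarrow> 'a::real_inner" +
  fixes Z :: "'a set" and z0 :: 'a and y :: "real \<Rightarrow> 'a"
  assumes reg: "regular_solution Z T z0 u y" and ctrl: "control (cumvar T u)"
begin

definition x :: "real \<Rightarrow> 'a" where "x t = u t - y t"
definition w :: "real \<Rightarrow> 'a" where "w t = y t - x t"

lemma sweep: "sweep Z T V u y"
  and dom_y: "0 \<le> s \<Longrightarrow> s \<le> t \<Longrightarrow> t \<le> T \<Longrightarrow> norm (y t - y s) \<le> V t - V s"
  and dom_x: "0 \<le> s \<Longrightarrow> s \<le> t \<Longrightarrow> t \<le> T \<Longrightarrow> norm (x t - x s) \<le> V t - V s"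
  and dom_w: "0 \<le> s \<Longrightarrow> s \<le> t \<Longrightarrow> t \<le> T \<Longrightarrow> norm (w t - w s) \<le> V t - V s"
  using reg unfolding regular_solution_def x_def w_def by blast+

sublocale X: dominated T V x
  by unfold_locales (use T ctrl cumvar_eq_0 dom_x in auto)

sublocale Y: dominated T V y
  by unfold_locales (use T ctrl cumvar_eq_0 dom_y in auto)

abbreviation "atom \<equiv> \<lambda>q. V q - lft V q"

lemma atom_nonneg: "0 \<le> atom q"
  using lft_le[OF mono_cumvar, of q] by simp

text \<open>
  The inequality for \<open>dy(\<tau>)\<close> is tested with \<open>z = x(b)\<close>. If \<open>x\<close> and \<open>y\<close> are almost affine in \<open>V\<close>
  on the cell, this bounds \<open>\<langle>slope y, slope x\<rangle>\<close> times the \<open>dV \<times> dV\<close>-mass of the pairs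
  \<open>\<tau> < \<sigma>\<close> in the cell, which is half the square of its \<open>dV\<close>-mass up to the atoms.
\<close>

lemma cell_orthogonality:
  assumes Q: "fine_partition T V e Q" and ab: "a \<in> Q" "b \<in> Q" "a < b"
  shows "(Y.slope a b \<bullet> X.slope a b) * (V b - V a) \<le> 3 * e + csum Q a b (\<lambda>p q. atom q)
    + 2 * csum Q a b (\<lambda>p q. norm ((x q - x p) - (V q - V p) *\<^sub>R X.slope a b))
    + 2 * csum Q a b (\<lambda>p q. norm ((y q - y p) - (V q - V p) *\<^sub>R Y.slope a b))"
proof -
  have fin: "finite Q" "Q \<subseteq> {0..T}" using fineD[OF Q] by auto
  have ab': "0 \<le> a" "b \<le> T" "a \<le> b" using ab fin by auto
  have e: "0 \<le> e" using fineD(5)[OF Q, of a a] ab' by simp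
  define cx where "cx = X.slope a b"
  define cy where "cy = Y.slope a b"
  define \<kappa> where "\<kappa> = cy \<bullet> cx"
  define m where "m = V b - V a"
  define RX where "RX = csum Q a b (\<lambda>p q. norm ((x q - x p) - (V q - V p) *\<^sub>R cx))"
  define RY where "RY = csum Q a b (\<lambda>p q. norm ((y q - y p) - (V q - V p) *\<^sub>R cy))"
  define \<alpha> where "\<alpha> = csum Q a b (\<lambda>p q. atom q)"
  have cx: "norm cx \<le> 1" and cy: "norm cy \<le> 1"
    unfolding cx_def cy_def using ab' by (auto intro!: X.norm_slope Y.norm_slope)
  have nonneg: "0 \<le> m" "0 \<le> RX" "0 \<le> RY" "0 \<le> \<alpha>"
    unfolding m_def RX_def RY_def \<alpha>_def
    using X.V_mono[OF ab'(3)] fin ab by (auto intro!: csum_nonneg atom_nonneg)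
  have \<kappa>: "\<bar>\<kappa>\<bar> \<le> 1"
  proof -
    have "\<bar>\<kappa>\<bar> \<le> norm cy * norm cx" unfolding \<kappa>_def by (rule Cauchy_Schwarz_ineq2)
    also have "\<dots> \<le> 1 * 1" using cx cy by (intro mult_mono) auto
    finally show ?thesis by simp
  qed
  have upper: "csum Q a b (\<lambda>p q. (y q - y p) \<bullet> (x b - x q)) \<le> e * m"
  proof -
    have "csum Q a b (\<lambda>p q. (y q - y p) \<bullet> (x b - x q)) \<le> csum Q a b (\<lambda>p q. e * (V q - V p))"
    proof (rule csum_mono[OF fin(1) ab(1)])
      fix p q assume pq: "p \<in> Q" "q \<in> Q" "a \<le> p" "p < q" "q \<le> b" "Q \<inter> {p<..<q} = {}"
      have "x b \<in> Z" using sweepD(1)[OF sweep, of b] ab' by (simp add: x_def)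
      then have "(y q - y p) \<bullet> (x b - (u q - y q)) \<le> (V q - V p) * e"
        using pq ab' by (intro sweep_fine[OF sweep ctrl Q]) auto
      then show "(y q - y p) \<bullet> (x b - x q) \<le> e * (V q - V p)" by (simp add: x_def mult.commute)
    qed
    then show ?thesis using csum_telescope[OF fin(1) ab(1,2) ab'(3), of V] by (simp add: csum_cmult m_def)
  qed
  \<comment> \<open>Replacing both increments by multiples of the slopes costs \<open>RY\<close>,
    weighted by \<open>V b - V q \<le> m\<close>, and \<open>RX\<close>, weighted by the increments
    of \<open>V\<close> that dominate those of \<open>y\<close>.\<close>
  have lower: "\<kappa> * csum Q a b (\<lambda>p q. (V q - V p) * (V b - V q)) - m * RY - RX * m
      \<le> csum Q a b (\<lambda>p q. (y q - y p) \<bullet> (x b - x q))"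
  proof -
    have "csum Q a b (\<lambda>p q. \<kappa> * ((V q - V p) * (V b - V q))
        - m * norm ((y q - y p) - (V q - V p) *\<^sub>R cy) - RX * (V q - V p))
      \<le> csum Q a b (\<lambda>p q. (y q - y p) \<bullet> (x b - x q))"
    proof (rule csum_mono[OF fin(1) ab(1)])
      fix p q assume pq: "p \<in> Q" "q \<in> Q" "a \<le> p" "p < q" "q \<le> b"
      define r where "r = (y q - y p) - (V q - V p) *\<^sub>R cy"
      define \<rho> where "\<rho> = (x b - x q) - (V b - V q) *\<^sub>R cx"
      have rho: "norm \<rho> \<le> RX"
      proof -
        let ?g = "\<lambda>t. x t - V t *\<^sub>R cx"
        have "norm (?g b - ?g q) \<le> csum Q q b (\<lambda>p q. norm (?g q - ?g p))"
          using pq ab fin by (intro norm_diff_le_csum)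
        also have "\<dots> \<le> csum Q a q (\<lambda>p q. norm (?g q - ?g p)) + csum Q q b (\<lambda>p q. norm (?g q - ?g p))"
          using fin ab by (auto intro!: csum_nonneg)
        also have "\<dots> = csum Q a b (\<lambda>p q. norm (?g q - ?g p))"
          using pq by (intro csum_split[symmetric] fin) auto
        finally show ?thesis by (simp add: \<rho>_def RX_def algebra_simps)
      qed
      have Vb: "0 \<le> V b - V q" "V b - V q \<le> m" "0 \<le> V q - V p"
        using X.V_mono[of q b] X.V_mono[of a q] X.V_mono[of p q] pq by (auto simp: m_def)
      have "(y q - y p) \<bullet> (x b - x q) = \<kappa> * ((V q - V p) * (V b - V q)) + (V b - V q) * (r \<bullet> cx) + (y q - y p) \<bullet> \<rho>"
        by (simp add: r_def \<rho>_def \<kappa>_def inner_diff algebra_simps)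
      moreover have "- (m * norm r) \<le> (V b - V q) * (r \<bullet> cx)"
      proof -
        have "\<bar>(V b - V q) * (r \<bullet> cx)\<bar> \<le> m * norm r"
          unfolding abs_mult
        proof (rule mult_mono)
          show "\<bar>r \<bullet> cx\<bar> \<le> norm r"
            using Cauchy_Schwarz_ineq2[of r cx] mult_left_mono[OF cx, of "norm r"] by simp
        qed (use Vb nonneg in auto)
        then show ?thesis by linarith
      qed
      moreover have "- (RX * (V q - V p)) \<le> (y q - y p) \<bullet> \<rho>"
      proof -
        have "\<bar>(y q - y p) \<bullet> \<rho>\<bar> \<le> norm (y q - y p) * norm \<rho>" by (rule Cauchy_Schwarz_ineq2)
        also have "\<dots> \<le> (V q - V p) * RX"
          using pq ab' rho Vb by (intro mult_mono dom_y) auto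
        finally show ?thesis by (simp add: mult.commute abs_le_iff)
      qed
      ultimately show "\<kappa> * ((V q - V p) * (V b - V q)) - m * norm ((y q - y p) - (V q - V p) *\<^sub>R cy) - RX * (V q - V p)
        \<le> (y q - y p) \<bullet> (x b - x q)"
        unfolding r_def by linarith
    qed
    then show ?thesis
      using csum_telescope[OF fin(1) ab(1,2) ab'(3), of V] by (simp add: csum_diff csum_cmult m_def RY_def)
  qed
  \<comment> \<open>Twice the mass of the ordered pairs is the full square minus its diagonal: with
    \<open>A = V b - V q\<close> and \<open>B = V q - V p\<close> one has
    \<open>2 A B = (A + B)^2 - A^2 - B^2\<close>, and the difference of the first two squares
    telescopes.\<close>
  have pairs: "2 * csum Q a b (\<lambda>p q. (V q - V p) * (V b - V q)) = m\<^sup>2 - csum Q a b (\<lambda>p q. (V q - V p)\<^sup>2)"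
  proof -
    have "2 * csum Q a b (\<lambda>p q. (V q - V p) * (V b - V q)) =
      csum Q a b (\<lambda>p q. (- (V b - V q)\<^sup>2 - - (V b - V p)\<^sup>2) - (V q - V p)\<^sup>2)"
      unfolding csum_cmult[symmetric] by (simp add: power2_eq_square algebra_simps)
    then show ?thesis
      unfolding csum_diff[of _ _ _ "\<lambda>p q. (- (V b - V q)\<^sup>2 - - (V b - V p)\<^sup>2)"]
      using csum_telescope[OF fin(1) ab(1,2) ab'(3), of "\<lambda>t. - (V b - V t)\<^sup>2"] by (simp add: m_def)
  qed
  \<comment> \<open>The diagonal is small cell by cell: apart from the atom at its right end, a cell
    has \<open>dV\<close>-mass at most \<open>e\<close>.\<close>
  have squares: "csum Q a b (\<lambda>p q. (V q - V p)\<^sup>2) \<le> m * (e + \<alpha>)"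
  proof -
    have "csum Q a b (\<lambda>p q. (V q - V p)\<^sup>2) \<le> csum Q a b (\<lambda>p q. e * (V q - V p) + m * atom q)"
    proof (rule csum_mono[OF fin(1) ab(1)])
      fix p q assume pq: "p \<in> Q" "q \<in> Q" "a \<le> p" "p < q" "q \<le> b" "Q \<inter> {p<..<q} = {}"
      have le: "V q - V p \<le> e + atom q"
        using fine_lft[OF Q mono_cumvar, of p q] pq ab' by simp
      have m: "0 \<le> V q - V p" "V q - V p \<le> m"
        using X.V_mono[of q b] X.V_mono[of a p] X.V_mono[of p q] pq by (auto simp: m_def)
      have "(V q - V p)\<^sup>2 \<le> (V q - V p) * (e + atom q)"
        unfolding power2_eq_square using le m by (intro mult_left_mono) auto
      also have "\<dots> = e * (V q - V p) + (V q - V p) * atom q" by (simp add: algebra_simps)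
      also have "(V q - V p) * atom q \<le> m * atom q"
        using m atom_nonneg by (intro mult_right_mono) auto
      finally show "(V q - V p)\<^sup>2 \<le> e * (V q - V p) + m * atom q" by simp
    qed
    also have "\<dots> = e * m + m * \<alpha>"
      using csum_telescope[OF fin(1) ab(1,2) ab'(3), of V] by (simp add: csum_add csum_cmult m_def \<alpha>_def)
    finally show ?thesis by (simp add: algebra_simps)
  qed
  \<comment> \<open>Doubling \<open>upper\<close> and \<open>lower\<close> produces
    \<open>2 e\<close>, \<open>2 RX\<close> and \<open>2 RY\<close>; the diagonal adds another
    \<open>e\<close> and the atoms.\<close>
  have "m * (\<kappa> * m) \<le> m * (3 * e + \<alpha> + 2 * RX + 2 * RY)"
  proof -
    let ?s = "csum Q a b (\<lambda>p q. (V q - V p)\<^sup>2)"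
    have "0 \<le> ?s" using fin ab by (intro csum_nonneg) auto
    then have "\<kappa> * ?s \<le> ?s" using \<kappa> mult_right_mono[of \<kappa> 1 ?s] by simp
    then have "\<kappa> * ?s \<le> m * (e + \<alpha>)" using squares by simp
    moreover have "\<kappa> * (m\<^sup>2 - ?s) \<le> 2 * (e * m + m * RY + RX * m)"
    proof -
      have eq: "\<kappa> * (m\<^sup>2 - ?s) = 2 * (\<kappa> * csum Q a b (\<lambda>p q. (V q - V p) * (V b - V q)))"
        unfolding pairs[symmetric] by simp
      have "\<kappa> * csum Q a b (\<lambda>p q. (V q - V p) * (V b - V q)) \<le> e * m + m * RY + RX * m"
        using upper lower by linarith
      then show ?thesis unfolding eq by simp
    qed
    ultimately show ?thesis by (simp add: power2_eq_square algebra_simps)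
  qed
  then have "\<kappa> * m \<le> 3 * e + \<alpha> + 2 * RX + 2 * RY"
    using nonneg e by (cases "m = 0") (auto simp: mult_le_cancel_left)
  then show ?thesis by (simp add: \<kappa>_def m_def \<alpha>_def RX_def RY_def cx_def cy_def)
qed

text \<open>The identity \<open>|\<Delta>u|^2 = |\<Delta>w|^2 + 4 <\<Delta>y, \<Delta>x>\<close> and
  subadditivity of the square root bound the loss of length. The result is a product of two roots,
  ready for Cauchy-Schwarz when summed over cells.\<close>

lemma increment_defect:
  assumes pq: "0 \<le> p" "p \<le> q" "q \<le> T" and K: "(Y.slope p q \<bullet> X.slope p q) * (V q - V p) \<le> K" "0 \<le> K"
  shows "norm (u q - u p) \<le> norm (w q - w p) + 2 * (sqrt (V q - V p) * sqrt K)"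
proof -
  have m: "0 \<le> V q - V p" using X.V_mono[OF pq(2)] by simp
  have "(y q - y p) \<bullet> (x q - x p) = (V q - V p) * ((Y.slope p q \<bullet> X.slope p q) * (V q - V p))"
    using X.slope_increment[OF pq] Y.slope_increment[OF pq] by (metis inner_scaleR_left inner_scaleR_right mult.commute)
  also have "\<dots> \<le> (V q - V p) * K" using K m by (intro mult_left_mono)
  finally have s: "(y q - y p) \<bullet> (x q - x p) \<le> (sqrt (V q - V p) * sqrt K)\<^sup>2"
    using m K by (simp add: power_mult_distrib)
  have "(norm (u q - u p))\<^sup>2 = (norm (w q - w p))\<^sup>2 + 4 * ((y q - y p) \<bullet> (x q - x p))"
    unfolding w_def x_def power2_norm_eq_inner by (simp add: inner_diff inner_commute algebra_simps)
  also have "\<dots> \<le> (norm (w q - w p))\<^sup>2 + (2 * (sqrt (V q - V p) * sqrt K))\<^sup>2"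
    using s by (simp add: power_mult_distrib)
  also have "\<dots> \<le> (norm (w q - w p) + 2 * (sqrt (V q - V p) * sqrt K))\<^sup>2"
    using m K by (simp add: power2_sum)
  finally show ?thesis by (rule power2_le_imp_le) (use m K in simp)
qed

lemma atoms_near_max:
  assumes "0 < e"
  obtains P where "is_part T P"
    "\<And>R Q. is_part T R \<Longrightarrow> P \<subseteq> R \<Longrightarrow> is_part T Q \<Longrightarrow> csum Q 0 T (\<lambda>p q. atom q) \<le> csum R 0 T (\<lambda>p q. atom q) + e"
proof (rule near_maximal_part[of T "\<lambda>Q. csum Q 0 T (\<lambda>p q. atom q)" "V T" e])
  fix P assume "is_part T P"
  then have P: "finite P" "0 \<in> P" "T \<in> P" by (auto simp: is_part_def)
  have "csum P 0 T (\<lambda>p q. atom q) \<le> csum P 0 T (\<lambda>p q. V q - V p)"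
    using lft_ge[OF mono_cumvar] by (intro csum_mono P) auto
  then show "csum P 0 T (\<lambda>p q. atom q) \<le> V T"
    using csum_telescope[OF P, of V] T cumvar_nonneg[of 0] by simp
next
  fix P Q assume "is_part T P" "is_part T Q" "P \<subseteq> Q"
  then show "csum P 0 T (\<lambda>p q. atom q) \<le> csum Q 0 T (\<lambda>p q. atom q)"
    unfolding csum_def by (intro sum_mono2) (auto simp: is_part_def lft_le[OF mono_cumvar])
qed (use assms T in auto)

text \<open>
  \<open>D\<close> is chosen near-maximal for the energies of \<open>x\<close> and \<open>y\<close>, the variation of \<open>u\<close> and the total mass of
  the atoms; then the cells of a finer \<open>P\<close> whose right end is not in \<open>D\<close> contain little atomic mass.
\<close>

lemma near_optimal_partition_aux:
  assumes \<eta>: "0 < \<eta>"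
  obtains P D where "is_part T P" "D \<subseteq> P"
    "(\<Sum>q\<in>P \<inter> {0<..T} - D. (V q - V (prv P q)) - norm (w q - w (prv P q)))
      \<le> \<eta> + 2 * sqrt (V T * (4 * \<eta> + 4 * sqrt (V T * \<eta>)))"
    "(\<Sum>q\<in>P \<inter> {0<..T} \<inter> D. lft V q - V (prv P q)) \<le> \<eta>"
proof -
  have VT: "0 \<le> V T" by (rule cumvar_nonneg)
  obtain PX where PX: "is_part T PX" "\<And>R Q. is_part T R \<Longrightarrow> PX \<subseteq> R \<Longrightarrow> is_part T Q \<Longrightarrow> X.energy Q \<le> X.energy R + \<eta>"
    using X.energy_near_max[OF \<eta>] by blast
  obtain PY where PY: "is_part T PY" "\<And>R Q. is_part T R \<Longrightarrow> PY \<subseteq> R \<Longrightarrow> is_part T Q \<Longrightarrow> Y.energy Q \<le> Y.energy R + \<eta>"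
    using Y.energy_near_max[OF \<eta>] by blast
  obtain PA where PA: "is_part T PA"
    "\<And>R Q. is_part T R \<Longrightarrow> PA \<subseteq> R \<Longrightarrow> is_part T Q \<Longrightarrow> csum Q 0 T (\<lambda>p q. atom q) \<le> csum R 0 T (\<lambda>p q. atom q) + \<eta>"
    using atoms_near_max[OF \<eta>] by blast
  obtain PU where PU: "finite PU" "PU \<subseteq> {0..T}" "0 \<in> PU" "T \<in> PU"
    and U: "V T - V 0 - \<eta> < csum PU 0 T (\<lambda>p q. norm (u q - u p))"
    using csum_near_cumvar[of 0 T, OF _ _ _ \<eta>] T by auto
  define D where "D = PX \<union> PY \<union> PA \<union> PU"
  have D: "is_part T D" using PX(1) PY(1) PA(1) PU unfolding D_def is_part_def by auto
  have N: "0 < real (card D) + 1" by simp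
  \<comment> \<open>At most \<open>card D\<close> cells of \<open>P\<close> end in \<open>D\<close>.
    This tolerance makes the masses of their interiors sum to at most \<eta>.\<close>
  obtain F where F: "fine_partition T V (\<eta> / (real (card D) + 1)) F"
    using fine_exists[OF ctrl, of T "\<eta> / (real (card D) + 1)"] T \<eta> by auto
  define P where "P = D \<union> F"
  have P: "is_part T P" unfolding P_def by (intro is_part_Un D fine_is_part[OF F])
  have Pfin: "finite P" "0 \<in> P" "T \<in> P" "P \<subseteq> {0..T}" using P by (auto simp: is_part_def)
  have Pfine: "fine_partition T V (\<eta> / (real (card D) + 1)) P"
    by (rule fine_superset[OF F]) (use Pfin in \<open>auto simp: P_def\<close>)
  \<comment> \<open>A second refinement \<open>Q\<close>, inside which
    \<open>cell_orthogonality\<close> is applied to each cell of \<open>P\<close>. Its tolerance is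
    small enough to be paid once for every cell of \<open>P\<close>.\<close>
  obtain F' where F': "fine_partition T V (\<eta> / (real (card P) + 1)) F'"
    using fine_exists[OF ctrl, of T "\<eta> / (real (card P) + 1)"] T \<eta> by auto
  define e where "e = \<eta> / (real (card P) + 1)"
  define Q where "Q = P \<union> F'"
  have Q: "is_part T Q" unfolding Q_def by (intro is_part_Un P fine_is_part[OF F'])
  have Qfin: "finite Q" "0 \<in> Q" "T \<in> Q" "Q \<subseteq> {0..T}" using Q by (auto simp: is_part_def)
  have Qfine: "fine_partition T V e Q"
    unfolding e_def by (rule fine_superset[OF F']) (use Qfin in \<open>auto simp: Q_def\<close>)
  have PQ: "P \<subseteq> Q" by (auto simp: Q_def)
  have e: "0 < e" "real (card P) * e \<le> \<eta>" using \<eta> by (auto simp: e_def field_simps)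
  define good where "good = P \<inter> {0<..T} - D"
  have good: "finite good" "good \<subseteq> P \<inter> {0<..T}" using Pfin by (auto simp: good_def)
  define \<alpha> where "\<alpha> p q = csum Q p q (\<lambda>r s. atom s)" for p q
  define RX where "RX p q = csum Q p q (\<lambda>r s. norm ((x s - x r) - (V s - V r) *\<^sub>R X.slope p q))" for p q
  define RY where "RY p q = csum Q p q (\<lambda>r s. norm ((y s - y r) - (V s - V r) *\<^sub>R Y.slope p q))" for p q
  define K where "K p q = 3 * e + \<alpha> p q + 2 * RX p q + 2 * RY p q" for p q
  have cellP: "prv P q \<in> P" "0 \<le> prv P q" "prv P q < q" "q \<le> T" "q \<in> P" if "q \<in> P \<inter> {0<..T}" for q
    using prv[OF Pfin(1,2), of q] that by auto
  have nonneg: "0 \<le> \<alpha> (prv P q) q" "0 \<le> RX (prv P q) q" "0 \<le> RY (prv P q) q" if "q \<in> P \<inter> {0<..T}" for q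
    unfolding \<alpha>_def RX_def RY_def using cellP[OF that] PQ Qfin by (auto intro!: csum_nonneg atom_nonneg)
  have sum_good_le: "(\<Sum>q\<in>good. H (prv P q) q) \<le> csum P 0 T H"
    if "\<And>q. q \<in> P \<inter> {0<..T} \<Longrightarrow> 0 \<le> H (prv P q) q" for H :: "real \<Rightarrow> real \<Rightarrow> real"
    unfolding csum_def using good that Pfin by (intro sum_mono2) auto
  have X_energy: "X.energy Q - X.energy P \<le> \<eta>" and Y_energy: "Y.energy Q - Y.energy P \<le> \<eta>"
  proof -
    have "PX \<subseteq> P" "PY \<subseteq> P" by (auto simp: P_def D_def)
    then show "X.energy Q - X.energy P \<le> \<eta>" "Y.energy Q - Y.energy P \<le> \<eta>"
      using PX(2)[OF P _ Q] PY(2)[OF P _ Q] by auto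
  qed
  have deviation: "(\<Sum>q\<in>good. R (prv P q) q) \<le> sqrt (V T * \<eta>)"
    if dm: "dominated T V g" and en: "dominated.energy T V g Q - dominated.energy T V g P \<le> \<eta>"
      and R: "\<And>p q. R p q = csum Q p q (\<lambda>r s. norm ((g s - g r) - (V s - V r) *\<^sub>R dominated.slope V g p q))"
    for g :: "real \<Rightarrow> 'a" and R :: "real \<Rightarrow> real \<Rightarrow> real"
  proof -
    interpret G: dominated T V g by (rule dm)
    have "(\<Sum>q\<in>good. R (prv P q) q) \<le> csum P 0 T R"
    proof (rule sum_good_le[of R])
      fix q assume "q \<in> P \<inter> {0<..T}"
      from cellP[OF this] show "0 \<le> R (prv P q) q"
        unfolding R using PQ Qfin by (intro csum_nonneg) auto
    qed
    also have "\<dots> = csum P 0 T (\<lambda>p q. csum Q p q (\<lambda>r s. norm ((g s - g r) - (V s - V r) *\<^sub>R step P G.slope s)))"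
    proof (rule csum_cong[OF Pfin(1,2)])
      fix p q assume pq: "p \<in> P" "q \<in> P" "p < q" "P \<inter> {p<..<q} = {}"
      show "R p q = csum Q p q (\<lambda>r s. norm ((g s - g r) - (V s - V r) *\<^sub>R step P G.slope s))"
        unfolding R
      proof (rule csum_cong[OF Qfin(1)])
        fix r s assume rs: "p \<le> r" "r < s" "s \<le> q"
        then have "step P G.slope s = G.slope p q" by (intro G.step_slope[OF P pq]) auto
        then show "norm ((g s - g r) - (V s - V r) *\<^sub>R G.slope p q) =
          norm ((g s - g r) - (V s - V r) *\<^sub>R step P G.slope s)" by simp
      qed (use pq PQ in auto)
    qed
    also have "\<dots> = csum Q 0 T (\<lambda>r s. norm ((g s - g r) - (V s - V r) *\<^sub>R step P G.slope s))"
      using T by (intro csum_nested Qfin PQ Pfin) auto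
    also have "\<dots> \<le> sqrt (V T * (G.energy Q - G.energy P))" by (rule G.deviation_le[OF P Q PQ])
    also have "\<dots> \<le> sqrt (V T * \<eta>)" using en VT by (intro real_sqrt_le_mono mult_left_mono)
    finally show ?thesis .
  qed
  have sumX: "(\<Sum>q\<in>good. RX (prv P q) q) \<le> sqrt (V T * \<eta>)"
    by (rule deviation[OF X.dominated_axioms X_energy]) (simp add: RX_def)
  have sumY: "(\<Sum>q\<in>good. RY (prv P q) q) \<le> sqrt (V T * \<eta>)"
    by (rule deviation[OF Y.dominated_axioms Y_energy]) (simp add: RY_def)
  \<comment> \<open>The cells of \<open>P\<close> that end in \<open>D\<close> contain the atoms at
    the points of \<open>D\<close>, whose sum is already maximal up to \<eta>. So at most \<eta> is
    left for the good cells.\<close>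
  have sumA: "(\<Sum>q\<in>good. \<alpha> (prv P q) q) \<le> \<eta>"
  proof -
    have split: "csum Q 0 T (\<lambda>p q. atom q) = (\<Sum>q\<in>good. \<alpha> (prv P q) q) + (\<Sum>q\<in>D \<inter> {0<..T}. \<alpha> (prv P q) q)"
    proof -
      have "csum Q 0 T (\<lambda>p q. atom q) = csum P 0 T \<alpha>"
        unfolding \<alpha>_def using T by (intro csum_nested[symmetric] Qfin PQ Pfin) auto
      also have "\<dots> = (\<Sum>q\<in>good. \<alpha> (prv P q) q) + (\<Sum>q\<in>D \<inter> {0<..T}. \<alpha> (prv P q) q)"
      proof -
        have "P \<inter> {0<..T} = good \<union> D \<inter> {0<..T}" "good \<inter> (D \<inter> {0<..T}) = {}" by (auto simp: good_def P_def)
        then show ?thesis unfolding csum_def using D good by (simp add: sum.union_disjoint is_part_def)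
      qed
      finally show ?thesis .
    qed
    have "csum D 0 T (\<lambda>p q. atom q) \<le> (\<Sum>q\<in>D \<inter> {0<..T}. \<alpha> (prv P q) q)"
      unfolding csum_def
    proof (rule sum_mono)
      fix q assume "q \<in> D \<inter> {0<..T}"
      then have q: "q \<in> P \<inter> {0<..T}" by (auto simp: P_def)
      have "(\<Sum>s\<in>{q}. atom s) \<le> (\<Sum>s\<in>Q \<inter> {prv P q<..q}. atom s)"
        using cellP[OF q] PQ Qfin atom_nonneg by (intro sum_mono2) auto
      then show "atom q \<le> \<alpha> (prv P q) q" by (simp add: \<alpha>_def csum_def)
    qed
    then have "(\<Sum>q\<in>good. \<alpha> (prv P q) q) \<le> csum Q 0 T (\<lambda>p q. atom q) - csum D 0 T (\<lambda>p q. atom q)"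
      unfolding split by linarith
    also have "\<dots> \<le> \<eta>"
    proof -
      have "PA \<subseteq> D" by (auto simp: D_def)
      from PA(2)[OF D this Q] show ?thesis by simp
    qed
    finally show ?thesis .
  qed
  have "real (card good) * e \<le> real (card P) * e"
    using Pfin good e by (intro mult_right_mono) (auto intro!: card_mono)
  then have sume: "real (card good) * e \<le> \<eta>" using e(2) by linarith
  \<comment> \<open>Three \<eta> come from the term \<open>3 * e\<close> and one from the atoms; the
    deviations of \<open>x\<close> and \<open>y\<close> enter with factor \<open>2\<close>
    each.\<close>
  have sumK: "(\<Sum>q\<in>good. K (prv P q) q) \<le> 4 * \<eta> + 4 * sqrt (V T * \<eta>)"
    using sumX sumY sumA sume by (simp add: K_def sum.distrib flip: sum_distrib_left)
  have K_nonneg: "0 \<le> K (prv P q) q" if "q \<in> good" for q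
  proof -
    have "q \<in> P \<inter> {0<..T}" using that good by blast
    from nonneg[OF this] show ?thesis using e by (simp add: K_def)
  qed
  have defect: "norm (u q - u (prv P q)) - norm (w q - w (prv P q)) \<le>
      2 * (sqrt (V q - V (prv P q)) * sqrt (K (prv P q) q))" if q: "q \<in> good" for q
  proof -
    have c: "q \<in> P \<inter> {0<..T}" using q good by auto
    have K: "(Y.slope (prv P q) q \<bullet> X.slope (prv P q) q) * (V q - V (prv P q)) \<le> K (prv P q) q"
      unfolding K_def \<alpha>_def RX_def RY_def using cellP[OF c] PQ by (intro cell_orthogonality[OF Qfine]) auto
    show ?thesis using increment_defect[OF cellP(2)[OF c] less_imp_le[OF cellP(3)[OF c]] cellP(4)[OF c] K K_nonneg[OF q]] by simp
  qed
  have V_cell: "V (prv P q) \<le> V q" if "q \<in> P \<inter> {0<..T}" for q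
    using cellP(3)[OF that] by (intro X.V_mono) simp
  have sumV: "(\<Sum>q\<in>good. V q - V (prv P q)) \<le> V T"
  proof -
    have "(\<Sum>q\<in>good. V q - V (prv P q)) \<le> csum P 0 T (\<lambda>p q. V q - V p)"
      by (rule sum_good_le[of "\<lambda>p q. V q - V p"]) (use V_cell in simp)
    also have "\<dots> = V T" using csum_telescope[OF Pfin(1-3), of V] T cumvar_eq_0[of 0] by simp
    finally show ?thesis .
  qed
  have cs: "(\<Sum>q\<in>good. sqrt (V q - V (prv P q)) * sqrt (K (prv P q) q)) \<le> sqrt (V T * (4 * \<eta> + 4 * sqrt (V T * \<eta>)))"
  proof (rule real_le_rsqrt)
    have "(\<Sum>q\<in>good. sqrt (V q - V (prv P q)) * sqrt (K (prv P q) q))\<^sup>2 \<le>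
      (\<Sum>q\<in>good. (sqrt (V q - V (prv P q)))\<^sup>2) * (\<Sum>q\<in>good. (sqrt (K (prv P q) q))\<^sup>2)"
      by (rule Cauchy_Schwarz_ineq_sum)
    also have "(\<Sum>q\<in>good. (sqrt (V q - V (prv P q)))\<^sup>2) = (\<Sum>q\<in>good. V q - V (prv P q))"
    proof (rule sum.cong)
      fix q assume "q \<in> good"
      then have "q \<in> P \<inter> {0<..T}" using good by blast
      from V_cell[OF this] show "(sqrt (V q - V (prv P q)))\<^sup>2 = V q - V (prv P q)" by simp
    qed simp
    also have "(\<Sum>q\<in>good. (sqrt (K (prv P q) q))\<^sup>2) = (\<Sum>q\<in>good. K (prv P q) q)"
      using K_nonneg by (intro sum.cong) auto
    also have "(\<Sum>q\<in>good. V q - V (prv P q)) * (\<Sum>q\<in>good. K (prv P q) q) \<le> V T * (4 * \<eta> + 4 * sqrt (V T * \<eta>))"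
      using sumV sumK VT K_nonneg by (intro mult_mono) (auto intro!: sum_nonneg)
    finally show "(\<Sum>q\<in>good. sqrt (V q - V (prv P q)) * sqrt (K (prv P q) q))\<^sup>2 \<le> V T * (4 * \<eta> + 4 * sqrt (V T * \<eta>))" .
  qed
  \<comment> \<open>The defect \<open>\<Delta>V - |\<Delta>u|\<close> is nonnegative on every cell,
    and its sum over all cells is at most \<eta> because \<open>P\<close> refines the nearly optimal
    \<open>PU\<close>.\<close>
  have first: "(\<Sum>q\<in>good. (V q - V (prv P q)) - norm (u q - u (prv P q))) \<le> \<eta>"
  proof -
    have "(\<Sum>q\<in>good. (V q - V (prv P q)) - norm (u q - u (prv P q))) \<le> csum P 0 T (\<lambda>p q. (V q - V p) - norm (u q - u p))"
    proof (rule sum_good_le)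
      fix q assume "q \<in> P \<inter> {0<..T}"
      from cellP[OF this] have "norm (u q - u (prv P q)) \<le> V q - V (prv P q)"
        by (intro norm_diff_le_cumvar) auto
      then show "0 \<le> V q - V (prv P q) - norm (u q - u (prv P q))" by simp
    qed
    also have "\<dots> = V T - V 0 - csum P 0 T (\<lambda>p q. norm (u q - u p))"
      using csum_telescope[OF Pfin(1-3), of V] T by (simp add: csum_diff)
    finally have le: "(\<Sum>q\<in>good. (V q - V (prv P q)) - norm (u q - u (prv P q))) \<le>
      V T - V 0 - csum P 0 T (\<lambda>p q. norm (u q - u p))" .
    have "csum PU 0 T (\<lambda>p q. norm (u q - u p)) \<le> csum P 0 T (\<lambda>p q. norm (u q - u p))"
    proof -
      have sub: "PU \<subseteq> P" by (auto simp: P_def D_def)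
      have "csum PU 0 T (\<lambda>p q. norm (u q - u p)) \<le> csum PU 0 T (\<lambda>p q. csum P p q (\<lambda>p q. norm (u q - u p)))"
        using PU sub Pfin by (intro csum_mono norm_diff_le_csum) auto
      also have "\<dots> = csum P 0 T (\<lambda>p q. norm (u q - u p))"
        using T by (intro csum_nested Pfin sub PU) auto
      finally show ?thesis .
    qed
    then show ?thesis using U le by linarith
  qed
  show thesis
  proof (rule that[OF P])
    show "D \<subseteq> P" by (auto simp: P_def)
    have split: "(\<Sum>q\<in>good. (V q - V (prv P q)) - norm (w q - w (prv P q))) =
      (\<Sum>q\<in>good. (V q - V (prv P q)) - norm (u q - u (prv P q))) +
      (\<Sum>q\<in>good. norm (u q - u (prv P q)) - norm (w q - w (prv P q)))"
      unfolding sum.distrib[symmetric] by (rule sum.cong) auto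
    have second: "(\<Sum>q\<in>good. norm (u q - u (prv P q)) - norm (w q - w (prv P q))) \<le>
      2 * (\<Sum>q\<in>good. sqrt (V q - V (prv P q)) * sqrt (K (prv P q) q))"
      unfolding sum_distrib_left by (rule sum_mono) (rule defect)
    show "(\<Sum>q\<in>P \<inter> {0<..T} - D. (V q - V (prv P q)) - norm (w q - w (prv P q)))
      \<le> \<eta> + 2 * sqrt (V T * (4 * \<eta> + 4 * sqrt (V T * \<eta>)))"
      unfolding good_def[symmetric] split using first second cs by linarith
    have "(\<Sum>q\<in>P \<inter> {0<..T} \<inter> D. lft V q - V (prv P q)) \<le> (\<Sum>q\<in>P \<inter> {0<..T} \<inter> D. \<eta> / (real (card D) + 1))"
    proof (rule sum_mono)
      fix q assume "q \<in> P \<inter> {0<..T} \<inter> D"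
      then have q: "q \<in> P \<inter> {0<..T}" "0 < q" by auto
      show "lft V q - V (prv P q) \<le> \<eta> / (real (card D) + 1)"
        using cellP[OF q(1)] prv_gap[OF Pfin(1,2) q(2)] by (intro fine_lft[OF Pfine mono_cumvar])
    qed
    also have "\<dots> = real (card (P \<inter> {0<..T} \<inter> D)) * (\<eta> / (real (card D) + 1))" by simp
    also have "\<dots> \<le> (real (card D) + 1) * (\<eta> / (real (card D) + 1))"
    proof (rule mult_right_mono)
      have "card (P \<inter> {0<..T} \<inter> D) \<le> card D" using D by (intro card_mono) (auto simp: is_part_def)
      then show "real (card (P \<inter> {0<..T} \<inter> D)) \<le> real (card D) + 1" by linarith
    qed (use \<eta> in simp)
    also have "\<dots> = \<eta>" by simp
    finally show "(\<Sum>q\<in>P \<inter> {0<..T} \<inter> D. lft V q - V (prv P q)) \<le> \<eta>" .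
  qed
qed

lemma near_optimal_partition:
  assumes "0 < e"
  obtains P D where "is_part T P" "D \<subseteq> P"
    "(\<Sum>q\<in>P \<inter> {0<..T} - D. (V q - V (prv P q)) - norm (w q - w (prv P q))) \<le> e"
    "(\<Sum>q\<in>P \<inter> {0<..T} \<inter> D. lft V q - V (prv P q)) \<le> e"
proof -
  have "((\<lambda>\<eta>. \<eta> + 2 * sqrt (V T * (4 * \<eta> + 4 * sqrt (V T * \<eta>)))) \<longlongrightarrow>
      0 + 2 * sqrt (V T * (4 * 0 + 4 * sqrt (V T * 0)))) (at_right 0)"
    by (intro tendsto_intros)
  then have "((\<lambda>\<eta>. \<eta> + 2 * sqrt (V T * (4 * \<eta> + 4 * sqrt (V T * \<eta>)))) \<longlongrightarrow> 0) (at_right 0)" by simp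
  then have "eventually (\<lambda>\<eta>. \<eta> + 2 * sqrt (V T * (4 * \<eta> + 4 * sqrt (V T * \<eta>))) < e) (at_right 0)"
    using assms by (intro order_tendstoD(2))
  moreover have "eventually (\<lambda>\<eta>. 0 < \<eta> \<and> \<eta> < e) (at_right (0::real))"
    using assms by (intro eventually_at_rightI[of 0 e]) auto
  ultimately have "eventually (\<lambda>\<eta>. 0 < \<eta> \<and> \<eta> < e \<and> \<eta> + 2 * sqrt (V T * (4 * \<eta> + 4 * sqrt (V T * \<eta>))) < e) (at_right 0)"
    by eventually_elim simp
  then obtain \<eta> where \<eta>: "0 < \<eta>" "\<eta> < e" "\<eta> + 2 * sqrt (V T * (4 * \<eta> + 4 * sqrt (V T * \<eta>))) < e"
    using eventually_happens'[OF trivial_limit_at_right_real] by blast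
  obtain P D where P: "is_part T P" "D \<subseteq> P"
    "(\<Sum>q\<in>P \<inter> {0<..T} - D. (V q - V (prv P q)) - norm (w q - w (prv P q)))
      \<le> \<eta> + 2 * sqrt (V T * (4 * \<eta> + 4 * sqrt (V T * \<eta>)))"
    "(\<Sum>q\<in>P \<inter> {0<..T} \<inter> D. lft V q - V (prv P q)) \<le> \<eta>"
    using near_optimal_partition_aux[OF \<eta>(1)] by blast
  show thesis
    by (rule that[OF P(1,2) order_trans[OF P(3)] order_trans[OF P(4)]]) (use \<eta> in linarith)+
qed

end

section \<open>Continuity of the play operator\<close>

text \<open>Strict convexity in quantitative form: a vector of length at most \<open>m + d\<close>
  whose component along \<open>e\<close> is nearly \<open>m + d\<close> lies close to
  \<open>m e\<close>. With \<open>t\<close> for that component, the bound rests on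
  \<open>(m + d)^2 - 2 m t + m^2 = 2 m (m + d - t) + d^2\<close>.\<close>

lemma deviation_from_direction:
  fixes a e :: "'a::real_inner"
  assumes a: "norm a \<le> m + d" and e: "norm e \<le> 1" and m: "0 \<le> m" "0 \<le> d"
  shows "0 \<le> m + d - a \<bullet> e" and "norm (a - m *\<^sub>R e) \<le> sqrt (2 * m) * sqrt (m + d - a \<bullet> e) + d"
proof -
  have "a \<bullet> e \<le> norm a * norm e" by (rule norm_cauchy_schwarz)
  also have "\<dots> \<le> norm a * 1" using e by (intro mult_left_mono) auto
  finally show t: "0 \<le> m + d - a \<bullet> e" using a by simp
  have "(norm (a - m *\<^sub>R e))\<^sup>2 = (norm a)\<^sup>2 - 2 * m * (a \<bullet> e) + m * m * (norm e)\<^sup>2"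
    unfolding power2_norm_eq_inner by (simp add: inner_diff inner_commute algebra_simps)
  also have "\<dots> \<le> (m + d)\<^sup>2 - 2 * m * (a \<bullet> e) + m * m * 1"
    using a e m by (intro add_mono diff_mono mult_left_mono power_mono) (auto simp: power_le_one)
  also have "\<dots> = (2 * m) * (m + d - a \<bullet> e) + d\<^sup>2"
    by (simp add: power2_eq_square algebra_simps)
  also have "\<dots> = (sqrt (2 * m) * sqrt (m + d - a \<bullet> e))\<^sup>2 + d\<^sup>2"
    using t m by (simp add: power_mult_distrib)
  also have "\<dots> \<le> (sqrt (2 * m) * sqrt (m + d - a \<bullet> e) + d)\<^sup>2"
    using t m by (simp add: power2_sum)
  finally show "norm (a - m *\<^sub>R e) \<le> sqrt (2 * m) * sqrt (m + d - a \<bullet> e) + d"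
    by (rule power2_le_imp_le) (use t m in simp)
qed

lemma sum_sqrt_le:
  fixes f g :: "'b \<Rightarrow> real"
  assumes "\<And>i. i \<in> I \<Longrightarrow> 0 \<le> f i" "\<And>i. i \<in> I \<Longrightarrow> 0 \<le> g i" "sum f I \<le> A" "sum g I \<le> B"
  shows "(\<Sum>i\<in>I. sqrt (f i) * sqrt (g i)) \<le> sqrt A * sqrt B"
proof -
  have "(\<Sum>i\<in>I. sqrt (f i) * sqrt (g i)) \<le> sqrt ((\<Sum>i\<in>I. (sqrt (f i))\<^sup>2) * (\<Sum>i\<in>I. (sqrt (g i))\<^sup>2))"
    by (rule real_le_rsqrt) (rule Cauchy_Schwarz_ineq_sum)
  also have "\<dots> = sqrt (sum f I * sum g I)" using assms by simp
  also have "\<dots> \<le> sqrt (A * B)"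
  proof (intro real_sqrt_le_mono mult_mono assms)
    show "0 \<le> A" using sum_nonneg[of I f] assms by fastforce
    show "0 \<le> sum g I" using assms by (simp add: sum_nonneg)
  qed
  finally show ?thesis by (simp add: real_sqrt_mult)
qed

text \<open>Because a single direction \<open>e\<close> serves all subcells, the deficits
  \<open>\<Delta>V + \<Delta>H - <\<Delta>g, e>\<close> are nonnegative and telescope. After
  Cauchy-Schwarz only the values at \<open>a\<close> and \<open>b\<close> enter, whatever the points
  of \<open>Q\<close> in between.\<close>

lemma cell_deviation:
  fixes g :: "real \<Rightarrow> 'a::real_inner"
  assumes Q: "finite Q" "a \<in> Q" "b \<in> Q" "a \<le> b"
    and mono: "mono V" "mono H" and e: "norm e \<le> 1"
    and g: "\<And>s t. s \<in> Q \<Longrightarrow> t \<in> Q \<Longrightarrow> s \<le> t \<Longrightarrow> norm (g t - g s) \<le> (V t - V s) + (H t - H s)"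
  shows "csum Q a b (\<lambda>r s. norm ((g s - g r) - (V s - V r) *\<^sub>R e)) \<le>
    sqrt (2 * (V b - V a)) * sqrt ((V b - V a) + (H b - H a) - (g b - g a) \<bullet> e) + (H b - H a)"
proof -
  have V: "0 \<le> V s - V r" and H: "0 \<le> H s - H r" if "r \<le> s" for r s
    using monoD[OF mono(1) that] monoD[OF mono(2) that] by auto
  have cell: "prv Q q \<in> Q" "prv Q q \<le> q" "q \<in> Q" if "q \<in> Q \<inter> {a<..b}" for q
    using prv[OF Q(1,2), of q] that by auto
  let ?t = "\<lambda>r s. (V s - V r) + (H s - H r) - (g s - g r) \<bullet> e"
  have "csum Q a b (\<lambda>r s. norm ((g s - g r) - (V s - V r) *\<^sub>R e)) \<le>
      csum Q a b (\<lambda>r s. sqrt (2 * (V s - V r)) * sqrt (?t r s) + (H s - H r))"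
    using V H g e by (intro csum_mono Q deviation_from_direction) auto
  also have "\<dots> = csum Q a b (\<lambda>r s. sqrt (2 * (V s - V r)) * sqrt (?t r s)) + (H b - H a)"
    using Q by (simp add: csum_add csum_telescope)
  also have "csum Q a b (\<lambda>r s. sqrt (2 * (V s - V r)) * sqrt (?t r s)) \<le> sqrt (2 * (V b - V a)) * sqrt (?t a b)"
    unfolding csum_def
  proof (rule sum_sqrt_le)
    fix q assume q: "q \<in> Q \<inter> {a<..b}"
    show "0 \<le> 2 * (V q - V (prv Q q))" using V[OF cell(2)[OF q]] by simp
    show "0 \<le> ?t (prv Q q) q"
      using cell[OF q] V H g e by (intro deviation_from_direction(1)) auto
  next
    have "csum Q a b (\<lambda>r s. 2 * (V s - V r)) = 2 * (V b - V a)"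
      using Q by (simp add: csum_cmult csum_telescope)
    then show "(\<Sum>q\<in>Q \<inter> {a<..b}. 2 * (V q - V (prv Q q))) \<le> 2 * (V b - V a)" by (simp add: csum_def)
    have "csum Q a b ?t = ?t a b"
      unfolding csum_diff[of Q a b "\<lambda>r s. (V s - V r) + (H s - H r)"] csum_add csum_inner_left
      using Q by (simp add: csum_telescope)
    then show "(\<Sum>q\<in>Q \<inter> {a<..b}. ?t (prv Q q) q) \<le> ?t a b" by (simp add: csum_def)
  qed
  finally show ?thesis by simp
qed

text \<open>Each cell of \<open>P\<close> has its own direction, but the bound is the same for every
  refinement \<open>Q\<close>: alignment of the increments on the coarse cells controls the
  variation inside them.\<close>

lemma total_deviation:
  fixes g :: "real \<Rightarrow> 'a::real_inner" and e :: "real \<Rightarrow> 'a"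
  assumes P: "is_part T P" and Q: "is_part T Q" "P \<subseteq> Q" and T: "0 < T" and I: "I \<subseteq> P \<inter> {0<..T}"
    and mono: "mono V" "mono H" and zero: "V 0 = 0" "H 0 = 0" and e: "\<And>q. norm (e q) \<le> 1"
    and g: "\<And>s t. 0 \<le> s \<Longrightarrow> s \<le> t \<Longrightarrow> t \<le> T \<Longrightarrow> norm (g t - g s) \<le> (V t - V s) + (H t - H s)"
    and B: "(\<Sum>q\<in>I. (V q - V (prv P q)) - (g q - g (prv P q)) \<bullet> e q) \<le> B"
  shows "(\<Sum>q\<in>I. csum Q (prv P q) q (\<lambda>r s. norm ((g s - g r) - (V s - V r) *\<^sub>R e q))) \<le>
    sqrt (2 * V T) * sqrt (B + H T) + H T"
proof -
  have fin: "finite P" "0 \<in> P" "T \<in> P" "P \<subseteq> {0..T}" "finite Q" "Q \<subseteq> {0..T}"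
    using P Q by (auto simp: is_part_def)
  have V: "0 \<le> V s - V r" and H: "0 \<le> H s - H r" if "r \<le> s" for r s
    using monoD[OF mono(1) that] monoD[OF mono(2) that] by auto
  have cell: "prv P q \<in> P" "0 \<le> prv P q" "prv P q \<le> q" "q \<in> P" "q \<le> T" if "q \<in> P \<inter> {0<..T}" for q
    using prv[OF fin(1,2), of q] that by auto
  have total: "(\<Sum>q\<in>I. G q - G (prv P q)) \<le> G T" if G: "mono G" "G 0 = 0" for G :: "real \<Rightarrow> real"
  proof -
    have "(\<Sum>q\<in>I. G q - G (prv P q)) \<le> csum P 0 T (\<lambda>p q. G q - G p)"
      unfolding csum_def
    proof (rule sum_mono2[OF _ I])
      fix q assume "q \<in> P \<inter> {0<..T} - I"
      then have "q \<in> P \<inter> {0<..T}" by blast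
      from monoD[OF G(1) cell(3)[OF this]] show "0 \<le> G q - G (prv P q)" by simp
    qed (use fin in simp)
    then show ?thesis using csum_telescope[OF fin(1-3), of G] T G(2) by simp
  qed
  let ?t = "\<lambda>q. (V q - V (prv P q)) + (H q - H (prv P q)) - (g q - g (prv P q)) \<bullet> e q"
  have "(\<Sum>q\<in>I. csum Q (prv P q) q (\<lambda>r s. norm ((g s - g r) - (V s - V r) *\<^sub>R e q))) \<le>
    (\<Sum>q\<in>I. sqrt (2 * (V q - V (prv P q))) * sqrt (?t q) + (H q - H (prv P q)))"
  proof (rule sum_mono)
    fix q assume "q \<in> I"
    then have q: "q \<in> P \<inter> {0<..T}" using I by auto
    show "csum Q (prv P q) q (\<lambda>r s. norm ((g s - g r) - (V s - V r) *\<^sub>R e q)) \<le>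
      sqrt (2 * (V q - V (prv P q))) * sqrt (?t q) + (H q - H (prv P q))"
      using cell[OF q] Q(2) fin by (intro cell_deviation mono e g) auto
  qed
  also have "\<dots> = (\<Sum>q\<in>I. sqrt (2 * (V q - V (prv P q))) * sqrt (?t q)) + (\<Sum>q\<in>I. H q - H (prv P q))"
    by (rule sum.distrib)
  also have "(\<Sum>q\<in>I. H q - H (prv P q)) \<le> H T" by (rule total[OF mono(2) zero(2)])
  also have "(\<Sum>q\<in>I. sqrt (2 * (V q - V (prv P q))) * sqrt (?t q)) \<le> sqrt (2 * V T) * sqrt (B + H T)"
  proof (rule sum_sqrt_le)
    fix q assume "q \<in> I"
    then have q: "q \<in> P \<inter> {0<..T}" using I by auto
    show "0 \<le> 2 * (V q - V (prv P q))" using V[OF cell(3)[OF q]] by simp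
    show "0 \<le> ?t q" using cell[OF q] V H by (intro deviation_from_direction(1) e g) auto
  next
    show "(\<Sum>q\<in>I. 2 * (V q - V (prv P q))) \<le> 2 * V T"
      unfolding sum_distrib_left[symmetric] using total[OF mono(1) zero(1)] by simp
    have "(\<Sum>q\<in>I. ?t q) = (\<Sum>q\<in>I. (V q - V (prv P q)) - (g q - g (prv P q)) \<bullet> e q) + (\<Sum>q\<in>I. H q - H (prv P q))"
      unfolding sum.distrib[symmetric] by (rule sum.cong) auto
    then show "(\<Sum>q\<in>I. ?t q) \<le> B + H T" using B total[OF mono(2) zero(2)] by linarith
  qed
  finally show ?thesis by simp
qed

text \<open>Both \<open>w\<close> and \<open>w'\<close> are compared with the same directions, those
  of the increments of \<open>w\<close> over the cells of \<open>P\<close>. The constants: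
  \<open>3 \<rho>\<close> for \<open>x\<close> is the initial error plus twice the variation of
  \<open>u' - u\<close>; \<open>y = u - x\<close> gives \<open>4 \<rho>\<close>,
  \<open>w = u - 2 x\<close> gives \<open>7 \<rho>\<close>, and increments of \<open>w\<close> give
  \<open>14 \<rho>\<close>.\<close>

lemma play_increment_stability:
  fixes u u' :: "real \<Rightarrow> 'a::real_inner"
  assumes A: "regular T u Z z0 y" and B: "regular T u' Z z0' y'"
    and bv: "bounded_variation T (\<lambda>t. u' t - u t)" "bounded_variation T (\<lambda>t. y' t - y t)"
    and P: "is_part T P" "D \<subseteq> P"
    and good: "(\<Sum>q\<in>P \<inter> {0<..T} - D. (cumvar T u q - cumvar T u (prv P q)) -
        norm (regular.w u y q - regular.w u y (prv P q))) \<le> e"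
    and jumps: "(\<Sum>q\<in>P \<inter> {0<..T} \<inter> D. lft (cumvar T u) q - cumvar T u (prv P q)) \<le> e"
    and \<rho>: "norm (z0' - z0) \<le> \<rho>" "\<And>t. t \<in> {0..T} \<Longrightarrow> norm (u' t - u t) \<le> \<rho>"
      "cumvar T (\<lambda>t. u' t - u t) T \<le> \<rho>"
  shows "t \<in> {0..T} \<Longrightarrow> norm (y' t - y t) \<le> 4 * \<rho>"
    and "variation (\<lambda>t. y' t - y t) {0..T} \<le>
      ennreal (2 * (sqrt (2 * cumvar T u T) * sqrt (e + 14 * real (card P) * \<rho> + \<rho>)) + 2 * e + 14 * real (card P) * \<rho> + 4 * \<rho>)"
proof -
  interpret A: regular T u Z z0 y by (rule A)
  interpret B: regular T u' Z z0' y' by (rule B)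
  interpret d: bounded_variation T "\<lambda>t. u' t - u t" by (rule bv(1))
  define H where "H = cumvar T (\<lambda>t. u' t - u t)"
  define N where "N = real (card P)"
  have T: "0 < T" by (rule A.T)
  have \<rho>0: "0 \<le> \<rho>" using \<rho>(1) norm_ge_zero order_trans by blast
  have H: "mono H" "H 0 = 0" "H T \<le> \<rho>" "0 \<le> H T"
    unfolding H_def using d.mono_cumvar d.cumvar_eq_0[of 0] \<rho>(3) d.cumvar_nonneg by auto
  have Vmono: "mono A.V" "A.V 0 = 0" using A.mono_cumvar A.cumvar_eq_0[of 0] by auto
  have x: "norm (B.x t - A.x t) \<le> 3 * \<rho>" if t: "t \<in> {0..T}" for t
  proof -
    have "A.x 0 = z0" "B.x 0 = z0'"
      using A.reg B.reg by (auto simp: A.x_def B.x_def regular_solution_def)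
    then show ?thesis
      using sweep_stability[OF B.ctrl A.ctrl B.sweep A.sweep bv t] \<rho>(1,3)
      unfolding A.x_def[symmetric] B.x_def[symmetric] by simp
  qed
  show y: "norm (y' t - y t) \<le> 4 * \<rho>" if t: "t \<in> {0..T}" for t
  proof -
    have "y' t - y t = (u' t - u t) - (B.x t - A.x t)" by (simp add: A.x_def B.x_def)
    then have "norm (y' t - y t) \<le> norm (u' t - u t) + norm (B.x t - A.x t)"
      by (metis norm_triangle_ineq4)
    then show ?thesis using \<rho>(2)[OF t] x[OF t] by simp
  qed
  have w: "norm (B.w t - A.w t) \<le> 7 * \<rho>" if t: "t \<in> {0..T}" for t
  proof -
    have "B.w t - A.w t = (u' t - u t) - 2 *\<^sub>R (B.x t - A.x t)"
      by (simp add: A.w_def B.w_def A.x_def B.x_def scaleR_2 algebra_simps)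
    then have "norm (B.w t - A.w t) \<le> norm (u' t - u t) + norm (2 *\<^sub>R (B.x t - A.x t))"
      by (metis norm_triangle_ineq4)
    then show ?thesis using \<rho>(2)[OF t] x[OF t] by simp
  qed
  have w_diff: "norm ((B.w t - B.w s) - (A.w t - A.w s)) \<le> 14 * \<rho>" if "s \<in> {0..T}" "t \<in> {0..T}" for s t
  proof -
    have "norm ((B.w t - B.w s) - (A.w t - A.w s)) \<le> norm (B.w t - A.w t) + norm (B.w s - A.w s)" by norm
    then show ?thesis using w[OF that(1)] w[OF that(2)] by simp
  qed
  \<comment> \<open>The increments of \<open>w'\<close> are measured by the variation of
    \<open>u\<close> rather than that of \<open>u'\<close>; the excess is the variation
    \<open>H\<close> of the difference.\<close>
  have B_dom: "norm (B.w t - B.w s) \<le> (A.V t - A.V s) + (H t - H s)" if st: "0 \<le> s" "s \<le> t" "t \<le> T" for s t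
  proof -
    have "B.V t - B.V s \<le> (A.V t - A.V s) + (H t - H s)"
    proof (rule B.cumvar_increment_le[OF st, of "{}"])
      fix Q assume Q: "finite Q" "Q \<subseteq> {s..t}" "s \<in> Q" "t \<in> Q"
      have "csum Q s t (\<lambda>p q. norm (u' q - u' p)) \<le>
        csum Q s t (\<lambda>p q. norm (u q - u p) + norm ((u' q - u q) - (u' p - u p)))"
      proof (rule csum_mono[OF Q(1,3)])
        fix p q
        show "norm (u' q - u' p) \<le> norm (u q - u p) + norm ((u' q - u q) - (u' p - u p))"
          using norm_triangle_ineq[of "u q - u p" "(u' q - u q) - (u' p - u p)"] by simp
      qed
      also have "\<dots> \<le> (A.V t - A.V s) + (H t - H s)"
        unfolding csum_add H_def using Q st by (intro add_mono A.csum_le_cumvar d.csum_le_cumvar) auto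
      finally show "csum Q s t (\<lambda>p q. norm (u' q - u' p)) \<le> (A.V t - A.V s) + (H t - H s)" .
    qed auto
    then show ?thesis using B.dom_w[OF st] by simp
  qed
  have A_dom: "norm (A.w t - A.w s) \<le> (A.V t - A.V s) + (H t - H s)" if st: "0 \<le> s" "s \<le> t" "t \<le> T" for s t
    using A.dom_w[OF st] monoD[OF H(1) st(2)] by simp
  have fin: "finite P" "0 \<in> P" "T \<in> P" "P \<subseteq> {0..T}" using P by (auto simp: is_part_def)
  define I where "I = P \<inter> {0<..T} - D"
  define J where "J = P \<inter> {0<..T} \<inter> D"
  have IJ: "finite I" "finite J" "I \<inter> J = {}" "P \<inter> {0<..T} = I \<union> J" "I \<subseteq> P \<inter> {0<..T}" "J \<subseteq> P \<inter> {0<..T}"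
    using fin by (auto simp: I_def J_def)
  have cell: "prv P q \<in> P" "0 \<le> prv P q" "prv P q < q" "q \<in> P" "q \<le> T" if "q \<in> P \<inter> {0<..T}" for q
    using prv[OF fin(1,2), of q] that by auto
  have cardI: "real (card I) \<le> N" "real (card J) \<le> N"
    unfolding N_def using fin by (auto simp: I_def J_def intro!: card_mono)
  define c where "c q = sgn (A.w q - A.w (prv P q))" for q
  have c: "norm (c q) \<le> 1" for q by (simp add: c_def norm_sgn)
  have wc: "(A.w q - A.w (prv P q)) \<bullet> c q = norm (A.w q - A.w (prv P q))" for q
    by (cases "A.w q - A.w (prv P q) = 0") (simp_all add: c_def sgn_div_norm power2_norm_eq_inner[symmetric] power2_eq_square)
  have goodA: "(\<Sum>q\<in>I. (A.V q - A.V (prv P q)) - (A.w q - A.w (prv P q)) \<bullet> c q) \<le> e + 14 * N * \<rho>"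
  proof -
    have "0 \<le> 14 * N * \<rho>" using \<rho>0 by (simp add: N_def)
    then show ?thesis using good unfolding wc I_def by linarith
  qed
  \<comment> \<open>The direction belongs to \<open>w\<close>. Replacing \<open>w\<close> by
    \<open>w'\<close> changes each component along it by at most \<open>14 \<rho>\<close>, and there
    are at most \<open>N\<close> cells.\<close>
  have goodB: "(\<Sum>q\<in>I. (A.V q - A.V (prv P q)) - (B.w q - B.w (prv P q)) \<bullet> c q) \<le> e + 14 * N * \<rho>"
  proof -
    have "(\<Sum>q\<in>I. (A.V q - A.V (prv P q)) - (B.w q - B.w (prv P q)) \<bullet> c q) \<le>
      (\<Sum>q\<in>I. ((A.V q - A.V (prv P q)) - norm (A.w q - A.w (prv P q))) + 14 * \<rho>)"
    proof (rule sum_mono)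
      fix q assume "q \<in> I"
      then have q: "q \<in> P \<inter> {0<..T}" using IJ by auto
      let ?\<Delta> = "(B.w q - B.w (prv P q)) - (A.w q - A.w (prv P q))"
      have "- (?\<Delta> \<bullet> c q) \<le> norm ?\<Delta> * norm (c q)" using Cauchy_Schwarz_ineq2[of ?\<Delta> "c q"] by linarith
      also have "\<dots> \<le> norm ?\<Delta> * 1" by (intro mult_left_mono c) simp
      also have "\<dots> \<le> 14 * \<rho>" using w_diff[of "prv P q" q] cell[OF q] by simp
      finally have "- (?\<Delta> \<bullet> c q) \<le> 14 * \<rho>" .
      moreover have "?\<Delta> \<bullet> c q = (B.w q - B.w (prv P q)) \<bullet> c q - norm (A.w q - A.w (prv P q))"
        by (simp only: inner_diff_left[of "B.w q - B.w (prv P q)"] wc)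
      ultimately show "(A.V q - A.V (prv P q)) - (B.w q - B.w (prv P q)) \<bullet> c q \<le>
        ((A.V q - A.V (prv P q)) - norm (A.w q - A.w (prv P q))) + 14 * \<rho>" by linarith
    qed
    also have "\<dots> \<le> e + real (card I) * (14 * \<rho>)" using good by (simp add: sum.distrib I_def)
    also have "\<dots> \<le> e + N * (14 * \<rho>)" using cardI \<rho>0 by (intro add_left_mono mult_right_mono) auto
    finally show ?thesis by (simp add: algebra_simps)
  qed
  let ?dw = "\<lambda>t. B.w t - A.w t"
  let ?S = "sqrt (2 * A.V T) * sqrt (e + 14 * N * \<rho> + \<rho>)"
  have main: "csum Q 0 T (\<lambda>p q. norm (?dw q - ?dw p)) \<le> 2 * ?S + 2 * e + 14 * N * \<rho> + 3 * \<rho>"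
    if Q: "is_part T Q" "P \<subseteq> Q" for Q
  proof -
    have Qfin: "finite Q" "0 \<in> Q" "T \<in> Q" "Q \<subseteq> {0..T}" using Q by (auto simp: is_part_def)
    let ?F = "\<lambda>p q. norm (?dw q - ?dw p)"
    have S: "sqrt (2 * A.V T) * sqrt (e + 14 * N * \<rho> + H T) \<le> ?S"
      using H(3) A.cumvar_nonneg[of T] by (intro mult_left_mono real_sqrt_le_mono) auto
    have "csum Q 0 T ?F = csum P 0 T (\<lambda>p q. csum Q p q ?F)"
      using T by (intro csum_nested[symmetric] Qfin Q fin) auto
    then have split: "csum Q 0 T ?F = (\<Sum>q\<in>I. csum Q (prv P q) q ?F) + (\<Sum>q\<in>J. csum Q (prv P q) q ?F)"
      unfolding csum_def[of P] IJ(4) sum.union_disjoint[OF IJ(1-3)] .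
    have "(\<Sum>q\<in>I. csum Q (prv P q) q ?F) \<le>
      (\<Sum>q\<in>I. csum Q (prv P q) q (\<lambda>r s. norm ((B.w s - B.w r) - (A.V s - A.V r) *\<^sub>R c q))
        + csum Q (prv P q) q (\<lambda>r s. norm ((A.w s - A.w r) - (A.V s - A.V r) *\<^sub>R c q)))"
    proof (rule sum_mono)
      fix q assume "q \<in> I"
      then have q: "q \<in> P \<inter> {0<..T}" using IJ by auto
      have "norm (?dw s - ?dw r) \<le> norm ((B.w s - B.w r) - k) + norm ((A.w s - A.w r) - k)" for r s k
        by norm
      then show "csum Q (prv P q) q ?F \<le> csum Q (prv P q) q (\<lambda>r s. norm ((B.w s - B.w r) - (A.V s - A.V r) *\<^sub>R c q))
        + csum Q (prv P q) q (\<lambda>r s. norm ((A.w s - A.w r) - (A.V s - A.V r) *\<^sub>R c q))"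
        unfolding csum_add[symmetric] using cell[OF q] Q Qfin by (intro csum_mono) auto
    qed
    then have onI: "(\<Sum>q\<in>I. csum Q (prv P q) q ?F) \<le> (?S + \<rho>) + (?S + \<rho>)"
      unfolding sum.distrib
      using total_deviation[OF P(1) Q T IJ(5) Vmono(1) H(1) Vmono(2) H(2) c B_dom goodB]
        total_deviation[OF P(1) Q T IJ(5) Vmono(1) H(1) Vmono(2) H(2) c A_dom goodA] S H(3)
      by linarith
    \<comment> \<open>In a jump cell only the last subcell of \<open>Q\<close> sees the atom at
      \<open>q\<close>, and there the sup norm bound is used. The other subcells end strictly before
      \<open>q\<close>, where \<open>dV\<close> has little mass.\<close>
    have "(\<Sum>q\<in>J. csum Q (prv P q) q ?F) \<le>
      (\<Sum>q\<in>J. 2 * (lft A.V q - A.V (prv P q)) + (H q - H (prv P q)) + 14 * \<rho>)"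
    proof (rule sum_mono)
      fix q assume "q \<in> J"
      then have q: "q \<in> P \<inter> {0<..T}" using IJ by auto
      note cq = cell[OF q]
      have pQ: "prv P q \<in> Q" "q \<in> Q" using cq Q by auto
      note r = prv[OF Qfin(1) pQ(1) cq(3)]
      have last: "csum Q (prv P q) q ?F = csum Q (prv P q) (prv Q q) ?F + ?F (prv Q q) q"
        by (rule csum_last[OF Qfin(1) pQ cq(3)])
      have "?F (prv Q q) q = norm ((B.w q - B.w (prv Q q)) - (A.w q - A.w (prv Q q)))"
        by (simp add: algebra_simps)
      then have jump: "?F (prv Q q) q \<le> 14 * \<rho>"
        using w_diff[of "prv Q q" q] cq r by simp
      have "csum Q (prv P q) (prv Q q) ?F \<le>
        csum Q (prv P q) (prv Q q) (\<lambda>r s. 2 * (A.V s - A.V r) + (H s - H r))"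
      proof (rule csum_mono[OF Qfin(1) pQ(1)])
        fix s t assume st: "s \<in> Q" "t \<in> Q" "prv P q \<le> s" "s < t" "t \<le> prv Q q"
        have "?F s t \<le> norm (B.w t - B.w s) + norm (A.w t - A.w s)" by norm
        then show "?F s t \<le> 2 * (A.V t - A.V s) + (H t - H s)"
          using B_dom[of s t] A.dom_w[of s t] st cq r by simp
      qed
      also have "\<dots> = 2 * (A.V (prv Q q) - A.V (prv P q)) + (H (prv Q q) - H (prv P q))"
        using Qfin pQ r by (simp add: csum_add csum_cmult csum_telescope)
      also have "\<dots> \<le> 2 * (lft A.V q - A.V (prv P q)) + (H q - H (prv P q))"
        using lft_ge[OF Vmono(1) r(3)] monoD[OF H(1), of "prv Q q" q] r by simp
      finally show "csum Q (prv P q) q ?F \<le> 2 * (lft A.V q - A.V (prv P q)) + (H q - H (prv P q)) + 14 * \<rho>"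
        unfolding last using jump by linarith
    qed
    also have "\<dots> = 2 * (\<Sum>q\<in>J. lft A.V q - A.V (prv P q)) + (\<Sum>q\<in>J. H q - H (prv P q)) + real (card J) * (14 * \<rho>)"
      unfolding sum.distrib sum_distrib_left by simp
    finally have onJ: "(\<Sum>q\<in>J. csum Q (prv P q) q ?F) \<le>
      2 * (\<Sum>q\<in>J. lft A.V q - A.V (prv P q)) + (\<Sum>q\<in>J. H q - H (prv P q)) + real (card J) * (14 * \<rho>)" .
    have "(\<Sum>q\<in>J. H q - H (prv P q)) \<le> csum P 0 T (\<lambda>p q. H q - H p)"
      unfolding csum_def
    proof (rule sum_mono2[OF _ IJ(6)])
      fix q assume "q \<in> P \<inter> {0<..T} - J"
      then have "q \<in> P \<inter> {0<..T}" by blast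
      from monoD[OF H(1) less_imp_le[OF cell(3)[OF this]]] show "0 \<le> H q - H (prv P q)" by simp
    qed (use fin in simp)
    then have HJ: "(\<Sum>q\<in>J. H q - H (prv P q)) \<le> \<rho>"
      using csum_telescope[OF fin(1-3), of H] T H by simp
    have "real (card J) * (14 * \<rho>) \<le> N * (14 * \<rho>)" using cardI \<rho>0 by (intro mult_right_mono) auto
    then have NJ: "real (card J) * (14 * \<rho>) \<le> 14 * N * \<rho>" by simp
    show ?thesis unfolding split using onI onJ HJ NJ jumps unfolding J_def[symmetric] by linarith
  qed
  show "variation (\<lambda>t. y' t - y t) {0..T} \<le>
      ennreal (2 * (sqrt (2 * A.V T) * sqrt (e + 14 * real (card P) * \<rho> + \<rho>)) + 2 * e + 14 * real (card P) * \<rho> + 4 * \<rho>)"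
  \<comment> \<open>Taking \<open>R = P\<close> restricts attention to refinements of
    \<open>P\<close>, for which \<open>main\<close> is available.\<close>
  proof (rule variation_le[OF fin(1,4)])
    fix Q assume Q: "finite Q" "Q \<subseteq> {0..T}" "P \<subseteq> Q" "0 \<in> Q" "T \<in> Q"
    let ?du = "\<lambda>t. u' t - u t"
    have "csum Q 0 T (\<lambda>p q. norm ((y' q - y q) - (y' p - y p))) \<le>
      csum Q 0 T (\<lambda>p q. norm (?dw q - ?dw p) + norm (?du q - ?du p))"
    proof (rule csum_mono[OF Q(1,4)])
      fix p q
      have "2 *\<^sub>R ((y' q - y q) - (y' p - y p)) = (?dw q - ?dw p) + (?du q - ?du p)"
        by (simp add: A.w_def B.w_def A.x_def B.x_def scaleR_2)
      then have "2 * norm ((y' q - y q) - (y' p - y p)) = norm ((?dw q - ?dw p) + (?du q - ?du p))"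
        by (metis abs_numeral norm_scaleR)
      also have "\<dots> \<le> norm (?dw q - ?dw p) + norm (?du q - ?du p)" by (rule norm_triangle_ineq)
      finally show "norm ((y' q - y q) - (y' p - y p)) \<le> norm (?dw q - ?dw p) + norm (?du q - ?du p)"
        using norm_ge_zero[of "(y' q - y q) - (y' p - y p)"] by linarith
    qed
    also have "csum Q 0 T (\<lambda>p q. norm (?dw q - ?dw p) + norm (?du q - ?du p)) \<le>
      (2 * ?S + 2 * e + 14 * N * \<rho> + 3 * \<rho>) + \<rho>"
      unfolding csum_add
    proof (rule add_mono)
      show "csum Q 0 T (\<lambda>p q. norm (?dw q - ?dw p)) \<le> 2 * ?S + 2 * e + 14 * N * \<rho> + 3 * \<rho>"
        using Q by (intro main) (auto simp: is_part_def)
      have "csum Q 0 T (\<lambda>p q. norm (?du q - ?du p)) \<le> H T - H 0"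
        unfolding H_def using Q T by (intro d.csum_le_cumvar) auto
      then show "csum Q 0 T (\<lambda>p q. norm (?du q - ?du p)) \<le> \<rho>" using H by simp
    qed
    finally show "csum Q 0 T (\<lambda>p q. norm ((y' q - y q) - (y' p - y p))) \<le>
      2 * (sqrt (2 * A.V T) * sqrt (e + 14 * real (card P) * \<rho> + \<rho>)) + 2 * e + 14 * real (card P) * \<rho> + 4 * \<rho>"
      by (simp add: N_def)
  qed (use T in simp)
qed

lemma bv_dist_bounds:
  fixes f g :: "real \<Rightarrow> 'a::real_normed_vector"
  assumes "f \<in> BVr T" "g \<in> BVr T" "0 < T"
  shows "t \<in> {0..T} \<Longrightarrow> norm (f t - g t) \<le> bv_dist T f g"
    and "cumvar T (\<lambda>t. f t - g t) T \<le> bv_dist T f g"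
proof -
  let ?h = "\<lambda>t. f t - g t"
  let ?S = "SUP t\<in>{0..T}. ennreal (norm (?h t))"
  have var: "variation ?h {0..T} < \<infinity>" using assms unfolding BVr_def by (blast intro: variation_diff_finite)
  have sup: "?S < \<infinity>" by (rule sup_norm_finite[OF var])
  have eq: "ennreal (bv_dist T f g) = ?S + variation ?h {0..T}"
    using var sup by (simp add: bv_dist_def bv_norm_def)
  have nonneg: "0 \<le> bv_dist T f g" by (simp add: bv_dist_def bv_norm_def)
  show "norm (f t - g t) \<le> bv_dist T f g" if "t \<in> {0..T}"
  proof -
    have "ennreal (norm (?h t)) \<le> ?S" using that by (rule SUP_upper)
    also have "\<dots> \<le> ennreal (bv_dist T f g)" unfolding eq by simp
    finally show ?thesis using nonneg by simp
  qed
  have "ennreal (cumvar T ?h T) = variation ?h {0..T}"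
    unfolding cumvar_def using var by simp
  also have "\<dots> \<le> ennreal (bv_dist T f g)" unfolding eq by simp
  finally show "cumvar T ?h T \<le> bv_dist T f g" using nonneg by simp
qed

lemma bv_dist_le:
  fixes f g :: "real \<Rightarrow> 'a::real_normed_vector"
  assumes "\<And>t. t \<in> {0..T} \<Longrightarrow> norm (f t - g t) \<le> a" "variation (\<lambda>t. f t - g t) {0..T} \<le> ennreal b" "0 \<le> a" "0 \<le> b"
  shows "bv_dist T f g \<le> a + b"
proof -
  have "(SUP t\<in>{0..T}. ennreal (norm (f t - g t))) \<le> ennreal a"
    using assms by (intro SUP_least) (auto intro: ennreal_leI)
  then have "(SUP t\<in>{0..T}. ennreal (norm (f t - g t))) + variation (\<lambda>t. f t - g t) {0..T} \<le> ennreal (a + b)"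
    using assms by (simp add: add_mono)
  then show ?thesis
    unfolding bv_dist_def bv_norm_def using assms by (intro enn2real_leI) auto
qed

text \<open>The partition is selected for \<open>u\<close> alone, before any neighbour is
  considered. Only then is \<rho> chosen, small in comparison with the inverse of its number of
  points.\<close>

lemma play_continuous_at:
  fixes Z :: "'a::{real_inner, banach} set"
  assumes Z: "Z \<noteq> {}" "closed Z" "convex Z" and T: "0 < T"
    and z0: "z0 \<in> Z" and u: "u \<in> BVr T" and \<epsilon>: "0 < \<epsilon>"
  obtains \<rho> where "0 < \<rho>" "\<And>z0' u'. z0' \<in> Z \<Longrightarrow> u' \<in> BVr T \<Longrightarrow> norm (z0' - z0) < \<rho> \<Longrightarrow>
    bv_dist T u' u < \<rho> \<Longrightarrow> bv_dist T (play T Z z0' u') (play T Z z0 u) < \<epsilon>"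
proof -
  have reg: "regular T u Z z0 (play T Z z0 u)" if "z0 \<in> Z" "u \<in> BVr T" for z0 u
    unfolding regular_def regular_axioms_def
    using play_regular_solution(2)[OF Z that T] BVr_bounded_variation[OF that(2) T] BVr_control[OF that(2) T] by blast
  interpret A: regular T u Z z0 "play T Z z0 u" by (rule reg[OF z0 u])
  have "((\<lambda>e. 2 * (sqrt (2 * A.V T) * sqrt (2 * e)) + 3 * e) \<longlongrightarrow> 2 * (sqrt (2 * A.V T) * sqrt (2 * 0)) + 3 * 0) (at_right 0)"
    by (intro tendsto_intros)
  then have "((\<lambda>e. 2 * (sqrt (2 * A.V T) * sqrt (2 * e)) + 3 * e) \<longlongrightarrow> 0) (at_right 0)" by simp
  then have "eventually (\<lambda>e. 2 * (sqrt (2 * A.V T) * sqrt (2 * e)) + 3 * e < \<epsilon>) (at_right 0)"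
    using \<epsilon> by (rule order_tendstoD(2))
  moreover have "eventually (\<lambda>e. 0 < e) (at_right (0::real))" by (rule eventually_at_right_less)
  ultimately have "eventually (\<lambda>e. 0 < e \<and> 2 * (sqrt (2 * A.V T) * sqrt (2 * e)) + 3 * e < \<epsilon>) (at_right 0)"
    by eventually_elim simp
  then obtain e where e: "0 < e" "2 * (sqrt (2 * A.V T) * sqrt (2 * e)) + 3 * e < \<epsilon>"
    using eventually_happens'[OF trivial_limit_at_right_real] by blast
  obtain P D where P: "is_part T P" "D \<subseteq> P"
    "(\<Sum>q\<in>P \<inter> {0<..T} - D. (A.V q - A.V (prv P q)) - norm (A.w q - A.w (prv P q))) \<le> e"
    "(\<Sum>q\<in>P \<inter> {0<..T} \<inter> D. lft A.V q - A.V (prv P q)) \<le> e"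
    using A.near_optimal_partition[OF e(1)] by blast
  define N where "N = real (card P)"
  \<comment> \<open>The choice gives \<open>14 N \<rho> + 8 \<rho> = e\<close>. The
    \<open>8 \<rho>\<close> combines \<open>4 \<rho>\<close> from the sup norm with
    \<open>4 \<rho>\<close> from the variation, and the argument of the second root stays below
    \<open>2 e\<close>.\<close>
  define \<rho> where "\<rho> = e / (14 * N + 8)"
  have N: "0 \<le> N" by (simp add: N_def)
  have \<rho>: "0 < \<rho>" "14 * N * \<rho> + 8 * \<rho> = e"
  proof -
    have "0 < 14 * N + 8" using N by simp
    then have "0 < \<rho>" "(14 * N + 8) * \<rho> = e" using e(1) unfolding \<rho>_def by simp_all
    then show "0 < \<rho>" "14 * N * \<rho> + 8 * \<rho> = e" by (simp_all only: distrib_right)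
  qed
  show thesis
  proof (rule that[OF \<rho>(1)])
    fix z0' u' assume z0': "z0' \<in> Z" and u': "u' \<in> BVr T" and near: "norm (z0' - z0) < \<rho>" "bv_dist T u' u < \<rho>"
    let ?b = "2 * (sqrt (2 * A.V T) * sqrt (e + 14 * N * \<rho> + \<rho>)) + 2 * e + 14 * N * \<rho> + 4 * \<rho>"
    have bv: "bounded_variation T (\<lambda>t. u' t - u t)"
      "bounded_variation T (\<lambda>t. play T Z z0' u' t - play T Z z0 u t)"
      using play_regular_solution(1)[OF Z z0' u' T] play_regular_solution(1)[OF Z z0 u T] u u' T
      by (blast intro: BVr_diff_bounded_variation)+
    have du: "norm (u' t - u t) \<le> \<rho>" if "t \<in> {0..T}" for t
      using bv_dist_bounds(1)[OF u' u T that] near by simp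
    have dV: "cumvar T (\<lambda>t. u' t - u t) T \<le> \<rho>"
      using bv_dist_bounds(2)[OF u' u T] near by simp
    note stab = play_increment_stability[OF reg[OF z0 u] reg[OF z0' u'] bv P less_imp_le[OF near(1)] du dV, folded N_def]
    have "bv_dist T (play T Z z0' u') (play T Z z0 u) \<le> 4 * \<rho> + ?b"
      using stab e \<rho> N A.cumvar_nonneg[of T] by (intro bv_dist_le) auto
    also have "\<dots> \<le> 2 * (sqrt (2 * A.V T) * sqrt (2 * e)) + 3 * e"
    proof -
      have "sqrt (2 * A.V T) * sqrt (e + 14 * N * \<rho> + \<rho>) \<le> sqrt (2 * A.V T) * sqrt (2 * e)"
        using \<rho> A.cumvar_nonneg[of T] by (intro mult_left_mono real_sqrt_le_mono) auto
      then show ?thesis using \<rho> by linarith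
    qed
    also have "\<dots> < \<epsilon>" by (rule e(2))
    finally show "bv_dist T (play T Z z0' u') (play T Z z0 u) < \<epsilon>" .
  qed
qed

theorem theorem3p3:
  fixes Z :: "'a::{real_inner, banach} set" and T :: real
  assumes "Z \<noteq> {}" and "closed Z" and "convex Z" and "0 < T"
  shows "continuous_map (prod_topology (top_of_set Z) (BV_topology T)) (BV_topology T)
           (\<lambda>(z0, u). play T Z z0 u)"
proof -
  interpret M: Metric_space "BVr T :: (real \<Rightarrow> 'a) set" "bv_dist T" by (rule Metric_space_BVr)
  show ?thesis
    unfolding BV_topology_def M.continuous_map_to_metric
  proof (intro ballI allI impI)
    fix p :: "'a \<times> (real \<Rightarrow> 'a)" and \<epsilon> :: real
    assume "p \<in> topspace (prod_topology (top_of_set Z) M.mtopology)" and \<epsilon>: "0 < \<epsilon>"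
    then obtain z0 u where p: "p = (z0, u)" "z0 \<in> Z" "u \<in> BVr T" by (cases p) auto
    obtain \<rho> where \<rho>: "0 < \<rho>" "\<And>z0' u'. z0' \<in> Z \<Longrightarrow> u' \<in> BVr T \<Longrightarrow> norm (z0' - z0) < \<rho> \<Longrightarrow>
      bv_dist T u' u < \<rho> \<Longrightarrow> bv_dist T (play T Z z0' u') (play T Z z0 u) < \<epsilon>"
      using play_continuous_at[OF assms p(2,3) \<epsilon>] by blast
    let ?U = "(Z \<inter> ball z0 \<rho>) \<times> M.mball u \<rho>"
    show "\<exists>U. openin (prod_topology (top_of_set Z) M.mtopology) U \<and> p \<in> U \<and>
      (\<forall>q\<in>U. (\<lambda>(z0, u). play T Z z0 u) q \<in> M.mball ((\<lambda>(z0, u). play T Z z0 u) p) \<epsilon>)"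
    proof (intro exI[of _ ?U] conjI ballI)
      show "openin (prod_topology (top_of_set Z) M.mtopology) ?U"
        by (simp add: openin_prod_Times_iff openin_open_Int)
      show "p \<in> ?U" using p \<rho>(1) by simp
      fix q assume "q \<in> ?U"
      then obtain z0' u' where q: "q = (z0', u')" "z0' \<in> Z" "dist z0 z0' < \<rho>" "u' \<in> BVr T" "bv_dist T u u' < \<rho>"
        by (cases q) auto
      have "bv_dist T (play T Z z0' u') (play T Z z0 u) < \<epsilon>"
        using q M.commute[of u u'] by (intro \<rho>(2)) (auto simp: dist_norm norm_minus_commute)
      then show "(\<lambda>(z0, u). play T Z z0 u) q \<in> M.mball ((\<lambda>(z0, u). play T Z z0 u) p) \<epsilon>"
        using p q play_regular_solution(1)[OF assms(1-3) _ _ assms(4)] M.commute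
        by simp
    qed
  qed
qed

end
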